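(* Let $\alpha>-1$ and $1\leq p\leq\infty$ be such that either $\alpha\geq0$, or $-1<\alpha<0$ and $\frac2{\alpha+2}<p<-\frac2\alpha$. Let $\mathcal D_\alpha=t^{\alpha/2}\mathcal S^+=\{t^{\alpha/2}f : f\in\mathcal S^+\}$, where $\mathcal S^+$ consists of the restrictions to $[0,\infty)$ of the elements of the Schwartz space $\mathcal S(\mathbb R)$. Let $$T_\alpha=t\frac{d^2}{dt^2}+\frac{d}{dt}-\frac t4-\frac{\alpha^2}{4t}+\frac{\alpha+1}2,$$ and view $T_\alpha$ as an operator on $L^p([0,\infty),dt)$ with domain $\mathcal D_\alpha$. Let $T_{\alpha,c}$ be its maximal (distributional) extension on $L^p([0,\infty),dt)$ (defined in the context), and let $T_e$ be a linear operator on $L^p([0,\infty),dt)$ with $T_\alpha\subset T_e\subset T_{\alpha,c}$. Then $T_e$ has the single-valued extension property. Let $f\in\mathcal D_\alpha$, and let $\mathcal F_\alpha f:\mathbb N_0\to\mathbb C$, $\mathcal F_\alpha f(n)=\int_0^\infty f(t)\,\mathcal L_n^\alpha(t)\,dt$, be the Laguerre transform of $f$, where $\mathcal L_n^\alpha$ is the normalised generalised Laguerre function. Then the following limit exists in the extended positive real numbers $[0,\infty]$ and $$\lim_{n\to\infty}\|T_e^nf\|_p^{1/n}=\sup\left\{|z| : z\in\{-n : n\in\mathbb N_0,\ \mathcal F_\alpha f(n)\neq0\}\right\}.$$ Moreover, $$\sigma_{T_e}(f)=\{-n : n\in\mathbb N_0,\ \mathcal F_\alpha f(n)\neq0\},$$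 so that the former equality is a local spectral radius formula $\lim_{n\to\infty}\|T_e^nf\|_p^{1/n}=\sup\{|z| : z\in\sigma_{T_e}(f)\}$ for $T_e$ at $f$.
   Context: $\mathbb N_0=\{0,1,2,\ldots\}$; $\sup\emptyset=0$. For $n\in\mathbb N_0$ and $t>0$, $$\mathcal L_n^\alpha(t)=\left(\frac{n!}{\Gamma(n+\alpha+1)}\right)^{1/2}e^{-t/2}t^{\alpha/2}L_n^\alpha(t),$$ where $L_n^\alpha(t)=\frac{1}{n!}e^tt^{-\alpha}\frac{d^n}{dt^n}(e^{-t}t^{n+\alpha})$ is the generalised Laguerre polynomial of order $n$. Under the stated conditions on $\alpha$ and $p$, $\mathcal D_\alpha\subset L^p([0,\infty),dt)$ and $\mathcal D_\alpha\subset L^q([0,\infty),dt)$ with $q$ the conjugate exponent of $p$, and $T_\alpha$ maps $\mathcal D_\alpha$ into itself. $T_{\alpha,c}$ is the operator on $X=L^p([0,\infty),dt)$ whose domain consists of all $f\in X$ for which there is $h\in X$ (necessarily unique) with $\int_0^\infty h\,g\,dt=\int_0^\infty f\,(T_\alpha g)\,dt$ for all $g\in\mathcal D_\alpha$; then $T_{\alpha,c}f=h$. For operators, $A\subset B$ means that $B$ extends $A$. For a linear operator $S$ on a complex Banach space $X$ with domain $\mathcal D(S)\subset X$: $S$ has the single-valued extension property if, for every non-empty open $U\subset\mathbb C$, the only analytic $\phi:U\to\mathcal D(S)$ with $(S-z)\phi_z=0$ for all $z\in U$ is zero. For $x\in X$, $z_0\in\mathbb C$ is in the local resolvent set $\rho_S(x)$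 if there are an open neighborhood $U$ of $z_0$ and an analytic $\phi:U\to\mathcal D(S)$ with $(S-z)\phi_z=x$ for all $z\in U$; the local spectrum is $\sigma_S(x)=\mathbb C\setminus\rho_S(x)$. Analyticity is with respect to the norm of $X$ (an analytic $X$-valued function with values in $\mathcal D(S)$). *)

theory Defs
  imports "HOL-Probability.Essential_Supremum"
begin

abbreviation half_line :: "real measure"
  where "half_line \<equiv> lebesgue_on {0..}"

section \<open>Lebesgue spaces on the half line\<close>

text \<open>Since the exponent \<open>p\<close> is a term, \<open>L\<^sup>p\<close> cannot be a type depending on it. The type
  \<open>ae_fun\<close> consists of the classes modulo almost everywhere equality of all measurable complex
  functions on \<open>[0,\<infinity>)\<close> (values at negative arguments are ignored), and every \<open>L\<^sup>p\<close> is a set of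
  such classes. The class of a function \<open>f\<close> is \<open>ae_class f\<close>; this is meaningful for
  measurable \<open>f\<close> only.\<close>

quotient_type ae_fun = "real \<Rightarrow> complex" / partial:
    "\<lambda>f g. f \<in> borel_measurable half_line \<and> g \<in> borel_measurable half_line \<and>
           (AE t in half_line. f t = g t)"
  morphisms rep_ae_fun ae_class
proof (rule part_equivpI)
  show "\<exists>f. f \<in> borel_measurable half_line \<and> f \<in> borel_measurable half_line \<and>
          (AE t in half_line. f t = (f t :: complex))"
    by (rule exI[of _ "\<lambda>_. 0"]) simp
  show "symp (\<lambda>f g. f \<in> borel_measurable half_line \<and> g \<in> borel_measurable half_line \<and>
          (AE t in half_line. f t = (g t :: complex)))"
    by (auto intro!: sympI elim: eventually_mono)
  show "transp (\<lambda>f g. f \<in> borel_measurable half_line \<and> g \<in> borel_measurable half_line \<and>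
          (AE t in half_line. f t = (g t :: complex)))"
    by (auto intro!: transpI elim: eventually_elim2)
qed

instantiation ae_fun :: ab_group_add
begin

lift_definition zero_ae_fun :: ae_fun is "\<lambda>_. 0" by simp

lift_definition plus_ae_fun :: "ae_fun \<Rightarrow> ae_fun \<Rightarrow> ae_fun" is "\<lambda>f g t. f t + g t"
  by (auto elim: eventually_elim2)

lift_definition minus_ae_fun :: "ae_fun \<Rightarrow> ae_fun \<Rightarrow> ae_fun" is "\<lambda>f g t. f t - g t"
  by (auto elim: eventually_elim2)

lift_definition uminus_ae_fun :: "ae_fun \<Rightarrow> ae_fun" is "\<lambda>f t. - f t"
  by (auto elim: eventually_mono)

instance
  by standard (transfer; auto)+

end

lift_definition cscale :: "complex \<Rightarrow> ae_fun \<Rightarrow> ae_fun" is "\<lambda>c f t. c * f t"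
  by (auto elim: eventually_mono)

lift_definition Lp_enorm :: "ennreal \<Rightarrow> ae_fun \<Rightarrow> ennreal" is
  "\<lambda>p f. if p = \<infinity> then esssup half_line (\<lambda>t. ennreal (norm (f t)))
         else let I = (\<integral>\<^sup>+ t. ennreal (norm (f t) powr enn2real p) \<partial>half_line)
              in if I = \<infinity> then \<infinity> else ennreal (enn2real I powr (1 / enn2real p))"
proof -
  fix p :: ennreal and f g :: "real \<Rightarrow> complex"
  assume *: "f \<in> borel_measurable half_line \<and> g \<in> borel_measurable half_line \<and>
             (AE t in half_line. f t = g t)"
  have "esssup half_line (\<lambda>t. ennreal (norm (f t))) = esssup half_line (\<lambda>t. ennreal (norm (g t)))"
    using * by (intro esssup_AE_cong) (auto elim: eventually_mono)
  moreover have "(\<integral>\<^sup>+ t. ennreal (norm (f t) powr enn2real p) \<partial>half_line) =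
                 (\<integral>\<^sup>+ t. ennreal (norm (g t) powr enn2real p) \<partial>half_line)"
    using * by (intro nn_integral_cong_AE) (auto elim: eventually_mono)
  ultimately show "?thesis p f g" by simp
qed

definition Lp :: "ennreal \<Rightarrow> ae_fun set"
  where "Lp p = {f. Lp_enorm p f < \<infinity>}"

definition Lp_norm :: "ennreal \<Rightarrow> ae_fun \<Rightarrow> real"
  where "Lp_norm p f = enn2real (Lp_enorm p f)"

text \<open>The bilinear (not sesquilinear) pairing \<open>\<integral>\<^sub>0\<^sup>\<infinity> f g dt\<close>.\<close>

lift_definition pairing :: "ae_fun \<Rightarrow> ae_fun \<Rightarrow> complex" is
  "\<lambda>f g. (LINT t|half_line. f t * g t)"
  by (rule integral_cong_AE) (auto elim: eventually_elim2)

section \<open>Unbounded operators and local spectral theory on \<open>L\<^sup>p\<close>\<close>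

text \<open>An operator is identified with its graph: its domain is \<open>Domain T\<close>, and \<open>A \<subseteq> B\<close> says that
  \<open>B\<close> extends \<open>A\<close>.\<close>

definition linear_operator :: "ennreal \<Rightarrow> (ae_fun \<times> ae_fun) set \<Rightarrow> bool"
  where "linear_operator p T \<longleftrightarrow>
    T \<subseteq> Lp p \<times> Lp p \<and> single_valued T \<and> (0, 0) \<in> T \<and>
    (\<forall>(f, h) \<in> T. \<forall>(f', h') \<in> T. (f + f', h + h') \<in> T) \<and>
    (\<forall>c. \<forall>(f, h) \<in> T. (cscale c f, cscale c h) \<in> T)"

definition op_app :: "(ae_fun \<times> ae_fun) set \<Rightarrow> ae_fun \<Rightarrow> ae_fun"
  where "op_app T f = (THE h. (f, h) \<in> T)"

definition Lp_analytic_on :: "ennreal \<Rightarrow> complex set \<Rightarrow> (complex \<Rightarrow> ae_fun) \<Rightarrow> bool"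
  where "Lp_analytic_on p U \<phi> \<longleftrightarrow>
    (\<forall>z\<in>U. \<phi> z \<in> Lp p) \<and>
    (\<forall>z\<in>U. \<exists>d\<in>Lp p.
       ((\<lambda>w. Lp_norm p (cscale (1 / (w - z)) (\<phi> w - \<phi> z) - d)) \<longlongrightarrow> 0) (at z))"

definition has_SVEP :: "ennreal \<Rightarrow> (ae_fun \<times> ae_fun) set \<Rightarrow> bool"
  where "has_SVEP p S \<longleftrightarrow>
    (\<forall>U \<phi>. open U \<and> U \<noteq> {} \<and> Lp_analytic_on p U \<phi> \<and>
       (\<forall>z\<in>U. \<phi> z \<in> Domain S \<and> op_app S (\<phi> z) - cscale z (\<phi> z) = 0)
       \<longrightarrow> (\<forall>z\<in>U. \<phi> z = 0))"

definition local_resolvent_set :: "ennreal \<Rightarrow> (ae_fun \<times> ae_fun) set \<Rightarrow> ae_fun \<Rightarrow> complex set"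
  where "local_resolvent_set p S x =
    {z0. \<exists>U \<phi>. open U \<and> z0 \<in> U \<and> Lp_analytic_on p U \<phi> \<and>
       (\<forall>z\<in>U. \<phi> z \<in> Domain S \<and> op_app S (\<phi> z) - cscale z (\<phi> z) = x)}"

definition local_spectrum :: "ennreal \<Rightarrow> (ae_fun \<times> ae_fun) set \<Rightarrow> ae_fun \<Rightarrow> complex set"
  where "local_spectrum p S x = - local_resolvent_set p S x"

section \<open>Laguerre functions and the Laguerre operator\<close>

abbreviation vderiv :: "(real \<Rightarrow> complex) \<Rightarrow> real \<Rightarrow> complex"
  where "vderiv f \<equiv> (\<lambda>t. vector_derivative f (at t))"

definition schwartz_space :: "(real \<Rightarrow> complex) set"
  where "schwartz_space =
    {f. (\<forall>k t. (vderiv ^^ k) f differentiable (at t)) \<and>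
        (\<forall>m k. bounded (range (\<lambda>t. of_real (t ^ m) * (vderiv ^^ k) f t)))}"

text \<open>The elements of \<open>\<D>\<^sub>\<alpha>\<close> are kept as functions on \<open>\<real>\<close>; only their values on \<open>(0,\<infinity>)\<close> matter, as
  they enter exclusively through integrals over \<open>[0,\<infinity>)\<close>, through \<open>ae_class\<close>, and through
  derivatives at almost every point of \<open>[0,\<infinity>)\<close>.\<close>

definition D_space :: "real \<Rightarrow> (real \<Rightarrow> complex) set"
  where "D_space \<alpha> = {\<lambda>t. of_real (t powr (\<alpha> / 2)) * f t | f. f \<in> schwartz_space}"

definition laguerre_diff :: "real \<Rightarrow> (real \<Rightarrow> complex) \<Rightarrow> real \<Rightarrow> complex"
  where "laguerre_diff \<alpha> f t =
    of_real t * vderiv (vderiv f) t + vderiv f t - of_real (t / 4) * f t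
    - of_real (\<alpha>\<^sup>2 / (4 * t)) * f t + of_real ((\<alpha> + 1) / 2) * f t"

definition T_op :: "real \<Rightarrow> (ae_fun \<times> ae_fun) set"
  where "T_op \<alpha> = {(ae_class f, ae_class (laguerre_diff \<alpha> f)) | f. f \<in> D_space \<alpha>}"

definition T_max :: "ennreal \<Rightarrow> real \<Rightarrow> (ae_fun \<times> ae_fun) set"
  where "T_max p \<alpha> = {(f, h). f \<in> Lp p \<and> h \<in> Lp p \<and>
    (\<forall>g\<in>D_space \<alpha>. pairing h (ae_class g) = pairing f (ae_class (laguerre_diff \<alpha> g)))}"

definition laguerre_poly :: "real \<Rightarrow> nat \<Rightarrow> real \<Rightarrow> real"
  where "laguerre_poly \<alpha> n t =
    1 / fact n * exp t * t powr (- \<alpha>) * (deriv ^^ n) (\<lambda>s. exp (- s) * s powr (real n + \<alpha>)) t"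

definition laguerre_fun :: "real \<Rightarrow> nat \<Rightarrow> real \<Rightarrow> real"
  where "laguerre_fun \<alpha> n t =
    sqrt (fact n / Gamma (real n + \<alpha> + 1)) * exp (- t / 2) * t powr (\<alpha> / 2) * laguerre_poly \<alpha> n t"

definition laguerre_transform :: "real \<Rightarrow> (real \<Rightarrow> complex) \<Rightarrow> nat \<Rightarrow> complex"
  where "laguerre_transform \<alpha> f n = (LINT t|half_line. f t * of_real (laguerre_fun \<alpha> n t))"

end

theory Submission
  imports Defs "HOL-Computational_Algebra.Polynomial"
begin

text \<open>Write \<open>\<ell>\<^sub>n\<close> for the normalised Laguerre functions; they are eigenfunctions, \<open>T\<^sub>\<alpha> \<ell>\<^sub>n = - n \<ell>\<^sub>n\<close>. The
inclusions \<open>T\<^sub>\<alpha> \<subseteq> T\<^sub>e \<subseteq> T\<^bsub>\<alpha>,c\<^esub>\<close> turn the definition of \<open>T\<^bsub>\<alpha>,c\<^esub>\<close> into the identity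
\<open>\<langle>T\<^sub>e x, \<ell>\<^sub>n\<rangle> = - n \<langle>x, \<ell>\<^sub>n\<rangle>\<close> for every \<open>x\<close> in the domain of \<open>T\<^sub>e\<close> (\<open>pairing_Te_ell\<close>), without any
integration by parts. So \<open>T\<^sub>e\<close> acts on Laguerre coefficients as multiplication by \<open>- n\<close>, and the
theorem becomes a statement about sequences as soon as two facts are known.

Completeness (\<open>Lp_complete\<close>): an element of \<open>L\<^sup>p\<close> whose coefficients all vanish is zero. By the
three-term recurrence all moments of \<open>x(t) t\<^bsup>\<alpha>/2\<^esup> e\<^bsup>-t/2\<^esup>\<close> vanish, and this function still has a finite
exponential moment, so it is determined by its moments (\<open>moments_determine_real\<close>).

Synthesis (\<open>synth_D\<close>): if \<open>b\<close> decreases rapidly, then \<open>\<Sum> b\<^sub>n \<ell>\<^sub>n\<close> belongs to \<open>\<D>\<^sub>\<alpha>\<close>. All weighted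
derivatives of \<open>e\<^bsup>-t/2\<^esup> L\<^sub>n\<^sup>\<alpha>(t)\<close> are bounded on the half line by a power of \<open>n\<close>
(\<open>poly_growth_lag_fun_deriv\<close>), so the series of derivatives converge, and a function which is
smooth and rapidly decreasing up to the boundary extends to a Schwartz function on \<open>\<real>\<close> by Borel's
theorem (\<open>half_schwartz_extends\<close>). Conversely the coefficients \<open>a\<^sub>n\<close> of an element of \<open>\<D>\<^sub>\<alpha>\<close> decrease
rapidly, because \<open>T\<^sub>\<alpha>\<close> maps \<open>\<D>\<^sub>\<alpha>\<close> into itself and multiplies \<open>a\<^sub>n\<close> by \<open>- n\<close>.

If \<open>(T\<^sub>e - z) \<phi>\<^sub>z = 0\<close>, the \<open>n\<close>-th coefficient of \<open>\<phi>\<^sub>z\<close> vanishes for \<open>z \<noteq> - n\<close>, and by continuity also at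
\<open>z = - n\<close>; completeness gives the single-valued extension property. If \<open>(T\<^sub>e - z) \<phi>\<^sub>z = f\<close> at \<open>z = - n\<close>,
then \<open>a\<^sub>n = 0\<close>. Away from the points \<open>- n\<close> with \<open>a\<^sub>n \<noteq> 0\<close> the series \<open>\<phi>\<^sub>z = - \<Sum> a\<^sub>n / (n + z) \<ell>\<^sub>n\<close> is an
analytic local resolvent with values in \<open>\<D>\<^sub>\<alpha>\<close>, and completeness shows that it solves the equation.
Finally \<open>n\<^sup>k \<bar>a\<^sub>n\<bar> \<le> C\<^sub>n \<parallel>T\<^sub>e\<^sup>k f\<parallel>\<close> gives the lower bound for the local spectral radius, and if all \<open>n\<close>
with \<open>a\<^sub>n \<noteq> 0\<close> are at most \<open>M\<close>, then \<open>\<parallel>T\<^sub>e\<^sup>k f\<parallel> \<le> C M\<^sup>k\<close> gives the upper bound.\<close>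

abbreviation half_measurable :: "(real \<Rightarrow> _) set"
  where "half_measurable \<equiv> borel_measurable half_line"

section \<open>Laguerre polynomials\<close>

text \<open>The polynomial \<open>L\<^sub>n\<^sup>a\<close> by its explicit coefficients; \<open>rodrigues\<close> identifies it with the Rodrigues
formula.\<close>

definition lag_poly :: "real \<Rightarrow> nat \<Rightarrow> real poly"
  where "lag_poly a n = (\<Sum>k\<le>n. monom ((-1) ^ k / fact k * ((a + real n) gchoose (n - k))) k)"

lemma coeff_lag_poly:
  "coeff (lag_poly a n) k = (if k \<le> n then (-1) ^ k / fact k * ((a + real n) gchoose (n - k)) else 0)"
  by (simp add: lag_poly_def coeff_sum)

lemma lag_0 [simp]: "lag_poly a 0 = 1"
  by (simp add: lag_poly_def)

lemma poly_lag_at_0: "poly (lag_poly a n) 0 = (a + real n) gchoose n"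
  by (simp add: poly_0_coeff_0 coeff_lag_poly)

text \<open>On coefficients this is Pascal's rule.\<close>

lemma pderiv_lag_Suc: "pderiv (lag_poly a (Suc n)) = pderiv (lag_poly a n) - lag_poly a n"
proof (rule poly_eqI)
  fix k
  have f: "real (Suc k) * ((-1) ^ Suc k / fact (Suc k) * x) = - ((-1) ^ k / fact k * x)" for x :: real
  proof -
    have "real (Suc k) \<noteq> 0" by simp
    then show ?thesis unfolding fact_Suc of_nat_mult by (simp del: of_nat_Suc)
  qed
  consider (1) "k < n" | (2) "k = n" | (3) "k > n" by linarith
  then show "coeff (pderiv (lag_poly a (Suc n))) k = coeff (pderiv (lag_poly a n) - lag_poly a n) k"
  proof cases
    case 1
    then obtain m where m: "n = k + Suc m"
      using less_imp_Suc_add by auto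
    have "((a + real n) + 1) gchoose (Suc m) = ((a + real n) gchoose m) + ((a + real n) gchoose Suc m)"
      by (rule gbinomial_Suc_Suc)
    then have *: "(a + real (Suc n)) gchoose (Suc m) = ((a + real n) gchoose m) + ((a + real n) gchoose Suc m)"
      by (simp add: add_ac)
    have idx: "Suc n - Suc k = Suc m" "n - Suc k = m" "n - k = Suc m" "Suc k \<le> Suc n" "Suc k \<le> n" "k \<le> n"
      using m by auto
    have "coeff (pderiv (lag_poly a (Suc n))) k = - ((-1) ^ k / fact k * ((a + real (Suc n)) gchoose (Suc m)))"
      unfolding coeff_pderiv coeff_lag_poly idx(1) using idx(4) f by (simp only: if_True)
    moreover have "coeff (pderiv (lag_poly a n)) k = - ((-1) ^ k / fact k * ((a + real n) gchoose m))"
      unfolding coeff_pderiv coeff_lag_poly idx(2) using idx(5) f by (simp only: if_True)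
    moreover have "coeff (lag_poly a n) k = (-1) ^ k / fact k * ((a + real n) gchoose Suc m)"
      using idx by (simp add: coeff_lag_poly)
    ultimately show ?thesis unfolding * by (simp add: algebra_simps)
  next
    case 2
    have "coeff (pderiv (lag_poly a (Suc n))) k = - ((-1) ^ k / fact k * 1)"
      using f[of 1] 2 by (simp add: coeff_pderiv coeff_lag_poly)
    with 2 show ?thesis by (simp add: coeff_pderiv coeff_lag_poly)
  qed (simp add: coeff_pderiv coeff_lag_poly)
qed

text \<open>The lowering relation \<open>t L\<^bsub>n+1\<^esub>' = (n + 1) L\<^bsub>n+1\<^esub> - (n + 1 + a) L\<^sub>n\<close>; on coefficients it is the absorption
identity for binomials. Together with the previous lemma it yields the recurrence and the differential
equation.\<close>

lemma mult_pderiv_lag_Suc: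
  "pCons 0 (pderiv (lag_poly a (Suc n))) = smult (real (Suc n)) (lag_poly a (Suc n)) - smult (real (Suc n) + a) (lag_poly a n)"
proof (rule poly_eqI)
  fix k
  have base: "coeff (pCons 0 (pderiv (lag_poly a (Suc n)))) k = real k * coeff (lag_poly a (Suc n)) k"
    by (cases k) (simp_all add: coeff_pderiv)
  consider (1) "k \<le> n" | (2) "k = Suc n" | (3) "k > Suc n" by linarith
  then show "coeff (pCons 0 (pderiv (lag_poly a (Suc n)))) k
      = coeff (smult (real (Suc n)) (lag_poly a (Suc n)) - smult (real (Suc n) + a) (lag_poly a n)) k"
  proof cases
    case 1
    then obtain m where m: "n = k + m" using le_Suc_ex by blast
    have "real (Suc m) * ((a + real (Suc n)) gchoose Suc m) = (a + real (Suc n)) * ((a + real (Suc n) - 1) gchoose m)"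
      using gbinomial_absorption by blast
    then have "(real (Suc n) - real k) * ((a + real (Suc n)) gchoose Suc m) = (a + real (Suc n)) * ((a + real n) gchoose m)"
      using m by (simp add: algebra_simps)
    then have eq: "(-1) ^ k / fact k * ((real (Suc n) - real k) * ((a + real (Suc n)) gchoose Suc m))
       = (-1) ^ k / fact k * ((a + real (Suc n)) * ((a + real n) gchoose m))" by (rule arg_cong)
    have idx: "Suc n - k = Suc m" "n - k = m" "k \<le> Suc n" "k \<le> n" using m by auto
    define r where "r = (-1) ^ k / (fact k :: real)"
    have "coeff (lag_poly a (Suc n)) k = r * ((a + real (Suc n)) gchoose Suc m)"
      "coeff (lag_poly a n) k = r * ((a + real n) gchoose m)"
      using idx by (simp_all add: coeff_lag_poly r_def)
    with eq show ?thesis unfolding base r_def[symmetric] coeff_diff coeff_smult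
      by (simp add: algebra_simps)
  next
    case 2
    then show ?thesis unfolding base coeff_diff coeff_smult by (simp add: coeff_lag_poly)
  next
    case 3
    then show ?thesis unfolding base coeff_diff coeff_smult by (simp add: coeff_lag_poly)
  qed
qed

text \<open>The induction step of the Rodrigues formula: the right-hand side is what remains of the derivative of
\<open>e\<^bsup>-t\<^esup> t\<^bsup>b+1\<^esup> L\<^sub>n\<^bsup>b+1\<^esup>(t)\<close> after division by \<open>e\<^bsup>-t\<^esup> t\<^sup>b\<close>.\<close>

lemma lag_Suc_raise:
  "smult (real (Suc n)) (lag_poly b (Suc n)) = smult (b + 1) (lag_poly (b + 1) n) - pCons 0 (lag_poly (b + 1) n)
     + pCons 0 (pderiv (lag_poly (b + 1) n))"
proof (rule poly_eqI)
  fix k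
  have base: "coeff (pCons 0 (pderiv (lag_poly (b+1) n))) k = real k * coeff (lag_poly (b+1) n) k"
    by (cases k) (simp_all add: coeff_pderiv)
  consider (1) "k \<le> n" | (2) "k = Suc n" | (3) "k > Suc n" by linarith
  then show "coeff (smult (real (Suc n)) (lag_poly b (Suc n))) k
    = coeff (smult (b + 1) (lag_poly (b + 1) n) - pCons 0 (lag_poly (b + 1) n) + pCons 0 (pderiv (lag_poly (b + 1) n))) k"
  proof cases
    case 1
    then obtain m where m: "n = k + m" using le_Suc_ex by blast
    define N where "N = b + real (Suc n)"
    have "N * (N gchoose m) = real m * (N gchoose m) + real (Suc m) * (N gchoose Suc m)"
      by (rule gbinomial_mult_1)
    then have *: "real (Suc m) * (N gchoose Suc m) = (b + 1 + real k) * (N gchoose m)"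
      using m by (simp add: N_def algebra_simps)
    have N': "b + 1 + real n = N" by (simp add: N_def)
    show ?thesis
    proof (cases k)
      case 0
      then show ?thesis using * m
        by (simp add: coeff_lag_poly coeff_pderiv N_def add_ac)
    next
      case (Suc j)
      have idx: "Suc n - k = Suc m" "n - k = m" "n - j = Suc m" "k \<le> Suc n" "k \<le> n" "j \<le> n" using m Suc by auto
      have f: "fact k = real k * fact j" using Suc by simp
      have kpos: "real k \<noteq> 0" using Suc by simp
      have s: "(-1::real)^k = - ((-1)^j)" using Suc by simp
      have "coeff (smult (b + 1) (lag_poly (b + 1) n) - pCons 0 (lag_poly (b + 1) n) + pCons 0 (pderiv (lag_poly (b + 1) n))) k
         = (b+1+real k) * coeff (lag_poly (b+1) n) k - coeff (lag_poly (b+1) n) j"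
        unfolding coeff_add coeff_diff coeff_smult base using Suc by (simp add: algebra_simps del: coeff_lag_poly)
      also have "\<dots> = (-1)^k / fact k * ((b+1+real k) * (N gchoose m) + real k * (N gchoose Suc m))"
      proof -
        have c1: "coeff (lag_poly (b+1) n) k = (-1)^k / fact k * (N gchoose m)"
          using coeff_lag_poly[of "b+1" n k] idx unfolding N' by (simp only: if_True)
        have "coeff (lag_poly (b+1) n) j = (-1)^j / fact j * (N gchoose Suc m)"
          using coeff_lag_poly[of "b+1" n j] idx unfolding N' by (simp only: if_True)
        also have "(-1)^j / fact j = - ((-1)^k / fact k) * real k"
          unfolding f s using kpos by simp
        finally show ?thesis unfolding c1 by (simp add: algebra_simps add_divide_distrib)
      qed
      also have "(b+1+real k) * (N gchoose m) + real k * (N gchoose Suc m) = real (Suc n) * (N gchoose Suc m)"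
        unfolding *[symmetric] using m by (simp add: algebra_simps)
      also have "(-1)^k / fact k * (real (Suc n) * (N gchoose Suc m)) = coeff (smult (real (Suc n)) (lag_poly b (Suc n))) k"
        using idx by (simp add: coeff_lag_poly N_def)
      finally show ?thesis ..
    qed
  next
    case 2
    have "real (Suc n) * ((-1) ^ Suc n / fact (Suc n)) = - ((-1) ^ n / (fact n :: real))"
    proof -
      have "real (Suc n) \<noteq> 0" by simp
      then show ?thesis unfolding fact_Suc of_nat_mult by (simp del: of_nat_Suc)
    qed
    with 2 show ?thesis by (simp add: coeff_lag_poly coeff_pderiv)
  next
    case 3
    then obtain j where "k = Suc j" by (cases k) auto
    with 3 show ?thesis by (simp add: coeff_lag_poly coeff_pderiv)
  qed
qed

lemma lag_three_term:
  "(real n + 2) * poly (lag_poly a (Suc (Suc n))) t =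
     (2 * real n + 3 + a - t) * poly (lag_poly a (Suc n)) t - (real n + 1 + a) * poly (lag_poly a n) t"
proof -
  have 1: "t * poly (pderiv (lag_poly a (Suc (Suc n)))) t =
      (real n + 2) * poly (lag_poly a (Suc (Suc n))) t - (real n + 2 + a) * poly (lag_poly a (Suc n)) t"
    using arg_cong[OF mult_pderiv_lag_Suc[of a "Suc n"], of "\<lambda>p. poly p t"] by (simp add: algebra_simps)
  have 2: "t * poly (pderiv (lag_poly a (Suc n))) t =
      (real n + 1) * poly (lag_poly a (Suc n)) t - (real n + 1 + a) * poly (lag_poly a n) t"
    using arg_cong[OF mult_pderiv_lag_Suc[of a n], of "\<lambda>p. poly p t"] by (simp add: algebra_simps)
  have 3: "poly (pderiv (lag_poly a (Suc (Suc n)))) t = poly (pderiv (lag_poly a (Suc n))) t - poly (lag_poly a (Suc n)) t"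
    by (simp add: pderiv_lag_Suc[of a "Suc n"])
  show ?thesis using 1 2 unfolding 3 by (simp add: algebra_simps)
qed

lemma lag_one: "poly (lag_poly a (Suc 0)) t = a + 1 - t"
proof -
  have "lag_poly a (Suc 0) = [: a + 1, -1 :]"
    by (rule poly_eqI) (auto simp: coeff_lag_poly coeff_pCons split: nat.split)
  then show ?thesis by simp
qed

lemma lag_ode:
  "t * poly (pderiv (pderiv (lag_poly a n))) t + (a + 1 - t) * poly (pderiv (lag_poly a n)) t + real n * poly (lag_poly a n) t = 0"
proof (cases n)
  case 0 then show ?thesis by simp
next
  case (Suc m)
  let ?D = "poly (pderiv (lag_poly a n)) t"
  have 1: "pderiv (pCons 0 (pderiv (lag_poly a n)))
      = pderiv (smult (real n) (lag_poly a n) - smult (real n + a) (lag_poly a m))"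
    using mult_pderiv_lag_Suc[of a m] Suc by simp
  have 2: "t * poly (pderiv (pderiv (lag_poly a n))) t + ?D = real n * ?D - (real n + a) * poly (pderiv (lag_poly a m)) t"
    using arg_cong[OF 1, of "\<lambda>p. poly p t"] by (simp add: pderiv_pCons pderiv_diff pderiv_smult algebra_simps)
  have 3: "poly (pderiv (lag_poly a m)) t = ?D + poly (lag_poly a m) t"
    using Suc pderiv_lag_Suc[of a m] by simp
  have 4: "t * ?D = real n * poly (lag_poly a n) t - (real n + a) * poly (lag_poly a m) t"
    using arg_cong[OF mult_pderiv_lag_Suc[of a m], of "\<lambda>p. poly p t"] Suc by (simp add: algebra_simps)
  show ?thesis using 2 4 unfolding 3 by (simp add: algebra_simps)
qed

text \<open>This reduces estimates for a parameter in \<open>(-1, 0)\<close> to a positive parameter.\<close>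

lemma lag_raise: "lag_poly a (Suc n) = lag_poly (a + 1) (Suc n) - lag_poly (a + 1) n"
proof (rule poly_eqI)
  fix k
  consider (1) "k \<le> n" | (2) "k = Suc n" | (3) "k > Suc n" by linarith
  then show "coeff (lag_poly a (Suc n)) k = coeff (lag_poly (a + 1) (Suc n) - lag_poly (a + 1) n) k"
  proof cases
    case 1
    then obtain m where m: "n = k + m" using le_Suc_ex by blast
    have "((a + real (Suc n)) + 1) gchoose (Suc m) = ((a + real (Suc n)) gchoose m) + ((a + real (Suc n)) gchoose Suc m)"
      by (rule gbinomial_Suc_Suc)
    then have *: "((a + 1 + real (Suc n))) gchoose (Suc m) = ((a + 1 + real n) gchoose m) + ((a + real (Suc n)) gchoose Suc m)"
      by (simp add: algebra_simps)
    moreover have "Suc n - k = Suc m" "n - k = m" "k \<le> Suc n" "k \<le> n" using m by auto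
    ultimately show ?thesis by (simp only: coeff_lag_poly coeff_diff if_True *) (simp add: algebra_simps)
  qed (auto simp: coeff_lag_poly)
qed

text \<open>The induction peels off the outermost derivative, so that the inner \<open>n\<close>-fold derivative is the one for
the parameter \<open>b + 1\<close>; hence the induction is over all parameters at once.\<close>

lemma rodrigues:
  assumes "t > 0"
  shows "(deriv ^^ n) (\<lambda>s. exp (- s) * s powr (real n + b)) t = fact n * exp (- t) * t powr b * poly (lag_poly b n) t"
proof -
  have "(deriv ^^ j) (\<lambda>s. exp (- s) * s powr (real j + b)) t = fact j * exp (- t) * t powr b * poly (lag_poly b j) t"
    if "t > 0" for j b t
    using that
  proof (induction j arbitrary: b t)
    case 0
    then show ?case by simp
  next
    case (Suc j)
    let ?F = "(deriv ^^ j) (\<lambda>s. exp (- s) * s powr (real (Suc j) + b))"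
    let ?G = "\<lambda>t. fact j * exp (- t) * t powr (b + 1) * poly (lag_poly (b + 1) j) t"
    have eq: "?F s = ?G s" if "s > 0" for s
      using Suc.IH[OF that, of "b + 1"] by (simp add: add_ac)
    have pw: "t powr (b + 1) = t * t powr b"
      using Suc.prems by (simp add: powr_add)
    have d1: "((\<lambda>t. t powr (b + 1)) has_real_derivative (b + 1) * t powr b) (at t)"
      using has_real_derivative_powr[of t "b + 1"] Suc.prems by simp
    have d2: "((\<lambda>t. fact j * exp (- t) * poly (lag_poly (b + 1) j) t) has_real_derivative
        fact j * exp (- t) * (poly (pderiv (lag_poly (b + 1) j)) t - poly (lag_poly (b + 1) j) t)) (at t)"
      by (auto intro!: derivative_eq_intros simp: algebra_simps)
    have "(?G has_real_derivative fact j * exp (- t) * t powr b *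
        ((b + 1) * poly (lag_poly (b + 1) j) t - t * poly (lag_poly (b + 1) j) t + t * poly (pderiv (lag_poly (b + 1) j)) t)) (at t)"
      using DERIV_mult[OF d1 d2] unfolding pw by (simp add: algebra_simps)
    moreover have "(b + 1) * poly (lag_poly (b + 1) j) t - t * poly (lag_poly (b + 1) j) t + t * poly (pderiv (lag_poly (b + 1) j)) t
        = real (Suc j) * poly (lag_poly b (Suc j)) t"
      using arg_cong[OF lag_Suc_raise[of j b], of "\<lambda>p. poly p t"] by (simp add: algebra_simps)
    ultimately have "(?G has_real_derivative fact j * exp (- t) * t powr b * (real (Suc j) * poly (lag_poly b (Suc j)) t)) (at t)"
      by simp
    then have "(?F has_real_derivative fact j * exp (- t) * t powr b * (real (Suc j) * poly (lag_poly b (Suc j)) t)) (at t)"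
      by (rule has_field_derivative_transform_within_open[where S="{0<..}"]) (use Suc.prems eq in auto)
    then show ?case by (simp add: DERIV_imp_deriv mult_ac)
  qed
  then show ?thesis using assms by blast
qed


section \<open>Polynomial growth of damped Laguerre polynomials\<close>

lemma poly_times_exp_neg_tendsto_0: "((\<lambda>t. poly p t * exp (- t)) \<longlongrightarrow> (0::real)) at_top"
proof -
  have "((\<lambda>t::real. \<Sum>i\<le>degree p. coeff p i * (t ^ i / exp t)) \<longlongrightarrow> (\<Sum>i\<le>degree p. coeff p i * 0)) at_top"
    by (intro tendsto_sum tendsto_mult tendsto_const tendsto_power_div_exp_0)
  moreover have "(\<Sum>i\<le>degree p. coeff p i * (t ^ i / exp t)) = poly p t * exp (- t)" for t :: real
    by (simp add: poly_altdef exp_minus sum_distrib_right divide_simps)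
  ultimately show ?thesis by simp
qed

text \<open>\<open>e\<^bsup>-t/2\<^esup> L\<^sub>n\<^sup>a(t)\<close>, the smooth factor of the Laguerre function.\<close>

definition lag_fun :: "real \<Rightarrow> nat \<Rightarrow> real \<Rightarrow> real"
  where "lag_fun a n t = exp (- t / 2) * poly (lag_poly a n) t"

text \<open>The \<open>k\<close>-th derivative of \<open>lag_fun a n\<close>, expressed through \<open>L\<^sub>n' = - (L\<^sub>0 + \<dots> + L\<^bsub>n-1\<^esub>)\<close> so that bounds
for the functions pass to the derivatives.\<close>

fun lag_fun_deriv :: "real \<Rightarrow> nat \<Rightarrow> nat \<Rightarrow> real \<Rightarrow> real" where
  "lag_fun_deriv a 0 n t = lag_fun a n t"
| "lag_fun_deriv a (Suc k) n t = - lag_fun_deriv a k n t / 2 - (\<Sum>j<n. lag_fun_deriv a k j t)"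

lemma lag_fun_deriv_0: "lag_fun_deriv a 0 n = lag_fun a n"
  by (rule ext) simp

lemma pderiv_lag_poly: "pderiv (lag_poly a n) = - (\<Sum>j<n. lag_poly a j)"
  by (induction n) (simp_all add: pderiv_lag_Suc)

lemma lag_fun_deriv_has_derivative: "(lag_fun_deriv a k n has_real_derivative lag_fun_deriv a (Suc k) n t) (at t)"
proof (induction k arbitrary: n)
  case 0
  have "(lag_fun a n has_real_derivative exp (- t / 2) * (poly (pderiv (lag_poly a n)) t - poly (lag_poly a n) t / 2)) (at t)"
    unfolding lag_fun_def [abs_def] by (auto intro!: derivative_eq_intros simp: algebra_simps)
  moreover have "exp (- t / 2) * (poly (pderiv (lag_poly a n)) t - poly (lag_poly a n) t / 2) = lag_fun_deriv a (Suc 0) n t"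
    by (simp add: pderiv_lag_poly poly_sum lag_fun_def sum_distrib_left algebra_simps)
  ultimately show ?case unfolding lag_fun_deriv_0 by simp
next
  case (Suc k)
  have "((\<lambda>t. - lag_fun_deriv a k n t / 2 - (\<Sum>j<n. lag_fun_deriv a k j t)) has_real_derivative
      - lag_fun_deriv a (Suc k) n t / 2 - (\<Sum>j<n. lag_fun_deriv a (Suc k) j t)) (at t)"
    by (intro DERIV_diff DERIV_cdivide DERIV_minus DERIV_sum Suc.IH)
  then show ?case by simp
qed

lemma lag_fun_three_term:
  "t * lag_fun a (Suc n) t = - (real n + 2) * lag_fun a (Suc (Suc n)) t + (2 * real n + 3 + a) * lag_fun a (Suc n) t
     - (real n + 1 + a) * lag_fun a n t"
  using arg_cong[OF lag_three_term[of n a t], of "\<lambda>x. exp (- t / 2) * x"]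
  by (simp add: lag_fun_def algebra_simps)

lemma lag_fun_one: "t * lag_fun a 0 t = - lag_fun a (Suc 0) t + (a + 1) * lag_fun a 0 t"
  by (simp add: lag_fun_def lag_one algebra_simps)

lemma lag_fun_ode:
  "t * lag_fun_deriv a 2 n t + (a + 1) * lag_fun_deriv a 1 n t + (real n + (a + 1) / 2 - t / 4) * lag_fun a n t = 0"
proof -
  have 1: "lag_fun_deriv a 1 n t = exp (- t / 2) * (poly (pderiv (lag_poly a n)) t - poly (lag_poly a n) t / 2)" for t
    by (simp add: pderiv_lag_poly poly_sum lag_fun_def sum_distrib_left algebra_simps)
  have "((\<lambda>t. exp (- t / 2) * (poly (pderiv (lag_poly a n)) t - poly (lag_poly a n) t / 2)) has_real_derivative
     exp (- t / 2) * (poly (pderiv (pderiv (lag_poly a n))) t - poly (pderiv (lag_poly a n)) t + poly (lag_poly a n) t / 4)) (at t)"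
    by (auto intro!: derivative_eq_intros simp: field_simps)
  then have "(lag_fun_deriv a 1 n has_real_derivative
     exp (- t / 2) * (poly (pderiv (pderiv (lag_poly a n))) t - poly (pderiv (lag_poly a n)) t + poly (lag_poly a n) t / 4)) (at t)"
    unfolding 1[symmetric] .
  moreover have "(lag_fun_deriv a 1 n has_real_derivative lag_fun_deriv a 2 n t) (at t)"
    using lag_fun_deriv_has_derivative[of a 1 n t] by (simp add: numeral_2_eq_2)
  ultimately have 2: "lag_fun_deriv a 2 n t =
     exp (- t / 2) * (poly (pderiv (pderiv (lag_poly a n))) t - poly (pderiv (lag_poly a n)) t + poly (lag_poly a n) t / 4)"
    by (rule DERIV_unique[rotated])
  show ?thesis unfolding 1 2 lag_fun_def
    using arg_cong[OF lag_ode[of t a n], of "\<lambda>x. exp (- t / 2) * x"] by (simp add: algebra_simps)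
qed

text \<open>An energy argument. For \<open>u = e\<^bsup>-t/2\<^esup> L\<^sub>n\<^sup>a\<close> and \<open>q = n + (a + 1)/2\<close> the differential equation makes
\<open>E = t u'\<^sup>2 + (q - t/4) u\<^sup>2\<close> decreasing, with limit 0 at infinity; so \<open>E \<ge> 0\<close>, even beyond the turning
point \<open>t = 4 q\<close>. Since \<open>E' = - (2 a + 1) u'\<^sup>2 - u\<^sup>2/4\<close> also dominates \<open>u u'\<close>, the sum \<open>u\<^sup>2 + 2 E\<close> decreases as
well, and its value at 0 bounds \<open>u\<^sup>2\<close> everywhere.\<close>

lemma lag_fun_square_bound:
  assumes a: "a \<ge> 0" and t: "t \<ge> 0"
  shows "(lag_fun a n t)\<^sup>2 \<le> (2 * real n + a + 2) * ((a + real n) gchoose n)\<^sup>2"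
proof -
  define q where "q = real n + (a + 1) / 2"
  define u where "u = lag_fun a n"
  define u1 where "u1 = lag_fun_deriv a 1 n"
  define u2 where "u2 = lag_fun_deriv a 2 n"
  define En where "En = (\<lambda>s. s * (u1 s)\<^sup>2 + (q - s / 4) * (u s)\<^sup>2)"
  have du: "(u has_real_derivative u1 s) (at s)" for s
    using lag_fun_deriv_has_derivative[of a 0 n s] unfolding u_def u1_def by (simp add: lag_fun_deriv_0)
  have du1: "(u1 has_real_derivative u2 s) (at s)" for s
    using lag_fun_deriv_has_derivative[of a 1 n s] unfolding u1_def u2_def by (simp add: numeral_2_eq_2)
  have ode: "s * u2 s = - (a + 1) * u1 s - (q - s / 4) * u s" for s
    using lag_fun_ode[of s a n] unfolding u_def u1_def u2_def q_def by linarith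
  have dEn: "(En has_real_derivative - (2 * a + 1) * (u1 s)\<^sup>2 - (u s)\<^sup>2 / 4) (at s)" for s
  proof -
    have "(En has_real_derivative (u1 s)\<^sup>2 + 2 * u1 s * (s * u2 s) + (q - s / 4) * (2 * u s * u1 s) - (u s)\<^sup>2 / 4) (at s)"
      unfolding En_def by (auto intro!: derivative_eq_intros du du1 simp: algebra_simps)
    moreover have "(u1 s)\<^sup>2 + 2 * u1 s * (s * u2 s) + (q - s / 4) * (2 * u s * u1 s) - (u s)\<^sup>2 / 4
       = - (2 * a + 1) * (u1 s)\<^sup>2 - (u s)\<^sup>2 / 4"
      unfolding ode by (simp add: power2_eq_square algebra_simps)
    ultimately show ?thesis by simp
  qed
  have En_lim: "(En \<longlongrightarrow> 0) at_top"
  proof -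
    define P where "P = lag_poly a n"
    define Q where "Q = pderiv P - smult (1/2) P"
    have e: "exp (- s / 2) * exp (- s / 2) = exp (- s)" for s :: real
      by (simp flip: exp_add)
    have u1: "u1 s = exp (- s / 2) * poly Q s" for s
      unfolding u1_def Q_def P_def by (simp add: pderiv_lag_poly poly_sum lag_fun_def sum_distrib_left algebra_simps)
    have "En s = poly ([:0, 1:] * Q * Q + [:q, -1/4:] * P * P) s * exp (- s)" for s
      unfolding En_def u1 u_def lag_fun_def P_def[symmetric] e[symmetric]
      by (simp add: power2_eq_square algebra_simps)
    then show ?thesis using poly_times_exp_neg_tendsto_0 by presburger
  qed
  have En_dec: "En y \<le> En x" if "x \<le> y" for x y
  proof (rule DERIV_nonpos_imp_nonincreasing[OF that])
    fix s
    have "- (2 * a + 1) * (u1 s)\<^sup>2 - (u s)\<^sup>2 / 4 \<le> 0"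
    proof -
      have "0 \<le> (2 * a + 1) * (u1 s)\<^sup>2" using a by (intro mult_nonneg_nonneg) auto
      moreover have "0 \<le> (u s)\<^sup>2 / 4" by simp
      ultimately show ?thesis by (simp only: mult_minus_left)
    qed
    with dEn show "\<exists>y. (En has_real_derivative y) (at s) \<and> y \<le> 0" by blast
  qed
  have En_nonneg: "En t \<ge> 0"
    by (rule tendsto_upperbound[OF En_lim])
       (use En_dec in \<open>auto simp: eventually_at_top_linorder\<close>)
  have "(u t)\<^sup>2 + 2 * En t \<le> (u 0)\<^sup>2 + 2 * En 0"
  proof (rule DERIV_nonpos_imp_nonincreasing[OF t])
    fix s
    have "((\<lambda>s. (u s)\<^sup>2 + 2 * En s) has_real_derivative
        2 * u s * u1 s + 2 * (- (2 * a + 1) * (u1 s)\<^sup>2 - (u s)\<^sup>2 / 4)) (at s)"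
      by (auto intro!: derivative_eq_intros du dEn)
    moreover have "2 * u s * u1 s + 2 * (- (2 * a + 1) * (u1 s)\<^sup>2 - (u s)\<^sup>2 / 4)
        = - 4 * a * (u1 s)\<^sup>2 - 2 * (u1 s - u s / 2)\<^sup>2"
      by (simp add: power2_eq_square algebra_simps)
    moreover have "\<dots> \<le> 0"
    proof -
      have "0 \<le> 4 * a * (u1 s)\<^sup>2" using a by simp
      moreover have "0 \<le> 2 * (u1 s - u s / 2)\<^sup>2" by simp
      ultimately show ?thesis by (simp only: mult_minus_left)
    qed
    ultimately show "\<exists>y. ((\<lambda>s. (u s)\<^sup>2 + 2 * En s) has_real_derivative y) (at s) \<and> y \<le> 0"
      by metis
  qed
  then have "(u t)\<^sup>2 \<le> (u 0)\<^sup>2 + 2 * En 0" using En_nonneg by linarith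
  also have "\<dots> = (2 * real n + a + 2) * (u 0)\<^sup>2"
    by (simp add: En_def q_def algebra_simps)
  also have "u 0 = (a + real n) gchoose n"
    by (simp add: u_def lag_fun_def poly_lag_at_0)
  finally show ?thesis by (simp add: u_def)
qed


text \<open>Bounds of the form \<open>C (n + 1)\<^sup>K\<close>, uniform on the half line. Sequences of numbers are treated as
functions constant in \<open>t\<close>.\<close>

definition poly_growth :: "(nat \<Rightarrow> real \<Rightarrow> real) \<Rightarrow> bool"
  where "poly_growth v \<longleftrightarrow> (\<exists>C K. \<forall>n. \<forall>t\<ge>0. \<bar>v n t\<bar> \<le> C * (real n + 1) ^ K)"

lemma poly_growthI: "(\<And>n t. t \<ge> 0 \<Longrightarrow> \<bar>v n t\<bar> \<le> C * (real n + 1) ^ K) \<Longrightarrow> poly_growth v"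
  unfolding poly_growth_def by blast

lemma poly_growthE:
  assumes "poly_growth v"
  obtains C K where "C \<ge> 0" "\<And>n t. t \<ge> 0 \<Longrightarrow> \<bar>v n t\<bar> \<le> C * (real n + 1) ^ K"
proof -
  from assms obtain C K where *: "\<And>n t. t \<ge> 0 \<Longrightarrow> \<bar>v n t\<bar> \<le> C * (real n + 1) ^ K"
    unfolding poly_growth_def by blast
  from *[of 0 0] have "C \<ge> 0" by simp
  with * that show thesis by blast
qed

lemma poly_growth_mono:
  assumes "poly_growth w" "\<And>n t. t \<ge> 0 \<Longrightarrow> \<bar>v n t\<bar> \<le> \<bar>w n t\<bar>"
  shows "poly_growth v"
  using assms unfolding poly_growth_def by (meson order_trans)

lemma poly_growth_add:
  assumes "poly_growth v" "poly_growth w"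
  shows "poly_growth (\<lambda>n t. v n t + w n t)"
proof -
  from assms(1) obtain C K where 1: "C \<ge> 0" "\<And>n t. t \<ge> 0 \<Longrightarrow> \<bar>v n t\<bar> \<le> C * (real n + 1) ^ K"
    by (rule poly_growthE) blast
  from assms(2) obtain C' K' where 2: "C' \<ge> 0" "\<And>n t. t \<ge> 0 \<Longrightarrow> \<bar>w n t\<bar> \<le> C' * (real n + 1) ^ K'"
    by (rule poly_growthE) blast
  have "\<bar>v n t + w n t\<bar> \<le> (C + C') * (real n + 1) ^ (K + K')" if "t \<ge> 0" for n t
  proof -
    have "C * (real n + 1) ^ K \<le> C * (real n + 1) ^ (K + K')"
      "C' * (real n + 1) ^ K' \<le> C' * (real n + 1) ^ (K + K')"
      using 1(1) 2(1) by (auto intro!: mult_left_mono power_increasing)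
    with 1(2)[OF that, of n] 2(2)[OF that, of n] show ?thesis by (simp add: algebra_simps)
  qed
  then show ?thesis by (rule poly_growthI)
qed

lemma poly_growth_mult:
  assumes "poly_growth v" "poly_growth w"
  shows "poly_growth (\<lambda>n t. v n t * w n t)"
proof -
  from assms(1) obtain C K where 1: "C \<ge> 0" "\<And>n t. t \<ge> 0 \<Longrightarrow> \<bar>v n t\<bar> \<le> C * (real n + 1) ^ K"
    by (rule poly_growthE) blast
  from assms(2) obtain C' K' where 2: "C' \<ge> 0" "\<And>n t. t \<ge> 0 \<Longrightarrow> \<bar>w n t\<bar> \<le> C' * (real n + 1) ^ K'"
    by (rule poly_growthE) blast
  have "\<bar>v n t * w n t\<bar> \<le> (C * C') * (real n + 1) ^ (K + K')" if "t \<ge> 0" for n t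
    using mult_mono[OF 1(2)[OF that, of n] 2(2)[OF that, of n]] 1(1)
    by (simp add: abs_mult power_add mult_ac)
  then show ?thesis by (rule poly_growthI)
qed

lemma poly_growth_const: "poly_growth (\<lambda>n t. c)"
  by (rule poly_growthI[of _ "\<bar>c\<bar>" 0]) simp

lemma poly_growth_index: "poly_growth (\<lambda>n t. real n)"
  by (rule poly_growthI[of _ 1 1]) simp

lemma poly_growth_uminus: "poly_growth v \<Longrightarrow> poly_growth (\<lambda>n t. - v n t)"
  by (erule poly_growth_mono) simp

lemma poly_growth_diff: "poly_growth v \<Longrightarrow> poly_growth w \<Longrightarrow> poly_growth (\<lambda>n t. v n t - w n t)"
  using poly_growth_add[OF _ poly_growth_uminus, of v w] by simp

lemma poly_growth_shift:
  assumes "poly_growth v"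
  shows "poly_growth (\<lambda>n t. v (Suc n) t)" "poly_growth (\<lambda>n t. v (n - 1) t)"
proof -
  from assms obtain C K where 1: "C \<ge> 0" "\<And>n t. t \<ge> 0 \<Longrightarrow> \<bar>v n t\<bar> \<le> C * (real n + 1) ^ K"
    by (rule poly_growthE) blast
  have "\<bar>v (Suc n) t\<bar> \<le> (C * 2 ^ K) * (real n + 1) ^ K" if "t \<ge> 0" for n t
  proof -
    have "(real (Suc n) + 1) ^ K \<le> (2 * (real n + 1)) ^ K" by (intro power_mono) auto
    then have "C * (real (Suc n) + 1) ^ K \<le> C * (2 ^ K * (real n + 1) ^ K)"
      using 1(1) unfolding power_mult_distrib by (rule mult_left_mono)
    with 1(2)[OF that, of "Suc n"] show ?thesis by (simp add: mult_ac)
  qed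
  then show "poly_growth (\<lambda>n t. v (Suc n) t)" by (rule poly_growthI)
  have "\<bar>v (n - 1) t\<bar> \<le> C * (real n + 1) ^ K" if "t \<ge> 0" for n t
  proof -
    have "C * (real (n - 1) + 1) ^ K \<le> C * (real n + 1) ^ K"
      using 1(1) by (intro mult_left_mono power_mono) auto
    with 1(2)[OF that, of "n - 1"] show ?thesis by simp
  qed
  then show "poly_growth (\<lambda>n t. v (n - 1) t)" by (rule poly_growthI)
qed

lemma poly_growth_sum:
  assumes "poly_growth v"
  shows "poly_growth (\<lambda>n t. \<Sum>j<n. v j t)"
proof -
  from assms obtain C K where 1: "C \<ge> 0" "\<And>n t. t \<ge> 0 \<Longrightarrow> \<bar>v n t\<bar> \<le> C * (real n + 1) ^ K"
    by (rule poly_growthE) blast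
  have "\<bar>\<Sum>j<n. v j t\<bar> \<le> C * (real n + 1) ^ Suc K" if t: "t \<ge> 0" for n t
  proof -
    have "\<bar>\<Sum>j<n. v j t\<bar> \<le> (\<Sum>j<n. \<bar>v j t\<bar>)" by (rule sum_abs)
    also have "\<dots> \<le> (\<Sum>j<n. C * (real n + 1) ^ K)"
    proof (rule sum_mono)
      fix j assume "j \<in> {..<n}"
      then have "C * (real j + 1) ^ K \<le> C * (real n + 1) ^ K"
        using 1(1) by (intro mult_left_mono power_mono) auto
      with 1(2)[OF t, of j] show "\<bar>v j t\<bar> \<le> C * (real n + 1) ^ K" by simp
    qed
    also have "\<dots> = real n * (C * (real n + 1) ^ K)" by simp
    also have "\<dots> \<le> (real n + 1) * (C * (real n + 1) ^ K)"
      using 1(1) by (intro mult_right_mono) auto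
    finally show ?thesis by (simp add: mult_ac)
  qed
  then show ?thesis by (rule poly_growthI)
qed

text \<open>By Bernoulli's inequality, \<open>1 + K / (n + 1) \<le> ((n + 2) / (n + 1))\<^sup>K\<close>, and the product of these telescopes.\<close>

lemma poly_growth_ratio:
  fixes s :: "nat \<Rightarrow> real"
  assumes "\<And>n. s n \<ge> 0" and "\<And>n. s (Suc n) \<le> (1 + real K / (real n + 1)) * s n"
  shows "poly_growth (\<lambda>n t. s n)"
proof -
  have "s n \<le> s 0 * (real n + 1) ^ K" for n
  proof (induction n)
    case (Suc n)
    have "1 + real K / (real n + 1) \<le> (1 + 1 / (real n + 1)) ^ K"
      using Bernoulli_inequality[of "1 / (real n + 1)" K] by (simp add: order_trans[of "-1" 0])
    also have "1 + 1 / (real n + 1) = (real (Suc n) + 1) / (real n + 1)" by (simp add: field_simps)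
    finally have le: "1 + real K / (real n + 1) \<le> ((real (Suc n) + 1) / (real n + 1)) ^ K" .
    have "s (Suc n) \<le> (1 + real K / (real n + 1)) * s n" by (rule assms(2))
    also have "\<dots> \<le> ((real (Suc n) + 1) / (real n + 1)) ^ K * (s 0 * (real n + 1) ^ K)"
      by (rule mult_mono[OF le Suc.IH]) (auto simp: assms(1))
    also have "\<dots> = s 0 * (real (Suc n) + 1) ^ K" by (simp add: power_divide)
    finally show ?case .
  qed simp
  then show ?thesis by (intro poly_growthI[of _ "s 0" K]) (simp add: assms(1))
qed

lemma poly_growth_gbinomial:
  assumes "a \<ge> 0"
  shows "poly_growth (\<lambda>n t. (a + real n) gchoose n)"
proof (rule poly_growth_ratio)
  show nn: "0 \<le> (a + real n) gchoose n" for n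
    unfolding gbinomial_prod_rev using assms by (intro divide_nonneg_nonneg prod_nonneg) auto
  fix n
  have "(a + real (Suc n)) gchoose (Suc n) = (1 + a / (real n + 1)) * ((a + real n) gchoose n)"
    using gbinomial_factors[of "a + real n" n] by (simp add: field_simps)
  also have "\<dots> \<le> (1 + real (nat \<lceil>a\<rceil>) / (real n + 1)) * ((a + real n) gchoose n)"
    using assms by (intro mult_right_mono nn add_left_mono divide_right_mono) linarith+
  finally show "(a + real (Suc n)) gchoose (Suc n) \<le> \<dots>" .
qed

lemma poly_growth_lag_fun_nonneg:
  assumes a: "a \<ge> 0"
  shows "poly_growth (lag_fun a)"
proof -
  have "poly_growth (\<lambda>n t. (2 * real n + a + 2) * ((a + real n) gchoose n))"
    by (intro poly_growth_mult poly_growth_add poly_growth_const poly_growth_index poly_growth_gbinomial a)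
  then show ?thesis
  proof (rule poly_growth_mono)
    fix n and t :: real assume t: "t \<ge> 0"
    let ?g = "(a + real n) gchoose n"
    have "(lag_fun a n t)\<^sup>2 \<le> (2 * real n + a + 2) * ?g\<^sup>2" by (rule lag_fun_square_bound[OF a t])
    also have "\<dots> \<le> (2 * real n + a + 2)\<^sup>2 * ?g\<^sup>2"
      using a by (intro mult_right_mono) (auto simp: power2_eq_square)
    finally show "\<bar>lag_fun a n t\<bar> \<le> \<bar>(2 * real n + a + 2) * ?g\<bar>"
      unfolding abs_le_square_iff by (simp add: power_mult_distrib)
  qed
qed

lemma poly_growth_lag_fun:
  assumes a: "a > -1"
  shows "poly_growth (lag_fun a)"
proof -
  have g: "poly_growth (lag_fun (a + 1))" using a by (intro poly_growth_lag_fun_nonneg) simp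
  have g': "poly_growth (\<lambda>n t. \<bar>lag_fun (a + 1) n t\<bar> + \<bar>lag_fun (a + 1) (n - 1) t\<bar>)"
    by (intro poly_growth_add)
       (auto intro: poly_growth_mono[OF g] poly_growth_mono[OF poly_growth_shift(2)[OF g]])
  show ?thesis
  proof (rule poly_growth_mono[OF g'])
    fix n and t :: real
    show "\<bar>lag_fun a n t\<bar> \<le> \<bar>\<bar>lag_fun (a + 1) n t\<bar> + \<bar>lag_fun (a + 1) (n - 1) t\<bar>\<bar>"
    proof (cases n)
      case 0 then show ?thesis by (simp add: lag_fun_def)
    next
      case (Suc m)
      have "lag_fun a n t = lag_fun (a + 1) n t - lag_fun (a + 1) m t"
        unfolding Suc lag_fun_def lag_raise[of a m] by (simp add: algebra_simps)
      then show ?thesis using Suc by simp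
    qed
  qed
qed

text \<open>The recurrence in a form valid for all \<open>n\<close>; the coefficient 0 makes the value of \<open>n - 1\<close> at \<open>n = 0\<close>
irrelevant.\<close>

lemma lag_fun_mult_t:
  "t * lag_fun a n t = - (real n + 1) * lag_fun a (Suc n) t + (2 * real n + 1 + a) * lag_fun a n t
     - (if n = 0 then 0 else real n + a) * lag_fun a (n - 1) t"
proof (cases n)
  case 0
  then show ?thesis using lag_fun_one[of t a] by simp
next
  case (Suc m)
  then show ?thesis using lag_fun_three_term[of t a m] by (simp add: algebra_simps)
qed

text \<open>Multiplication by \<open>t\<close> and differentiation both act on the sequence by finite combinations with
coefficients polynomial in \<open>n\<close>.\<close>

lemma poly_growth_lag_fun_deriv:
  assumes a: "a > -1"
  shows "poly_growth (\<lambda>n t. t ^ m * lag_fun_deriv a k n t)"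
proof (induction k)
  case 0
  show ?case
  proof (induction m)
    case 0
    then show ?case using poly_growth_lag_fun[OF a] by simp
  next
    case (Suc m)
    let ?v = "\<lambda>n t. t ^ m * lag_fun a n t"
    have v: "poly_growth ?v" using Suc by simp
    have i: "poly_growth (\<lambda>n t. if n = 0 then 0 else real n + a)"
    proof (rule poly_growth_mono)
      show "poly_growth (\<lambda>n t. real n + \<bar>a\<bar>)"
        by (intro poly_growth_add poly_growth_const poly_growth_index)
    qed auto
    have "poly_growth (\<lambda>n t. - (real n + 1) * ?v (Suc n) t + (2 * real n + 1 + a) * ?v n t
        - (if n = 0 then 0 else real n + a) * ?v (n - 1) t)"
      by (intro poly_growth_add poly_growth_diff poly_growth_mult poly_growth_uminus poly_growth_const
          poly_growth_index v i poly_growth_shift(1)[OF v] poly_growth_shift(2)[OF v])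
    also have "(\<lambda>n t. - (real n + 1) * ?v (Suc n) t + (2 * real n + 1 + a) * ?v n t
        - (if n = 0 then 0 else real n + a) * ?v (n - 1) t) = (\<lambda>n t. t ^ Suc m * lag_fun_deriv a 0 n t)"
    proof (intro ext)
      fix n t
      show "- (real n + 1) * ?v (Suc n) t + (2 * real n + 1 + a) * ?v n t
        - (if n = 0 then 0 else real n + a) * ?v (n - 1) t = t ^ Suc m * lag_fun_deriv a 0 n t"
        using arg_cong[OF lag_fun_mult_t[of t a n], of "\<lambda>x. t ^ m * x"] by (simp add: algebra_simps)
    qed
    finally show ?case .
  qed
next
  case (Suc k)
  have "poly_growth (\<lambda>n t. (- (1/2)) * (t ^ m * lag_fun_deriv a k n t) - (\<Sum>j<n. t ^ m * lag_fun_deriv a k j t))"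
    by (intro poly_growth_diff poly_growth_mult poly_growth_const poly_growth_sum Suc)
  then show ?case by (simp add: sum_distrib_left right_diff_distrib)
qed

definition lag_norm :: "real \<Rightarrow> nat \<Rightarrow> real"
  where "lag_norm a n = sqrt (fact n / Gamma (real n + a + 1))"

lemma lag_norm_pos: "a > -1 \<Longrightarrow> lag_norm a n > 0"
  unfolding lag_norm_def by (simp add: Gamma_real_pos)

lemma lag_norm_square: "a > -1 \<Longrightarrow> (lag_norm a n)\<^sup>2 = fact n / Gamma (real n + a + 1)"
  unfolding lag_norm_def by (simp add: Gamma_real_nonneg)

lemma lag_norm_Suc:
  assumes a: "a > -1"
  shows "(lag_norm a (Suc n))\<^sup>2 * (real n + 1 + a) = (real n + 1) * (lag_norm a n)\<^sup>2"
proof -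
  have nz: "real n + a + 1 \<noteq> 0" using a by linarith
  have "Gamma (real n + a + 1 + 1) = (real n + a + 1) * Gamma (real n + a + 1)"
    using a by (intro Gamma_plus1) (auto dest: nonpos_Ints_nonpos)
  then have G: "Gamma (real (Suc n) + a + 1) = (real n + a + 1) * Gamma (real n + a + 1)"
    by (simp add: add_ac)
  have f: "fact (Suc n) = (real n + 1) * fact n" and c: "real n + 1 + a = real n + a + 1" by simp_all
  show ?thesis unfolding lag_norm_square[OF a] G f c using nz by simp
qed

lemma poly_growth_lag_norm:
  assumes a: "a > -1"
  shows "poly_growth (\<lambda>n t. lag_norm a n)"
proof -
  have "poly_growth (\<lambda>n t. (lag_norm a n)\<^sup>2)"
  proof (rule poly_growth_ratio)
    fix n
    \<comment> \<open>Chosen so that \<open>(n + 1) / (n + 1 + a) \<le> 1 + K / (n + 1)\<close>; for negative \<open>a\<close> the case \<open>n = 0\<close> is the worst.\<close>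
    define K where "K = nat \<lceil>\<bar>a\<bar> / (1 + a)\<rceil>"
    have K: "\<bar>a\<bar> \<le> real K * (1 + a)"
    proof -
      have "\<bar>a\<bar> / (1 + a) \<le> real K" unfolding K_def using a by (simp add: le_of_int_ceiling)
      then show ?thesis using a by (simp add: field_simps)
    qed
    have pos: "real n + 1 + a > 0" using a by linarith
    have "- a * (real n + 1) \<le> real K * (real n + 1 + a)"
    proof (cases "a \<ge> 0")
      case True
      then have "- a * (real n + 1) \<le> 0" "0 \<le> real K * (real n + 1 + a)"
        using pos by (simp_all add: mult_nonneg_nonneg)
      then show ?thesis by linarith
    next
      case False
      then have "(1 + a) * (real n + 1) \<le> real n + 1 + a"
        using mult_nonneg_nonneg[of "- a" "real n"] by (simp add: algebra_simps)
      then have "real K * ((1 + a) * (real n + 1)) \<le> real K * (real n + 1 + a)"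
        by (intro mult_left_mono) auto
      moreover have "- a * (real n + 1) \<le> real K * (1 + a) * (real n + 1)"
        using K False by (intro mult_right_mono) auto
      ultimately show ?thesis by (simp add: mult.assoc)
    qed
    then have "real n + 1 \<le> (1 + real K / (real n + 1)) * (real n + 1 + a)"
      by (simp add: field_simps)
    then have "(real n + 1) * (lag_norm a n)\<^sup>2 \<le> (1 + real K / (real n + 1)) * (real n + 1 + a) * (lag_norm a n)\<^sup>2"
      by (intro mult_right_mono) auto
    then have "(lag_norm a (Suc n))\<^sup>2 * (real n + 1 + a) \<le> (1 + real K / (real n + 1)) * (lag_norm a n)\<^sup>2 * (real n + 1 + a)"
      unfolding lag_norm_Suc[OF a] by (simp add: mult_ac)
    then show "(lag_norm a (Suc n))\<^sup>2 \<le> (1 + real (nat \<lceil>\<bar>a\<bar> / (1 + a)\<rceil>) / (real n + 1)) * (lag_norm a n)\<^sup>2"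
      using pos unfolding K_def by (simp only: mult_le_cancel_right_pos)
  qed simp
  then have "poly_growth (\<lambda>n t. 1 + (lag_norm a n)\<^sup>2)"
    by (intro poly_growth_add poly_growth_const)
  then show ?thesis
  proof (rule poly_growth_mono)
    fix n
    have "0 \<le> (lag_norm a n - 1)\<^sup>2 + (lag_norm a n)\<^sup>2 + 1" by simp
    then show "\<bar>lag_norm a n\<bar> \<le> \<bar>1 + (lag_norm a n)\<^sup>2\<bar>"
      using lag_norm_pos[OF a, of n] by (simp add: power2_eq_square algebra_simps)
  qed
qed

section \<open>Schwartz functions on the half line\<close>

text \<open>\<open>G k\<close> is the \<open>k\<close>-th derivative, one-sided at 0, of the function \<open>G 0\<close> on the half line. Giving the whole
sequence avoids iterating one-sided derivatives.\<close>

definition half_schwartz :: "(nat \<Rightarrow> real \<Rightarrow> complex) \<Rightarrow> bool"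
  where "half_schwartz G \<longleftrightarrow>
    (\<forall>k. \<forall>t\<ge>0. (G k has_vector_derivative G (Suc k) t) (at t within {0..})) \<and>
    (\<forall>k m. \<exists>B. \<forall>t\<ge>0. t ^ m * norm (G k t) \<le> B)"

text \<open>Term-by-term differentiation by the Weierstrass test, in the form needed for both the Borel series and the
Laguerre series.\<close>

lemma half_schwartz_series:
  fixes F :: "nat \<Rightarrow> nat \<Rightarrow> real \<Rightarrow> complex"
  assumes deriv: "\<And>k n t. t \<ge> 0 \<Longrightarrow> (F k n has_vector_derivative F (Suc k) n t) (at t within {0..})"
    and bound: "\<And>k m. \<exists>B. summable B \<and> (\<forall>n. \<forall>t\<ge>0. t ^ m * norm (F k n t) \<le> B n)"
  shows "half_schwartz (\<lambda>k t. \<Sum>n. F k n t)"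
    and "\<And>k t. t \<ge> 0 \<Longrightarrow> summable (\<lambda>n. norm (F k n t))"
proof -
  show sm: "summable (\<lambda>n. norm (F k n t))" if "t \<ge> 0" for k t
  proof -
    obtain B where B: "summable B" "\<forall>n. \<forall>t\<ge>0. t ^ 0 * norm (F k n t) \<le> B n"
      using bound[where m=0 and k=k] by blast
    show ?thesis by (rule summable_comparison_test'[OF B(1), of 0]) (use B(2) that in simp)
  qed
  have "((\<lambda>t. \<Sum>n. F k n t) has_vector_derivative (\<Sum>n. F (Suc k) n t)) (at t within {0..})"
    if t: "t \<ge> 0" for k t
  proof -
    obtain B where B: "summable B" "\<forall>n. \<forall>t\<ge>0. t ^ 0 * norm (F (Suc k) n t) \<le> B n"
      using bound[where m=0 and k="Suc k"] by blast
    have ul: "uniform_limit {0..} (\<lambda>n t. \<Sum>i<n. F (Suc k) i t) (\<lambda>t. \<Sum>i. F (Suc k) i t) sequentially"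
      by (rule Weierstrass_m_test[OF _ B(1)]) (use B(2) in auto)
    have "\<exists>g. \<forall>x\<in>{0..}. (\<lambda>n. F k n x) sums g x \<and>
        (g has_derivative (\<lambda>h. h *\<^sub>R (\<Sum>i. F (Suc k) i x))) (at x within {0..})"
    proof (rule has_derivative_series)
      show "(F k n has_derivative (\<lambda>h. h *\<^sub>R F (Suc k) n x)) (at x within {0..})" if "x \<in> {0..}" for n x
        using deriv[of x k n] that by (simp add: has_vector_derivative_def)
      show "(\<lambda>n. F k n 0) sums (\<Sum>n. F k n 0)"
        by (rule summable_sums[OF summable_norm_cancel[OF sm]]) simp
      fix e :: real assume "e > 0"
      with ul have "\<forall>\<^sub>F n in sequentially. \<forall>x\<in>{0..}. dist (\<Sum>i<n. F (Suc k) i x) (\<Sum>i. F (Suc k) i x) < e"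
        by (rule uniform_limitD)
      then show "\<forall>\<^sub>F n in sequentially. \<forall>x\<in>{0..}. \<forall>h.
          norm ((\<Sum>i<n. h *\<^sub>R F (Suc k) i x) - h *\<^sub>R (\<Sum>i. F (Suc k) i x)) \<le> e * norm h"
      proof (rule eventually_mono, intro ballI allI)
        fix n and x h :: real
        assume *: "\<forall>x\<in>{0..}. dist (\<Sum>i<n. F (Suc k) i x) (\<Sum>i. F (Suc k) i x) < e" and x: "x \<in> {0..}"
        have "norm ((\<Sum>i<n. h *\<^sub>R F (Suc k) i x) - h *\<^sub>R (\<Sum>i. F (Suc k) i x))
           = norm h * dist (\<Sum>i<n. F (Suc k) i x) (\<Sum>i. F (Suc k) i x)"
          unfolding dist_norm scaleR_sum_right[symmetric] scaleR_diff_right[symmetric] by simp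
        also have "\<dots> \<le> norm h * e" using * x by (intro mult_left_mono) (auto intro: less_imp_le)
        finally show "norm ((\<Sum>i<n. h *\<^sub>R F (Suc k) i x) - h *\<^sub>R (\<Sum>i. F (Suc k) i x)) \<le> e * norm h"
          by (simp add: mult.commute)
      qed
    qed auto
    then obtain g where g: "\<And>x. x \<ge> 0 \<Longrightarrow> (\<lambda>n. F k n x) sums g x"
      "\<And>x. x \<ge> 0 \<Longrightarrow> (g has_vector_derivative (\<Sum>i. F (Suc k) i x)) (at x within {0..})"
      unfolding has_vector_derivative_def by (metis atLeast_iff)
    show ?thesis
      by (rule has_vector_derivative_transform[OF _ _ g(2)[OF t]]) (use t g(1) in \<open>simp_all add: sums_iff\<close>)
  qed
  moreover have "\<exists>B. \<forall>t\<ge>0. t ^ m * norm (\<Sum>n. F k n t) \<le> B" for k m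
  proof -
    obtain B where B: "summable B" "\<forall>n. \<forall>t\<ge>0. t ^ m * norm (F k n t) \<le> B n"
      using bound by blast
    have "t ^ m * norm (\<Sum>n. F k n t) \<le> suminf B" if t: "t \<ge> 0" for t
    proof -
      have "norm (\<Sum>n. F k n t) \<le> (\<Sum>n. norm (F k n t))" by (rule summable_norm[OF sm[OF t]])
      then have "t ^ m * norm (\<Sum>n. F k n t) \<le> t ^ m * (\<Sum>n. norm (F k n t))"
        using t by (intro mult_left_mono) auto
      also have "\<dots> = (\<Sum>n. t ^ m * norm (F k n t))"
        by (rule suminf_mult[OF sm[OF t], symmetric])
      also have "\<dots> \<le> suminf B"
        by (rule suminf_le[OF _ summable_mult[OF sm[OF t]] B(1)]) (use B(2) t in auto)
      finally show ?thesis .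
    qed
    then show ?thesis by blast
  qed
  ultimately show "half_schwartz (\<lambda>k t. \<Sum>n. F k n t)"
    unfolding half_schwartz_def by blast
qed

text \<open>The \<open>j\<close>-th derivative of \<open>x\<^sup>k e\<^bsup>-x\<^esup>\<close>.\<close>

fun power_exp_deriv :: "nat \<Rightarrow> nat \<Rightarrow> real \<Rightarrow> real" where
  "power_exp_deriv 0 j x = (-1) ^ j * exp (- x)"
| "power_exp_deriv (Suc k) j x = x * power_exp_deriv k j x + real j * power_exp_deriv k (j - 1) x"

lemma power_exp_deriv_has_derivative: "(power_exp_deriv k j has_real_derivative power_exp_deriv k (Suc j) x) (at x)"
proof (induction k arbitrary: j)
  case 0
  show ?case unfolding power_exp_deriv.simps(1)[abs_def] by (auto intro!: derivative_eq_intros)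
next
  case (Suc k)
  have *: "real j * power_exp_deriv k (Suc (j - 1)) x = real j * power_exp_deriv k j x" by (cases j) auto
  have "((\<lambda>x. x * power_exp_deriv k j x + real j * power_exp_deriv k (j - 1) x) has_real_derivative
      (power_exp_deriv k j x + x * power_exp_deriv k (Suc j) x) + real j * power_exp_deriv k (Suc (j - 1)) x) (at x)"
    by (auto intro!: derivative_eq_intros Suc.IH)
  then show ?case unfolding * by (simp add: algebra_simps fun_eq_iff[symmetric])
qed

lemma power_exp_deriv_at_0: "j < k \<Longrightarrow> power_exp_deriv k j 0 = 0" "power_exp_deriv k k 0 = fact k"
proof -
  show "j < k \<Longrightarrow> power_exp_deriv k j 0 = 0" for j
  proof (induction k arbitrary: j)
    case (Suc k)
    then show ?case by (cases j) auto
  qed simp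
  show "power_exp_deriv k k 0 = fact k"
    by (induction k) auto
qed

lemma power_times_exp_neg_le: "x \<ge> 0 \<Longrightarrow> x ^ m * exp (- x) \<le> (fact m :: real)"
proof -
  assume x: "x \<ge> 0"
  have "(\<Sum>i\<in>{m}. x ^ i /\<^sub>R fact i) \<le> exp x"
    unfolding exp_def using x by (intro sum_le_suminf summable_exp_generic) auto
  then have "x ^ m \<le> fact m * exp x" by (simp add: field_simps)
  then show ?thesis by (simp add: exp_minus field_simps)
qed

lemma power_exp_deriv_bounded: "\<exists>B. \<forall>x\<ge>0. x ^ m * \<bar>power_exp_deriv k j x\<bar> \<le> B"
proof (induction k arbitrary: j m)
  case 0
  show ?case by (rule exI[of _ "fact m"]) (simp add: abs_mult power_times_exp_neg_le)
next
  case (Suc k)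
  obtain B1 where B1: "\<forall>x\<ge>0. x ^ Suc m * \<bar>power_exp_deriv k j x\<bar> \<le> B1" using Suc.IH by blast
  obtain B2 where B2: "\<forall>x\<ge>0. x ^ m * \<bar>power_exp_deriv k (j - 1) x\<bar> \<le> B2" using Suc.IH by blast
  have "x ^ m * \<bar>power_exp_deriv (Suc k) j x\<bar> \<le> B1 + real j * B2" if x: "x \<ge> 0" for x
  proof -
    have "x ^ m * \<bar>power_exp_deriv (Suc k) j x\<bar> \<le> x ^ m * (x * \<bar>power_exp_deriv k j x\<bar> + real j * \<bar>power_exp_deriv k (j - 1) x\<bar>)"
      using x abs_triangle_ineq[of "x * power_exp_deriv k j x" "real j * power_exp_deriv k (j - 1) x"]
      by (intro mult_left_mono) (auto simp: abs_mult)
    also have "\<dots> = x ^ Suc m * \<bar>power_exp_deriv k j x\<bar> + real j * (x ^ m * \<bar>power_exp_deriv k (j - 1) x\<bar>)"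
      by (simp add: algebra_simps)
    also have "\<dots> \<le> B1 + real j * B2"
      using B1 B2 x by (intro add_mono mult_left_mono) auto
    finally show ?thesis .
  qed
  then show ?case by blast
qed

lemma power_exp_deriv_bounded_uniform: "\<exists>M\<ge>0. \<forall>j\<le>k. \<forall>m\<le>k. \<forall>x\<ge>0. x ^ m * \<bar>power_exp_deriv k j x\<bar> \<le> M"
proof -
  have "\<forall>m j. \<exists>B. \<forall>x\<ge>0. x ^ m * \<bar>power_exp_deriv k j x\<bar> \<le> B" using power_exp_deriv_bounded by blast
  then obtain B where B: "\<And>m j x. x \<ge> 0 \<Longrightarrow> x ^ m * \<bar>power_exp_deriv k j x\<bar> \<le> B m j" by metis
  define M where "M = (\<Sum>m\<le>k. \<Sum>j\<le>k. \<bar>B m j\<bar>)"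
  have "x ^ m * \<bar>power_exp_deriv k j x\<bar> \<le> M" if "j \<le> k" "m \<le> k" "x \<ge> 0" for j m x
  proof -
    have "x ^ m * \<bar>power_exp_deriv k j x\<bar> \<le> \<bar>B m j\<bar>" using B[OF that(3), of m j] by linarith
    also have "\<dots> \<le> (\<Sum>j\<le>k. \<bar>B m j\<bar>)" using that by (intro member_le_sum) auto
    also have "\<dots> \<le> M" unfolding M_def using that by (intro member_le_sum[of m]) (auto intro: sum_nonneg)
    finally show ?thesis .
  qed
  moreover have "M \<ge> 0" unfolding M_def by (intro sum_nonneg) auto
  ultimately show ?thesis by blast
qed

text \<open>A dilation factor large enough that the \<open>k\<close>-th term of the Borel series, with coefficient \<open>d\<close>, contributes
at most \<open>2\<^bsup>-k\<^esup>\<close> to each of the bounds of order less than \<open>k\<close>.\<close>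

definition borel_scale :: "(nat \<Rightarrow> real) \<Rightarrow> nat \<Rightarrow> complex \<Rightarrow> real"
  where "borel_scale M k d = 1 + norm d * M k * 2 ^ k"

text \<open>Since \<open>e\<^bsup>-x\<^esup>\<close> is not flat at 0, the \<open>k\<close>-th term also contributes to the derivatives of order above \<open>k\<close>;
the coefficients solve the resulting triangular system, where \<open>M k\<close> bounds the derivatives of \<open>x\<^sup>k e\<^bsup>-x\<^esup>\<close> up to order \<open>k\<close>,
multiplied by powers of \<open>x\<close> up to the \<open>k\<close>-th.\<close>

function borel_coeff :: "(nat \<Rightarrow> real) \<Rightarrow> (nat \<Rightarrow> complex) \<Rightarrow> nat \<Rightarrow> complex" where
  "borel_coeff M c j = (c j - (\<Sum>k\<in>{..<j}. (let d = borel_coeff M c k; l = borel_scale M k d in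
       d * of_real (l ^ j / l ^ k * power_exp_deriv k j 0)))) / fact j"
  by auto
termination by (relation "Wellfounded.measure (\<lambda>(M, c, j). j)") auto

declare borel_coeff.simps [simp del]

text \<open>Borel's theorem on the half line. The function is \<open>\<Sum> d\<^sub>k s\<^sup>k e\<^bsup>- l\<^sub>k s\<^esup>\<close> with large dilation factors \<open>l\<^sub>k\<close>; the
exponential takes the place of the usual smooth cut-off and provides the rapid decrease as well.\<close>

theorem borel_half_line:
  fixes c :: "nat \<Rightarrow> complex"
  shows "\<exists>G. half_schwartz G \<and> (\<forall>k. G k 0 = c k)"
proof -
  have "\<forall>k. \<exists>M\<ge>0. \<forall>j\<le>k. \<forall>m\<le>k. \<forall>x\<ge>0. x ^ m * \<bar>power_exp_deriv k j x\<bar> \<le> M"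
    using power_exp_deriv_bounded_uniform by blast
  then obtain M where M0: "\<And>k. M k \<ge> 0"
    and M: "\<And>k j m x. j \<le> k \<Longrightarrow> m \<le> k \<Longrightarrow> x \<ge> 0 \<Longrightarrow> x ^ m * \<bar>power_exp_deriv k j x\<bar> \<le> M k"
    by metis
  \<comment> \<open>\<open>l k\<close> dilates the \<open>k\<close>-th term, and \<open>F j k\<close> is its \<open>j\<close>-th derivative.\<close>
  define d where "d = borel_coeff M c"
  define l where "l = (\<lambda>k. borel_scale M k (d k))"
  have l1: "l k \<ge> 1" for k unfolding l_def borel_scale_def using M0 by simp
  have ld: "norm (d k) * M k \<le> l k * (1/2) ^ k" for k
    unfolding l_def borel_scale_def by (simp add: field_simps)
  define F where "F = (\<lambda>j k s. d k * of_real (l k ^ j / l k ^ k * power_exp_deriv k j (l k * s)))"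
  have deriv: "(F j k has_vector_derivative F (Suc j) k s) (at s within {0..})" for j k s
  proof -
    have "((\<lambda>s. power_exp_deriv k j (l k * s)) has_real_derivative power_exp_deriv k (Suc j) (l k * s) * l k) (at s within {0..})"
      by (rule DERIV_chain2[OF power_exp_deriv_has_derivative]) (auto intro!: derivative_eq_intros)
    then have "((\<lambda>s. l k ^ j / l k ^ k * power_exp_deriv k j (l k * s)) has_real_derivative
        l k ^ j / l k ^ k * (power_exp_deriv k (Suc j) (l k * s) * l k)) (at s within {0..})"
      by (rule DERIV_cmult)
    then have "((\<lambda>s. complex_of_real (l k ^ j / l k ^ k * power_exp_deriv k j (l k * s))) has_vector_derivative
        of_real (l k ^ j / l k ^ k * (power_exp_deriv k (Suc j) (l k * s) * l k))) (at s within {0..})"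
      by (intro has_vector_derivative_of_real) (simp add: has_real_derivative_iff_has_vector_derivative)
    then have "(F j k has_vector_derivative d k * of_real (l k ^ j / l k ^ k * (power_exp_deriv k (Suc j) (l k * s) * l k))) (at s within {0..})"
      unfolding F_def by (rule has_vector_derivative_mult_right)
    then show ?thesis unfolding F_def by (simp add: mult_ac)
  qed
  have bound: "\<exists>B. summable B \<and> (\<forall>k. \<forall>s\<ge>0. s ^ m * norm (F j k s) \<le> B k)" for j m
  proof -
    have "\<forall>k. \<exists>B. \<forall>x\<ge>0. x ^ m * \<bar>power_exp_deriv k j x\<bar> \<le> B" using power_exp_deriv_bounded by blast
    then obtain C where C: "\<And>k x. x \<ge> 0 \<Longrightarrow> x ^ m * \<bar>power_exp_deriv k j x\<bar> \<le> C k" by metis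
    define B where "B = (\<lambda>k. if k > max j m then (1/2) ^ k else norm (d k) * (l k ^ j / l k ^ k) * C k)"
    have "\<forall>\<^sub>F k in sequentially. B k = (1/2) ^ k"
      using eventually_gt_at_top[of "max j m"] by eventually_elim (auto simp: B_def)
    then have "summable B = summable (\<lambda>k. (1/2::real) ^ k)" by (rule summable_cong)
    then have "summable B" by (simp add: summable_geometric)
    moreover have "s ^ m * norm (F j k s) \<le> B k" if s: "s \<ge> 0" for k s
    proof -
      have ls: "0 \<le> l k * s" using l1[of k] s by simp
      have "s ^ m \<le> (l k * s) ^ m"
        using l1[of k] s mult_right_mono[of 1 "l k" s] by (intro power_mono) auto
      then have *: "s ^ m * norm (F j k s) \<le> norm (d k) * (l k ^ j / l k ^ k) * ((l k * s) ^ m * \<bar>power_exp_deriv k j (l k * s)\<bar>)"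
      proof -
        have "s ^ m * norm (F j k s) = s ^ m * (norm (d k) * (l k ^ j / l k ^ k) * \<bar>power_exp_deriv k j (l k * s)\<bar>)"
          unfolding F_def using l1[of k] by (simp add: norm_mult abs_mult norm_divide norm_power)
        also have "\<dots> \<le> (l k * s) ^ m * (norm (d k) * (l k ^ j / l k ^ k) * \<bar>power_exp_deriv k j (l k * s)\<bar>)"
          using \<open>s ^ m \<le> (l k * s) ^ m\<close> l1[of k] by (intro mult_right_mono) auto
        finally show ?thesis by (simp add: mult_ac)
      qed
      show ?thesis
      proof (cases "k > max j m")
        case False
        note *
        also have "norm (d k) * (l k ^ j / l k ^ k) * ((l k * s) ^ m * \<bar>power_exp_deriv k j (l k * s)\<bar>)
            \<le> norm (d k) * (l k ^ j / l k ^ k) * C k"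
          using C[OF ls] l1[of k] by (intro mult_left_mono) auto
        also have "\<dots> = B k" unfolding B_def if_not_P[OF False] ..
        finally show ?thesis .
      next
        case True
        have "l k ^ Suc j \<le> l k ^ k" using True l1[of k] by (intro power_increasing) auto
        then have "l k ^ j / l k ^ k \<le> 1 / l k"
          using l1[of k] by (simp add: field_simps)
        note *
        also have "norm (d k) * (l k ^ j / l k ^ k) * ((l k * s) ^ m * \<bar>power_exp_deriv k j (l k * s)\<bar>)
            \<le> norm (d k) * (1 / l k) * M k"
          using M[of j k m "l k * s"] True ls l1[of k] \<open>l k ^ j / l k ^ k \<le> 1 / l k\<close>
          by (intro mult_mono) auto
        also have "\<dots> \<le> (1/2) ^ k"
          using ld[of k] l1[of k] by (simp add: field_simps)
        finally show ?thesis using True by (simp add: B_def)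
      qed
    qed
    ultimately show ?thesis by blast
  qed
  have "(\<Sum>k. F j k 0) = c j" for j
  proof -
    have "(\<Sum>k. F j k 0) = (\<Sum>k\<in>{..<Suc j}. F j k 0)"
      by (rule suminf_finite) (auto simp: F_def power_exp_deriv_at_0)
    also have "\<dots> = (\<Sum>k\<in>{..<j}. F j k 0) + d j * fact j"
      using l1[of j] by (simp add: F_def power_exp_deriv_at_0)
    also have "d j = (c j - (\<Sum>k\<in>{..<j}. F j k 0)) / fact j"
      unfolding d_def by (subst borel_coeff.simps) (simp add: F_def Let_def d_def l_def)
    finally show ?thesis by simp
  qed
  then show ?thesis
    using half_schwartz_series(1)[of F, OF deriv bound] by (intro exI[of _ "\<lambda>j s. \<Sum>k. F j k s"]) auto
qed

lemma schwartz_spaceI: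
  assumes deriv: "\<And>k t. (F k has_vector_derivative F (Suc k) t) (at t)"
    and bound: "\<And>k m. \<exists>B. \<forall>t. \<bar>t\<bar> ^ m * norm (F k t) \<le> B"
  shows "F 0 \<in> schwartz_space"
proof -
  have eq: "(vderiv ^^ k) (F 0) = F k" for k
    by (induction k) (auto simp: vector_derivative_at[OF deriv])
  show ?thesis
    unfolding schwartz_space_def mem_Collect_eq eq
  proof (intro conjI allI)
    show "F k differentiable (at t)" for k t
      using deriv[of k t] by (rule differentiableI_vector)
    show "bounded (range (\<lambda>t. of_real (t ^ m) * F k t))" for m k
    proof -
      obtain B where "\<forall>t. \<bar>t\<bar> ^ m * norm (F k t) \<le> B" using bound by blast
      then show ?thesis unfolding bounded_iff by (auto simp: norm_mult norm_power)
    qed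
  qed
qed

lemma schwartz_spaceE:
  assumes "f \<in> schwartz_space"
  obtains F where "f = F 0" "\<And>k t. (F k has_vector_derivative F (Suc k) t) (at t)"
    "\<And>k m. \<exists>B. \<forall>t. \<bar>t\<bar> ^ m * norm (F k t) \<le> B"
proof -
  define F where "F = (\<lambda>k. (vderiv ^^ k) f)"
  have "(F k has_vector_derivative F (Suc k) t) (at t)" for k t
    using assms unfolding F_def schwartz_space_def by (auto simp: vector_derivative_works[symmetric])
  moreover have "\<exists>B. \<forall>t. \<bar>t\<bar> ^ m * norm (F k t) \<le> B" for k m
  proof -
    have "bounded (range (\<lambda>t. of_real (t ^ m) * F k t))"
      using assms unfolding F_def schwartz_space_def by blast
    then show ?thesis unfolding bounded_iff by (auto simp: norm_mult norm_power)
  qed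
  moreover have "f = F 0" by (simp add: F_def)
  ultimately show thesis using that by blast
qed

text \<open>The reflected Borel function with the same one-sided derivatives at 0 continues \<open>G\<close> to the negative half
line.\<close>

theorem half_schwartz_extends:
  assumes G: "half_schwartz G"
  shows "\<exists>f\<in>schwartz_space. \<forall>t\<ge>0. f t = G 0 t"
proof -
  obtain H where H: "half_schwartz H" and H0: "\<And>k. H k 0 = (-1) ^ k * G k 0"
    using borel_half_line[of "\<lambda>k. (-1) ^ k * G k 0"] by blast
  define F where "F = (\<lambda>k t. if t \<in> {0..} then G k t else (-1) ^ k * H k (- t))"
  have "(F k has_vector_derivative F (Suc k) t) (at t within UNIV)" for k t
    unfolding F_def
  proof (rule has_vector_derivative_If_within_closures[where T="{..<0}"])
    have c: "closure {0::real..} \<inter> closure {..<0} = {0}" by (auto simp: closure_lessThan)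
    show "t \<in> {0..} \<union> {..<0}" by auto
    show "UNIV = {0..} \<union> {..<0::real}" by auto
    show "(G k has_vector_derivative G (Suc k) t) (at t within {0..} \<union> closure {0..} \<inter> closure {..<0})"
      if "t \<in> {0..} \<union> closure {0..} \<inter> closure {..<0}"
    proof -
      have "{0::real..} \<union> closure {0..} \<inter> closure {..<0} = {0..}" unfolding c by auto
      with that G show ?thesis by (auto simp: half_schwartz_def)
    qed
    show "((\<lambda>t. (-1) ^ k * H k (- t)) has_vector_derivative (-1) ^ Suc k * H (Suc k) (- t))
      (at t within {..<0} \<union> closure {0..} \<inter> closure {..<0})"
      if "t \<in> {..<0} \<union> closure {0..} \<inter> closure {..<0}"
    proof -
      have s: "{..<0::real} \<union> closure {0..} \<inter> closure {..<0} = {..0}" unfolding c by auto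
      have im: "uminus ` {..0::real} = {0..}"
        by (auto simp: image_iff intro: bexI[of _ "- x" for x])
      have "(uminus has_vector_derivative (-1::real)) (at t within {..0})"
        by (auto intro!: derivative_eq_intros)
      moreover have "(H k has_vector_derivative H (Suc k) (- t)) (at (- t) within uminus ` {..0})"
        unfolding im using H that unfolding s by (auto simp: half_schwartz_def)
      ultimately have "(H k \<circ> uminus has_vector_derivative (-1) *\<^sub>R H (Suc k) (- t)) (at t within {..0})"
        by (rule vector_diff_chain_within)
      then have "((\<lambda>t. (-1) ^ k * (H k \<circ> uminus) t) has_vector_derivative (-1) ^ k * ((-1) *\<^sub>R H (Suc k) (- t))) (at t within {..0})"
        by (rule has_vector_derivative_mult_right)
      then show ?thesis unfolding s by simp
    qed
    have z: "t = 0" if "t \<in> closure {0..}" "t \<in> closure {..<0}" using that c by blast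
    show "G k t = (-1) ^ k * H k (- t)" if "t \<in> closure {0..}" "t \<in> closure {..<0}"
      unfolding z[OF that] by (simp add: H0 flip: power_mult_distrib mult.assoc)
    show "G (Suc k) t = (-1) ^ Suc k * H (Suc k) (- t)" if "t \<in> closure {0..}" "t \<in> closure {..<0}"
      unfolding z[OF that] minus_zero H0 by (simp flip: power_mult_distrib mult.assoc)
  qed
  moreover have "\<exists>B. \<forall>t. \<bar>t\<bar> ^ m * norm (F k t) \<le> B" for k m
  proof -
    obtain B1 where B1: "\<forall>t\<ge>0. t ^ m * norm (G k t) \<le> B1" using G unfolding half_schwartz_def by blast
    obtain B2 where B2: "\<forall>t\<ge>0. t ^ m * norm (H k t) \<le> B2" using H unfolding half_schwartz_def by blast
    have "\<bar>t\<bar> ^ m * norm (F k t) \<le> max B1 B2" for t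
      using B1[rule_format, of t] B2[rule_format, of "- t"]
      by (cases "t \<ge> 0") (auto simp: F_def norm_mult norm_power le_max_iff_disj)
    then show ?thesis by blast
  qed
  ultimately have "F 0 \<in> schwartz_space" by (intro schwartz_spaceI) auto
  then show ?thesis by (rule bexI[rotated]) (auto simp: F_def)
qed


section \<open>The Laguerre operator on smooth functions\<close>

text \<open>The operator to which \<open>T\<^sub>\<alpha>\<close> is conjugate under multiplication by \<open>t\<^bsup>\<alpha>/2\<^esup>\<close>: the singular term
\<open>\<alpha>\<^sup>2 / (4 t)\<close> cancels. Here \<open>F k\<close> stands for the \<open>k\<close>-th derivative of the function.\<close>

definition laguerre_core :: "real \<Rightarrow> (nat \<Rightarrow> real \<Rightarrow> complex) \<Rightarrow> real \<Rightarrow> complex"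
  where "laguerre_core \<alpha> F t = of_real t * F 2 t + of_real (\<alpha> + 1) * F 1 t + of_real ((\<alpha> + 1) / 2 - t / 4) * F 0 t"

lemma laguerre_diff_powr:
  assumes F: "\<And>k s. s > 0 \<Longrightarrow> k < 2 \<Longrightarrow> (F k has_vector_derivative F (Suc k) s) (at s)"
    and f: "\<And>s. s > 0 \<Longrightarrow> f s = of_real (s powr (\<alpha> / 2)) * F 0 s"
    and t: "t > 0"
  shows "laguerre_diff \<alpha> f t = of_real (t powr (\<alpha> / 2)) * laguerre_core \<alpha> F t"
proof -
  define b where "b = \<alpha> / 2"
  have pw: "((\<lambda>s. complex_of_real (s powr r)) has_vector_derivative of_real (r * s powr (r - 1))) (at s)" if "s > 0" for r s
    using has_real_derivative_powr[OF that, of r]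
    by (intro has_vector_derivative_of_real) (simp add: has_real_derivative_iff_has_vector_derivative)
  define f1 where "f1 = (\<lambda>s. of_real (s powr b) * F 1 s + of_real (b * s powr (b - 1)) * F 0 s)"
  define f2 where "f2 = (\<lambda>s. of_real (s powr b) * F 2 s + of_real (b * s powr (b - 1)) * F 1 s
     + (of_real (b * s powr (b - 1)) * F 1 s + of_real (b * ((b - 1) * s powr (b - 1 - 1))) * F 0 s))"
  have F0: "(F 0 has_vector_derivative F 1 s) (at s)" if "s > 0" for s using F[OF that, of 0] by simp
  have F1: "(F 1 has_vector_derivative F 2 s) (at s)" if "s > 0" for s
    using F[OF that, of 1] by (simp add: numeral_2_eq_2)
  have d1: "(f has_vector_derivative f1 s) (at s)" if "s > 0" for s
  proof (rule has_vector_derivative_transform_within_open)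
    show "((\<lambda>s. of_real (s powr b) * F 0 s) has_vector_derivative f1 s) (at s)"
      unfolding f1_def using has_vector_derivative_mult[OF pw[OF that] F0[OF that]] .
    show "open {0::real<..}" "s \<in> {0<..}" using that by auto
    show "of_real (y powr b) * F 0 y = f y" if "y \<in> {0<..}" for y using that f by (simp add: b_def)
  qed
  have v1: "vderiv f s = f1 s" if "s > 0" for s
    using d1[OF that] by (rule vector_derivative_at)
  have pw': "((\<lambda>s. complex_of_real (b * s powr (b - 1))) has_vector_derivative of_real (b * ((b - 1) * t powr (b - 1 - 1)))) (at t)"
    using has_vector_derivative_mult_right[OF pw[OF t, of "b - 1"], of "of_real b"] by simp
  have "(f1 has_vector_derivative f2 t) (at t)"
    unfolding f1_def f2_def
    by (intro has_vector_derivative_add has_vector_derivative_mult pw[OF t] pw' F0[OF t] F1[OF t])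
  then have "(vderiv f has_vector_derivative f2 t) (at t)"
    by (rule has_vector_derivative_transform_within_open[where S="{0<..}"]) (use t v1 in auto)
  then have v2: "vderiv (vderiv f) t = f2 t" by (rule vector_derivative_at)
  define X where "X = complex_of_real (t powr b)"
  have p1: "complex_of_real (t powr (b - 1)) = X / of_real t"
    using t unfolding X_def by (simp add: powr_diff)
  have p2: "complex_of_real (t powr (b - 1 - 1)) = X / (of_real t * of_real t)"
    using t unfolding X_def by (simp add: powr_diff power2_eq_square)
  have al: "\<alpha> = 2 * b" by (simp add: b_def)
  define z where "z = complex_of_real t"
  define c where "c = complex_of_real b"
  have znz: "z \<noteq> 0" using t by (simp add: z_def)
  have ft: "f t = X * F 0 t" using f[OF t] by (simp add: X_def b_def)
  have f1t: "f1 t = X * F 1 t + c * (X / z) * F 0 t"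
    unfolding f1_def of_real_mult p1 X_def[symmetric] c_def z_def ..
  have f2t: "f2 t = X * F 2 t + c * (X / z) * F 1 t + (c * (X / z) * F 1 t + c * ((c - 1) * (X / (z * z))) * F 0 t)"
    unfolding f2_def of_real_mult p1 p2 X_def[symmetric] c_def z_def by simp
  have "laguerre_diff \<alpha> f t = z * f2 t + f1 t - z / 4 * (X * F 0 t) - c * c / z * (X * F 0 t)
      + (2 * c + 1) / 2 * (X * F 0 t)"
    unfolding laguerre_diff_def v1[OF t] v2 ft al z_def c_def by (simp add: power2_eq_square)
  also have "\<dots> = X * (z * F 2 t + (2 * c + 1) * F 1 t + ((2 * c + 1) / 2 - z / 4) * F 0 t)"
    unfolding f1t f2t using znz by (simp add: field_simps)
  also have "\<dots> = of_real (t powr (\<alpha> / 2)) * laguerre_core \<alpha> F t"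
    unfolding laguerre_core_def al z_def c_def X_def by simp
  finally show ?thesis .
qed

lemma laguerre_core_schwartz:
  assumes F: "\<And>k t. (F k has_vector_derivative F (Suc k) t) (at t)"
    and B: "\<And>k m. \<exists>B. \<forall>t. \<bar>t\<bar> ^ m * norm (F k t) \<le> B"
  shows "laguerre_core \<alpha> F \<in> schwartz_space"
proof -
  define G where "G = (\<lambda>k t. of_real t * F (Suc (Suc k)) t + of_real (real k + \<alpha> + 1) * F (Suc k) t
      + of_real ((\<alpha> + 1) / 2) * F k t - of_real (1/4) * (of_real t * F k t) - of_real (real k / 4) * F (k - 1) t)"
  have id: "((\<lambda>t. complex_of_real t) has_vector_derivative 1) (at t)" for t
    using has_vector_derivative_of_real[OF DERIV_ident] by simp
  have "(G k has_vector_derivative G (Suc k) t) (at t)" for k t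
  proof -
    have *: "of_real (real k / 4) * F (Suc (k - 1)) t = of_real (real k / 4) * F k t" by (cases k) auto
    have tF: "((\<lambda>t. of_real t * F j t) has_vector_derivative of_real t * F (Suc j) t + 1 * F j t) (at t)" for j
      by (rule has_vector_derivative_mult[OF id F])
    have cF: "((\<lambda>t. of_real c * F j t) has_vector_derivative of_real c * F (Suc j) t) (at t)" for c j
      by (rule has_vector_derivative_mult_right[OF F])
    have "(G k has_vector_derivative (of_real t * F (Suc (Suc (Suc k))) t + 1 * F (Suc (Suc k)) t) + of_real (real k + \<alpha> + 1) * F (Suc (Suc k)) t
      + of_real ((\<alpha> + 1) / 2) * F (Suc k) t - of_real (1/4) * (of_real t * F (Suc k) t + 1 * F k t)
      - of_real (real k / 4) * F (Suc (k - 1)) t) (at t)"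
      unfolding G_def
      using has_vector_derivative_diff[OF has_vector_derivative_diff[OF has_vector_derivative_add[OF
        has_vector_derivative_add[OF tF[of "Suc (Suc k)"] cF[of "real k + \<alpha> + 1" "Suc k"]] cF[of "(\<alpha> + 1) / 2" k]]
          has_vector_derivative_mult_right[OF tF[of k], of "of_real (1/4)"]] cF[of "real k / 4" "k - 1"]]
      .
    then show ?thesis unfolding * by (simp add: G_def algebra_simps add_divide_distrib)
  qed
  moreover have "\<exists>B. \<forall>t. \<bar>t\<bar> ^ m * norm (G k t) \<le> B" for k m
  proof -
    obtain B1 where B1: "\<And>t. \<bar>t\<bar> ^ Suc m * norm (F (Suc (Suc k)) t) \<le> B1" using B by blast
    obtain B2 where B2: "\<And>t. \<bar>t\<bar> ^ m * norm (F (Suc k) t) \<le> B2" using B by blast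
    obtain B3 where B3: "\<And>t. \<bar>t\<bar> ^ m * norm (F k t) \<le> B3" using B by blast
    obtain B4 where B4: "\<And>t. \<bar>t\<bar> ^ Suc m * norm (F k t) \<le> B4" using B by blast
    obtain B5 where B5: "\<And>t. \<bar>t\<bar> ^ m * norm (F (k - 1) t) \<le> B5" using B by blast
    have "\<bar>t\<bar> ^ m * norm (G k t) \<le> B1 + \<bar>real k + \<alpha> + 1\<bar> * B2 + \<bar>(\<alpha> + 1) / 2\<bar> * B3 + 1/4 * B4 + real k / 4 * B5" for t
    proof -
      have "norm (G k t) \<le> norm (of_real t * F (Suc (Suc k)) t) + norm (of_real (real k + \<alpha> + 1) * F (Suc k) t)
         + norm (of_real ((\<alpha> + 1) / 2) * F k t) + norm (of_real (1/4) * (of_real t * F k t)) + norm (of_real (real k / 4) * F (k - 1) t)"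
        unfolding G_def
        by (intro order_trans[OF norm_triangle_ineq4] order_trans[OF norm_triangle_ineq] add_mono order_refl)
      also have "\<dots> = \<bar>t\<bar> * norm (F (Suc (Suc k)) t) + \<bar>real k + \<alpha> + 1\<bar> * norm (F (Suc k) t)
         + \<bar>(\<alpha> + 1) / 2\<bar> * norm (F k t) + 1/4 * (\<bar>t\<bar> * norm (F k t)) + real k / 4 * norm (F (k - 1) t)"
        by (simp only: norm_mult norm_of_real) simp
      finally have "\<bar>t\<bar> ^ m * norm (G k t) \<le> \<bar>t\<bar> ^ m * \<dots>" by (rule mult_left_mono) simp
      also have "\<dots> = \<bar>t\<bar> ^ Suc m * norm (F (Suc (Suc k)) t) + \<bar>real k + \<alpha> + 1\<bar> * (\<bar>t\<bar> ^ m * norm (F (Suc k) t))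
         + \<bar>(\<alpha> + 1) / 2\<bar> * (\<bar>t\<bar> ^ m * norm (F k t)) + 1/4 * (\<bar>t\<bar> ^ Suc m * norm (F k t)) + real k / 4 * (\<bar>t\<bar> ^ m * norm (F (k - 1) t))"
        by (simp add: distrib_left mult_ac)
      also have "\<dots> \<le> B1 + \<bar>real k + \<alpha> + 1\<bar> * B2 + \<bar>(\<alpha> + 1) / 2\<bar> * B3 + 1/4 * B4 + real k / 4 * B5"
        by (intro add_mono mult_left_mono B1 B2 B3 B4 B5) auto
      finally show ?thesis .
    qed
    then show ?thesis by blast
  qed
  ultimately have "G 0 \<in> schwartz_space" by (intro schwartz_spaceI) auto
  also have "G 0 = laguerre_core \<alpha> F"
    by (rule ext) (simp add: G_def laguerre_core_def numeral_2_eq_2 algebra_simps)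
  finally show ?thesis .
qed

lemma laguerre_diff_D_space:
  assumes "f \<in> D_space \<alpha>"
  shows "\<exists>g\<in>D_space \<alpha>. \<forall>t>0. laguerre_diff \<alpha> f t = g t"
proof -
  from assms obtain F0 where f: "f = (\<lambda>t. of_real (t powr (\<alpha> / 2)) * F0 t)" and F0: "F0 \<in> schwartz_space"
    unfolding D_space_def by blast
  obtain F where F: "F0 = F 0" "\<And>k t. (F k has_vector_derivative F (Suc k) t) (at t)"
    "\<And>k m. \<exists>B. \<forall>t. \<bar>t\<bar> ^ m * norm (F k t) \<le> B"
    by (rule schwartz_spaceE[OF F0], rule that)
  have eq: "laguerre_diff \<alpha> f t = of_real (t powr (\<alpha> / 2)) * laguerre_core \<alpha> F t" if "t > 0" for t
  proof (rule laguerre_diff_powr[where F=F])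
    show "f s = of_real (s powr (\<alpha> / 2)) * F 0 s" for s by (simp add: f F(1))
  qed (use F(2) that in auto)
  have mem: "(\<lambda>t. of_real (t powr (\<alpha> / 2)) * laguerre_core \<alpha> F t) \<in> D_space \<alpha>"
    unfolding D_space_def mem_Collect_eq
    by (intro exI[of _ "laguerre_core \<alpha> F"] conjI refl laguerre_core_schwartz[where F=F] F(2,3))
  show ?thesis
    by (rule bexI[OF _ mem]) (simp add: eq)
qed

section \<open>Weighted integrals and the Lebesgue spaces\<close>

text \<open>Up to constants, every element of \<open>\<D>\<^sub>\<alpha>\<close> is dominated by the majorant with \<open>a = \<alpha>/2\<close>. With the exponent
\<open>-2\<close> at infinity all powers \<open>r \<ge> 1\<close> are integrable there, so only the singularity at 0 restricts \<open>r\<close>.\<close>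

definition majorant :: "real \<Rightarrow> real \<Rightarrow> real"
  where "majorant a t = (if t \<le> 1 then t powr a else 1 / t\<^sup>2)"

lemma majorant_nonneg: "majorant a t \<ge> 0"
  by (simp add: majorant_def)

lemma majorant_le_1: "a \<ge> 0 \<Longrightarrow> t > 0 \<Longrightarrow> majorant a t \<le> 1"
  by (simp add: majorant_def powr_le1 divide_le_eq one_le_power)

lemma majorant_measurable: "majorant a \<in> half_measurable"
proof -
  have "majorant a \<in> borel_measurable borel" unfolding majorant_def[abs_def] by measurable
  then show ?thesis by (intro measurable_restrict_space1 measurable_completion) simp
qed

lemma AE_half_line_pos: "AE t in half_line. t > 0"
proof -
  have "AE t in lebesgue. t \<notin> {0::real}" by (intro AE_completion AE_not_in) simp
  then show ?thesis
    by (subst AE_restrict_space_iff) (auto elim: eventually_mono)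
qed

lemma majorant_integrable:
  assumes a: "a > -1"
  shows "integrable half_line (majorant a)"
proof -
  have 1: "(\<lambda>t. t powr a) integrable_on {0..1}" using integrable_on_powr_from_0[OF a, of 1] by simp
  have i1: "majorant a integrable_on {0..1}"
    using 1 by (rule integrable_eq) (simp add: majorant_def)
  have "((\<lambda>t::real. t powr (-2)) has_integral (-(1 powr (-2+1)) / (-2+1))) {1..}"
    by (rule has_integral_powr_to_inf) auto
  then have 2: "(\<lambda>t::real. t powr (-2)) integrable_on {1..}" by blast
  have i2: "majorant a integrable_on {1..}"
  proof (rule integrable_eq[OF 2])
    fix t :: real assume t: "t \<in> {1..}"
    then have "t powr (-2) = 1 / t\<^sup>2" by (simp add: powr_minus powr_numeral divide_inverse)
    with t show "t powr (-2) = majorant a t" by (cases "t = 1") (auto simp: majorant_def)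
  qed
  have neg: "negligible ({0..1} \<inter> {1::real..})"
    by (rule negligible_subset[of "{1}"]) auto
  have "{0..} = {0..1} \<union> {1::real..}" by auto
  then have "majorant a integrable_on {0..}"
    by (rule integrable_Un'[OF i1 i2 neg])
  then have "set_integrable lebesgue {0..} (majorant a)"
    by (intro nonnegative_absolutely_integrable_1) (auto simp: majorant_nonneg)
  then show ?thesis unfolding set_integrable_def by (subst integrable_restrict_space) auto
qed

lemma majorant_powr:
  assumes r: "r \<ge> 1" and t: "t > 0"
  shows "majorant a t powr r \<le> majorant (a * r) t"
proof (cases "t \<le> 1")
  case True
  then show ?thesis using t by (simp add: majorant_def powr_powr)
next
  case False
  have "(1 / t\<^sup>2) powr r \<le> (1 / t\<^sup>2) powr 1"
    using r False by (intro powr_mono') (auto simp: divide_le_eq one_le_power)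
  then show ?thesis using False by (simp add: majorant_def)
qed

lemma majorant_powr_integrable:
  assumes r: "r \<ge> 1" and a: "a * r > -1"
  shows "integrable half_line (\<lambda>t. majorant a t powr r)"
proof (rule Bochner_Integration.integrable_bound[OF majorant_integrable[OF a]])
  show "(\<lambda>t. majorant a t powr r) \<in> half_measurable"
    using majorant_measurable by measurable
  show "AE t in half_line. norm (majorant a t powr r) \<le> norm (majorant (a * r) t)"
    using AE_half_line_pos by (rule eventually_mono) (simp add: majorant_powr[OF r] majorant_nonneg)
qed

lemma Lp_enorm_class:
  assumes "f \<in> half_measurable"
  shows "Lp_enorm p (ae_class f) = (if p = \<infinity> then esssup half_line (\<lambda>t. ennreal (norm (f t)))
         else let I = (\<integral>\<^sup>+ t. ennreal (norm (f t) powr enn2real p) \<partial>half_line)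
              in if I = \<infinity> then \<infinity> else ennreal (enn2real I powr (1 / enn2real p)))"
  using assms by (simp add: Lp_enorm.abs_eq)

lemma ae_class_cases:
  obtains f where "f \<in> half_measurable" "x = ae_class f"
proof -
  have "\<exists>f. f \<in> half_measurable \<and> x = ae_class f"
    by (rule ae_fun.abs_induct) auto
  then show thesis using that by blast
qed

lemma ae_class_eq_iff:
  assumes "f \<in> half_measurable" "g \<in> half_measurable"
  shows "ae_class f = ae_class g \<longleftrightarrow> (AE t in half_line. f t = g t)"
  using Quotient_rel[OF Quotient_ae_fun, of f g] assms by auto

lemma ae_class_ops:
  assumes "f \<in> half_measurable" "g \<in> half_measurable"
  shows "ae_class f + ae_class g = ae_class (\<lambda>t. f t + g t)"
    "ae_class f - ae_class g = ae_class (\<lambda>t. f t - g t)"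
    "cscale c (ae_class f) = ae_class (\<lambda>t. c * f t)"
    "pairing (ae_class f) (ae_class g) = (LINT t|half_line. f t * g t)"
  using assms by (simp_all add: plus_ae_fun.abs_eq minus_ae_fun.abs_eq cscale.abs_eq pairing.abs_eq)

lemma zero_ae_class: "0 = ae_class (\<lambda>_. 0)"
  by (simp add: zero_ae_fun_def)

lemma Lp_finite_iff:
  assumes f: "f \<in> half_measurable" and r: "r \<ge> 1"
  shows "ae_class f \<in> Lp (ennreal r) \<longleftrightarrow> integrable half_line (\<lambda>t. norm (f t) powr r)"
proof -
  have "(\<lambda>t. norm (f t) powr r) \<in> half_measurable" using f by measurable
  then have "integrable half_line (\<lambda>t. norm (f t) powr r) \<longleftrightarrow> (\<integral>\<^sup>+ t. ennreal (norm (f t) powr r) \<partial>half_line) < \<infinity>"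
    by (simp add: integrable_iff_bounded)
  then show ?thesis using r by (auto simp: Lp_def Lp_enorm_class[OF f] Let_def top.not_eq_extremum)
qed

lemma Lp_finite_norm:
  assumes f: "f \<in> half_measurable" and r: "r \<ge> 1" and "ae_class f \<in> Lp (ennreal r)"
  shows "Lp_norm (ennreal r) (ae_class f) = (LINT t|half_line. norm (f t) powr r) powr (1 / r)"
proof -
  have i: "integrable half_line (\<lambda>t. norm (f t) powr r)" using assms Lp_finite_iff by blast
  then have "(\<integral>\<^sup>+ t. ennreal (norm (f t) powr r) \<partial>half_line) = ennreal (LINT t|half_line. norm (f t) powr r)"
    by (intro nn_integral_eq_integral) auto
  then show ?thesis using r by (simp add: Lp_norm_def Lp_enorm_class[OF f] Let_def integral_nonneg_AE)
qed

lemma Lp_top_iff: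
  assumes f: "f \<in> half_measurable"
  shows "ae_class f \<in> Lp \<infinity> \<longleftrightarrow> (\<exists>B. AE t in half_line. norm (f t) \<le> B)"
    and "ae_class f \<in> Lp \<infinity> \<Longrightarrow> AE t in half_line. norm (f t) \<le> Lp_norm \<infinity> (ae_class f)"
    and "B \<ge> 0 \<Longrightarrow> AE t in half_line. norm (f t) \<le> B \<Longrightarrow> Lp_norm \<infinity> (ae_class f) \<le> B"
proof -
  let ?S = "esssup half_line (\<lambda>t. ennreal (norm (f t)))"
  have e: "Lp_enorm \<infinity> (ae_class f) = ?S" by (simp add: Lp_enorm_class[OF f])
  have fm: "(\<lambda>t. ennreal (norm (f t))) \<in> half_measurable" using f by measurable
  have le: "?S \<le> ennreal B" if "AE t in half_line. norm (f t) \<le> B" for B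
    by (rule esssup_I[OF fm]) (use that in \<open>auto elim!: eventually_mono intro: ennreal_leI\<close>)
  show *: "AE t in half_line. norm (f t) \<le> Lp_norm \<infinity> (ae_class f)" if "ae_class f \<in> Lp \<infinity>"
  proof -
    have fin: "?S < \<infinity>" using that unfolding Lp_def mem_Collect_eq e .
    show ?thesis
      using esssup_AE[of "\<lambda>t. ennreal (norm (f t))" half_line]
    proof (rule eventually_mono)
      fix t assume "ennreal (norm (f t)) \<le> ?S"
      then have "enn2real (ennreal (norm (f t))) \<le> enn2real ?S" using fin by (intro enn2real_mono) auto
      then show "norm (f t) \<le> Lp_norm \<infinity> (ae_class f)" unfolding Lp_norm_def e by simp
    qed
  qed
  show "ae_class f \<in> Lp \<infinity> \<longleftrightarrow> (\<exists>B. AE t in half_line. norm (f t) \<le> B)"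
  proof
    assume "\<exists>B. AE t in half_line. norm (f t) \<le> B"
    then obtain B where "AE t in half_line. norm (f t) \<le> B" ..
    then have "?S \<le> ennreal B" by (rule le)
    then show "ae_class f \<in> Lp \<infinity>" unfolding Lp_def mem_Collect_eq e by (rule le_less_trans) simp
  qed (use * in blast)
  show "Lp_norm \<infinity> (ae_class f) \<le> B" if "B \<ge> 0" "AE t in half_line. norm (f t) \<le> B"
  proof -
    have "enn2real ?S \<le> enn2real (ennreal B)" using le[OF that(2)] by (intro enn2real_mono) auto
    with that(1) show ?thesis unfolding Lp_norm_def e by simp
  qed
qed

locale laguerre_exponent =
  fixes \<alpha> :: real and p :: ennreal
  assumes alpha: "\<alpha> > -1" and p1: "1 \<le> p"
    and exponent: "0 \<le> \<alpha> \<or> (-1 < \<alpha> \<and> \<alpha> < 0 \<and> ennreal (2 / (\<alpha> + 2)) < p \<and> p < ennreal (- 2 / \<alpha>))"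
begin

text \<open>For \<open>1 < r\<close> the two conditions say that \<open>t\<^bsup>\<alpha>/2\<^esup>\<close> is locally in \<open>L\<^sup>r\<close> and in \<open>L\<^sup>q\<close> for the conjugate exponent
\<open>q = r / (r - 1)\<close>.\<close>

lemma exponent_cases:
  obtains (top) "p = \<infinity>" "\<alpha> \<ge> 0"
  | (one) "p = ennreal 1" "\<alpha> \<ge> 0"
  | (mid) r where "p = ennreal r" "r > 1" "\<alpha> / 2 * r > -1" "\<alpha> / 2 * (r / (r - 1)) > -1"
proof (cases p)
  case (real r)
  then have r1: "r \<ge> 1" using p1 by (simp flip: ennreal_1)
  show thesis
  proof (cases "\<alpha> \<ge> 0")
    case True
    show thesis
    proof (cases "r = 1")
      case False
      then have "\<alpha> / 2 * r \<ge> 0" "\<alpha> / 2 * (r / (r - 1)) \<ge> 0" using True r1 by simp_all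
      then have *: "\<alpha> / 2 * r > -1" "\<alpha> / 2 * (r / (r - 1)) > -1" by linarith+
      have "r > 1" using False r1 by linarith
      then show thesis by (rule mid[OF real(2) _ *])
    qed (use True real one in auto)
  next
    case False
    with exponent real have *: "2 / (\<alpha> + 2) < r" "r < - 2 / \<alpha>"
      using alpha by (auto simp: ennreal_less_iff)
    have "2 / (\<alpha> + 2) > 1" using False alpha by simp
    with * have r: "r > 1" by linarith
    have "\<alpha> * r > -2" using *(2) False by (simp add: field_simps)
    then have "\<alpha> / 2 * r > -1" by simp
    moreover have "2 < r * (\<alpha> + 2)" using *(1) alpha by (simp add: field_simps)
    then have "\<alpha> * r > - 2 * (r - 1)" by (simp add: algebra_simps)
    then have "\<alpha> / 2 * (r / (r - 1)) > -1" using r by (simp add: field_simps)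
    ultimately show thesis by (rule mid[OF real(2) r])
  qed
next
  case top
  then have "\<alpha> \<ge> 0" using exponent by auto
  then show thesis using top that(1) by simp
qed

text \<open>The weight through which every estimate in \<open>L\<^sup>p\<close> is made: it lies in \<open>L\<^sup>p\<close> and in the dual space \<open>L\<^sup>q\<close>.\<close>

definition V :: "real \<Rightarrow> real" where "V = majorant (\<alpha> / 2)"

lemma V_nonneg: "V t \<ge> 0" by (simp add: V_def majorant_nonneg)
lemma V_measurable: "V \<in> half_measurable" by (simp add: V_def majorant_measurable)
lemma V_integrable: "integrable half_line V" unfolding V_def using alpha by (intro majorant_integrable) simp

lemma Lp_majorized:
  "\<exists>C\<ge>0. \<forall>f c. f \<in> half_measurable \<longrightarrow> c \<ge> 0 \<longrightarrow> (AE t in half_line. norm (f t) \<le> c * V t) \<longrightarrow>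
     ae_class f \<in> Lp p \<and> Lp_norm p (ae_class f) \<le> C * c"
proof -
  have fin: ?thesis if r: "p = ennreal r" "r \<ge> 1" and int: "integrable half_line (\<lambda>t. V t powr r)" for r
  proof -
    define K where "K = (LINT t|half_line. V t powr r)"
    have K: "K \<ge> 0" unfolding K_def by (intro integral_nonneg_AE) auto
    have "ae_class f \<in> Lp p \<and> Lp_norm p (ae_class f) \<le> K powr (1 / r) * c"
      if f: "f \<in> half_measurable" and c: "c \<ge> 0" and b: "AE t in half_line. norm (f t) \<le> c * V t" for f c
    proof -
      have le: "AE t in half_line. norm (f t) powr r \<le> c powr r * V t powr r"
        using b
      proof (rule eventually_mono)
        fix t assume "norm (f t) \<le> c * V t"
        then have "norm (f t) powr r \<le> (c * V t) powr r" using r by (intro powr_mono2) auto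
        then show "norm (f t) powr r \<le> c powr r * V t powr r" using c V_nonneg by (simp add: powr_mult)
      qed
      have int': "integrable half_line (\<lambda>t. norm (f t) powr r)"
      proof (rule Bochner_Integration.integrable_bound)
        show "integrable half_line (\<lambda>t. c powr r * V t powr r)" using int by simp
        show "(\<lambda>t. norm (f t) powr r) \<in> half_measurable" using f by measurable
        show "AE t in half_line. norm (norm (f t) powr r) \<le> norm (c powr r * V t powr r)"
          using le by (rule eventually_mono) simp
      qed
      then have m: "ae_class f \<in> Lp (ennreal r)" using Lp_finite_iff[OF f r(2)] by simp
      have "(LINT t|half_line. norm (f t) powr r) \<le> (LINT t|half_line. c powr r * V t powr r)"
        using int int' le by (intro integral_mono_AE) auto
      also have "\<dots> = c powr r * K" unfolding K_def by simp
      finally have "(LINT t|half_line. norm (f t) powr r) powr (1 / r) \<le> (c powr r * K) powr (1 / r)"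
        using r by (intro powr_mono2 integral_nonneg_AE) auto
      also have "\<dots> = c * K powr (1 / r)" using r K c by (simp add: powr_mult powr_powr)
      finally show ?thesis using m Lp_finite_norm[OF f r(2) m] r by (simp add: mult.commute)
    qed
    then show ?thesis by (intro exI[of _ "K powr (1 / r)"]) auto
  qed
  show ?thesis
  proof (cases rule: exponent_cases)
    case top
    have "ae_class f \<in> Lp p \<and> Lp_norm p (ae_class f) \<le> 1 * c"
      if f: "f \<in> half_measurable" and c: "c \<ge> 0" and b: "AE t in half_line. norm (f t) \<le> c * V t" for f c
    proof -
      have "AE t in half_line. norm (f t) \<le> c"
        using b AE_half_line_pos
      proof eventually_elim
        case (elim t)
        have "c * V t \<le> c * 1" unfolding V_def using top elim c by (intro mult_left_mono majorant_le_1) auto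
        with elim show ?case by simp
      qed
      then show ?thesis using Lp_top_iff[OF f] c top by auto
    qed
    then show ?thesis by (intro exI[of _ 1]) auto
  next
    case one
    show ?thesis by (rule fin[OF one(1)]) (use V_integrable V_nonneg in simp_all)
  next
    case (mid r)
    show ?thesis
      by (rule fin[OF mid(1)]) (use mid in \<open>auto simp: V_def intro!: majorant_powr_integrable\<close>)
  qed
qed

text \<open>Hoelder's inequality against \<open>V\<close>, up to a constant, from Young's inequality for functions normalised in
\<open>L\<^sup>p\<close>.\<close>

lemma Lp_weighted_integral:
  "\<exists>C\<ge>0. \<forall>f. f \<in> half_measurable \<longrightarrow> ae_class f \<in> Lp p \<longrightarrow>
     integrable half_line (\<lambda>t. norm (f t) * V t) \<and>
     (LINT t|half_line. norm (f t) * V t) \<le> C * Lp_norm p (ae_class f)"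
proof (cases rule: exponent_cases)
  case top
  define K where "K = (LINT t|half_line. V t)"
  have "K \<ge> 0" unfolding K_def by (intro integral_nonneg_AE) (simp add: V_nonneg)
  moreover have "integrable half_line (\<lambda>t. norm (f t) * V t) \<and>
     (LINT t|half_line. norm (f t) * V t) \<le> K * Lp_norm p (ae_class f)"
    if f: "f \<in> half_measurable" and m: "ae_class f \<in> Lp p" for f
  proof -
    define s where "s = Lp_norm p (ae_class f)"
    have "AE t in half_line. norm (f t) \<le> s" using Lp_top_iff(2)[OF f] m top by (simp add: s_def)
    then have b: "AE t in half_line. norm (f t) * V t \<le> s * V t"
      by (rule eventually_mono) (intro mult_right_mono V_nonneg)
    have i: "integrable half_line (\<lambda>t. norm (f t) * V t)"
    proof (rule Bochner_Integration.integrable_bound)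
      show "integrable half_line (\<lambda>t. s * V t)" using V_integrable by simp
      show "(\<lambda>t. norm (f t) * V t) \<in> half_measurable" using f V_measurable by measurable
      show "AE t in half_line. norm (norm (f t) * V t) \<le> norm (s * V t)"
        using b by (rule eventually_mono) (auto simp: V_nonneg)
    qed
    have "(LINT t|half_line. norm (f t) * V t) \<le> (LINT t|half_line. s * V t)"
      using i b V_integrable by (intro integral_mono_AE) auto
    then show ?thesis using i by (simp add: K_def s_def mult.commute)
  qed
  ultimately show ?thesis by blast
next
  case one
  have "integrable half_line (\<lambda>t. norm (f t) * V t) \<and>
     (LINT t|half_line. norm (f t) * V t) \<le> 1 * Lp_norm p (ae_class f)"
    if f: "f \<in> half_measurable" and m: "ae_class f \<in> Lp p" for f
  proof -
    have i1: "integrable half_line (\<lambda>t. norm (f t))"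
      using Lp_finite_iff[OF f, of 1] m one by simp
    have b: "AE t in half_line. norm (f t) * V t \<le> norm (f t)"
      using AE_half_line_pos
    proof (rule eventually_mono)
      fix t :: real assume "t > 0"
      then have "V t \<le> 1" unfolding V_def using one by (intro majorant_le_1) auto
      then show "norm (f t) * V t \<le> norm (f t)" using V_nonneg by (intro mult_left_le) auto
    qed
    have i: "integrable half_line (\<lambda>t. norm (f t) * V t)"
    proof (rule Bochner_Integration.integrable_bound[OF i1])
      show "(\<lambda>t. norm (f t) * V t) \<in> half_measurable" using f V_measurable by measurable
      show "AE t in half_line. norm (norm (f t) * V t) \<le> norm (norm (f t))"
        using b by (rule eventually_mono) (auto simp: V_nonneg)
    qed
    have "(LINT t|half_line. norm (f t) * V t) \<le> (LINT t|half_line. norm (f t))"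
      using i i1 b by (intro integral_mono_AE) auto
    also have "\<dots> = Lp_norm p (ae_class f)"
      using Lp_finite_norm[OF f, of 1] m one by (simp add: integral_nonneg_AE)
    finally show ?thesis using i by simp
  qed
  then show ?thesis by (intro exI[of _ 1]) auto
next
  case (mid r)
  define q where "q = r / (r - 1)"
  have q: "q > 1" "1 / r + 1 / q = 1" using mid(2) unfolding q_def by (simp_all add: field_simps)
  have Vq: "integrable half_line (\<lambda>t. V t powr q)"
    unfolding V_def using mid q by (intro majorant_powr_integrable) (auto simp: q_def)
  define K where "K = (LINT t|half_line. V t powr q)"
  have K: "K \<ge> 0" unfolding K_def by (intro integral_nonneg_AE) auto
  have "integrable half_line (\<lambda>t. norm (f t) * V t) \<and>
     (LINT t|half_line. norm (f t) * V t) \<le> (1 + K) * Lp_norm p (ae_class f)"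
    if f: "f \<in> half_measurable" and m: "ae_class f \<in> Lp p" for f
  proof -
    have r1: "r \<ge> 1" using mid by simp
    have fr: "integrable half_line (\<lambda>t. norm (f t) powr r)"
      using Lp_finite_iff[OF f r1] m mid by simp
    define J where "J = (LINT t|half_line. norm (f t) powr r)"
    define s where "s = Lp_norm p (ae_class f)"
    have s: "s = J powr (1 / r)" using Lp_finite_norm[OF f r1] m mid by (simp add: s_def J_def)
    have J0: "J \<ge> 0" unfolding J_def by (intro integral_nonneg_AE) auto
    have meas: "(\<lambda>t. norm (f t) * V t) \<in> half_measurable" using f V_measurable by measurable
    show ?thesis
    proof (cases "J = 0")
      case True
      then have "AE t in half_line. norm (f t) powr r = 0"
        unfolding J_def using fr by (subst (asm) integral_nonneg_eq_0_iff_AE) auto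
      then have z: "AE t in half_line. norm (f t) * V t = 0" by (rule eventually_mono) auto
      have "integrable half_line (\<lambda>t. norm (f t) * V t) = integrable half_line (\<lambda>t. 0::real)"
        using meas z by (intro integrable_cong_AE) auto
      moreover have "(LINT t|half_line. norm (f t) * V t) = (LINT t|half_line. 0)"
        using meas z by (intro integral_cong_AE) auto
      ultimately show ?thesis using s True K by (simp add: s_def)
    next
      case False
      then have J: "J > 0" using J0 by simp
      then have spos: "s > 0" unfolding s by simp
      have sr: "s powr r = J" unfolding s using r1 J by (simp add: powr_powr)
      have b: "norm (f t) * V t \<le> s * (norm (f t) powr r / J + V t powr q)" for t
      proof -
        have "norm (f t) / s * V t \<le> (norm (f t) / s) powr r / r + V t powr q / q"
          using mid q spos V_nonneg by (intro Youngs_inequality) auto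
        also have "\<dots> \<le> (norm (f t) / s) powr r + V t powr q"
        proof (intro add_mono)
          have div: "x / c \<le> x" if "x \<ge> 0" "c \<ge> 1" for x c :: real
            using divide_left_mono[of 1 c x] that by simp
          show "(norm (f t) / s) powr r / r \<le> (norm (f t) / s) powr r" using r1 by (intro div) auto
          show "V t powr q / q \<le> V t powr q" using q(1) by (intro div) auto
        qed
        also have "(norm (f t) / s) powr r = norm (f t) powr r / J"
          using spos by (simp add: powr_divide sr)
        finally show ?thesis using spos by (simp add: field_simps)
      qed
      have bi: "integrable half_line (\<lambda>t. s * (norm (f t) powr r / J + V t powr q))"
        using fr Vq by simp
      have i: "integrable half_line (\<lambda>t. norm (f t) * V t)"
      proof (rule Bochner_Integration.integrable_bound[OF bi meas], rule AE_I2)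
        fix t
        have "norm (norm (f t) * V t) = norm (f t) * V t" using V_nonneg by simp
        also have "\<dots> \<le> \<bar>s * (norm (f t) powr r / J + V t powr q)\<bar>"
          by (rule order_trans[OF b abs_ge_self])
        finally show "norm (norm (f t) * V t) \<le> norm (s * (norm (f t) powr r / J + V t powr q))" by simp
      qed
      have "(LINT t|half_line. norm (f t) * V t) \<le> (LINT t|half_line. s * (norm (f t) powr r / J + V t powr q))"
        using i bi b by (intro integral_mono) auto
      also have "\<dots> = s * (J / J + K)"
        using fr Vq by (simp add: J_def K_def)
      finally show ?thesis using i J by (simp add: s_def mult.commute)
    qed
  qed
  then show ?thesis using K by (intro exI[of _ "1 + K"]) auto
qed

lemma Lp_add:
  assumes "x \<in> Lp p" "y \<in> Lp p"
  shows "x + y \<in> Lp p"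
proof -
  obtain f where f: "f \<in> half_measurable" "x = ae_class f" by (rule ae_class_cases)
  obtain g where g: "g \<in> half_measurable" "y = ae_class g" by (rule ae_class_cases)
  have fg: "(\<lambda>t. f t + g t) \<in> half_measurable" using f g by simp
  have eq: "x + y = ae_class (\<lambda>t. f t + g t)" using f g by (simp add: ae_class_ops)
  have fin: ?thesis if r: "p = ennreal r" "r \<ge> 1" for r
  proof -
    have "integrable half_line (\<lambda>t. norm (f t + g t) powr r)"
    proof (rule Bochner_Integration.integrable_bound)
      show "integrable half_line (\<lambda>t. 2 powr r * (norm (f t) powr r + norm (g t) powr r))"
        using assms f g Lp_finite_iff r by auto
      show "(\<lambda>t. norm (f t + g t) powr r) \<in> half_measurable" using fg by measurable
      have "norm (f t + g t) powr r \<le> 2 powr r * (norm (f t) powr r + norm (g t) powr r)" for t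
      proof -
        have "norm (f t + g t) \<le> 2 * max (norm (f t)) (norm (g t))"
          using norm_triangle_ineq[of "f t" "g t"] by linarith
        then have "norm (f t + g t) powr r \<le> (2 * max (norm (f t)) (norm (g t))) powr r"
          using r by (intro powr_mono2) auto
        also have "\<dots> = 2 powr r * max (norm (f t)) (norm (g t)) powr r" by (simp add: powr_mult)
        also have "\<dots> \<le> 2 powr r * (norm (f t) powr r + norm (g t) powr r)"
          by (intro mult_left_mono) (auto simp: max_def)
        finally show ?thesis .
      qed
      then show "AE t in half_line. norm (norm (f t + g t) powr r) \<le> norm (2 powr r * (norm (f t) powr r + norm (g t) powr r))"
        by (intro AE_I2) (simp add: abs_of_nonneg)
    qed
    then show ?thesis unfolding eq using Lp_finite_iff[OF fg] r by auto
  qed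
  show ?thesis
  proof (cases rule: exponent_cases)
    case top
    obtain A where A: "AE t in half_line. norm (f t) \<le> A" using Lp_top_iff(1)[OF f(1)] assms f top by auto
    obtain B where B: "AE t in half_line. norm (g t) \<le> B" using Lp_top_iff(1)[OF g(1)] assms g top by auto
    have "AE t in half_line. norm (f t + g t) \<le> A + B"
      using A B by eventually_elim (intro order_trans[OF norm_triangle_ineq] add_mono)
    then show ?thesis unfolding eq using Lp_top_iff(1)[OF fg] top by auto
  qed (use fin in auto)
qed

lemma Lp_cscale:
  assumes "x \<in> Lp p"
  shows "cscale c x \<in> Lp p"
proof -
  obtain f where f: "f \<in> half_measurable" "x = ae_class f" by (rule ae_class_cases)
  have cf: "(\<lambda>t. c * f t) \<in> half_measurable" using f by simp
  have eq: "cscale c x = ae_class (\<lambda>t. c * f t)" using f by (simp add: ae_class_ops[OF f(1) f(1)])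
  have fin: ?thesis if r: "p = ennreal r" "r \<ge> 1" for r
    unfolding eq r using Lp_finite_iff[OF cf r(2)] Lp_finite_iff[OF f(1) r(2)] assms f r
    by (simp add: norm_mult powr_mult)
  show ?thesis
  proof (cases rule: exponent_cases)
    case top
    obtain A where A: "AE t in half_line. norm (f t) \<le> A" using Lp_top_iff(1)[OF f(1)] assms f top by auto
    have "AE t in half_line. norm (c * f t) \<le> norm c * A"
      using A by eventually_elim (simp add: norm_mult mult_left_mono)
    then show ?thesis unfolding eq using Lp_top_iff(1)[OF cf] top by auto
  qed (use fin in auto)
qed

lemma Lp_diff: "x \<in> Lp p \<Longrightarrow> y \<in> Lp p \<Longrightarrow> x - y \<in> Lp p"
proof -
  assume x: "x \<in> Lp p" and y: "y \<in> Lp p"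
  obtain f where f: "f \<in> half_measurable" "x = ae_class f" by (rule ae_class_cases)
  obtain g where g: "g \<in> half_measurable" "y = ae_class g" by (rule ae_class_cases)
  have "x - y = x + cscale (-1) y" using f g by (simp add: ae_class_ops[OF _ g(1)] ae_class_ops[OF f(1)])
  then show ?thesis using Lp_add[OF x Lp_cscale[OF y, of "-1"]] by (simp only:)
qed

end

section \<open>Determinacy of the moment problem\<close>

text \<open>The sets on which the integral of \<open>G\<close> vanishes form a Dynkin system containing the intersection-stable
generator \<open>{..<c}\<close>.\<close>

lemma AE_zero_if_lessThan_integrals_zero:
  fixes G :: "real \<Rightarrow> real"
  assumes int: "integrable lebesgue G"
    and zero: "\<And>c. (LINT x|lebesgue. indicator {..<c} x * G x) = 0"
  shows "AE x in lebesgue. G x = 0"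
proof -
  have intA: "integrable lebesgue (\<lambda>x. indicator A x * G x)" if "A \<in> sets lebesgue" for A
    using integrable_mult_indicator[OF that int] by simp
  have total: "(LINT x|lebesgue. G x) = 0"
  proof -
    have "(\<lambda>n. LINT x|lebesgue. indicator {..<real n} x * G x) \<longlonglongrightarrow> (LINT x|lebesgue. G x)"
    proof (rule integral_dominated_convergence[where w="\<lambda>x. \<bar>G x\<bar>"])
      show "AE x in lebesgue. (\<lambda>n. indicator {..<real n} x * G x) \<longlonglongrightarrow> G x"
      proof (rule AE_I2)
        fix x
        have "\<forall>\<^sub>F n in sequentially. indicator {..<real n} x * G x = G x"
          using eventually_gt_at_top[of "nat \<lceil>x\<rceil>"]
          by eventually_elim (simp add: indicator_def, linarith)
        then show "(\<lambda>n. indicator {..<real n} x * G x) \<longlonglongrightarrow> G x" by (rule tendsto_eventually)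
      qed
      show "(\<lambda>x. indicator {..<real n} x * G x) \<in> borel_measurable lebesgue" for n
        by (intro borel_measurable_integrable intA) simp
    qed (use int in \<open>auto simp: indicator_def\<close>)
    then show ?thesis unfolding zero by (simp add: LIMSEQ_const_iff)
  qed
  have sigma: "sigma_sets UNIV (range lessThan) = sets (borel :: real measure)"
    by (simp add: borel_Iio)
  have borel: "(LINT x|lebesgue. indicator A x * G x) = 0" if "A \<in> sets borel" for A
  proof -
    have "A \<in> sigma_sets UNIV (range lessThan)"
      using that unfolding sigma .
    then show ?thesis
    proof (induction rule: sigma_sets_induct_disjoint[rotated 2, consumes 1, case_names basic empty compl union])
      case (basic A)
      then show ?case using zero by auto
    next
      case empty
      show ?case by simp
    next
      case (compl A)
      then have A: "A \<in> sets lebesgue" unfolding sigma by simp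
      have "(LINT x|lebesgue. indicator (UNIV - A) x * G x) = (LINT x|lebesgue. G x - indicator A x * G x)"
        by (intro Bochner_Integration.integral_cong) (auto simp: indicator_def)
      also have "\<dots> = 0"
        using int intA[OF A] compl total by simp
      finally show ?case .
    next
      case (union A)
      then have A: "A i \<in> sets lebesgue" for i unfolding sigma by auto
      have "(LINT x:(\<Union>i. A i)|lebesgue. G x) = (\<Sum>i. (LINT x:(A i)|lebesgue. G x))"
        using union(1) intA[of "\<Union>i. A i"] A
        by (intro lebesgue_integral_countable_add) (auto simp: disjoint_family_on_def set_integrable_def)
      then show ?case using union by (simp add: set_lebesgue_integral_def)
    next
      show "Int_stable (range lessThan :: real set set)" 
      proof (intro Int_stableI)
        fix A B :: "real set" assume "A \<in> range lessThan" "B \<in> range lessThan"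
        then obtain a b where "A = {..<a}" "B = {..<b}" by blast
        then have "A \<inter> B = {..<min a b}" by auto
        then show "A \<inter> B \<in> range lessThan" by blast
      qed
      show "range lessThan \<subseteq> Pow (UNIV :: real set)" by auto
    qed
  qed
  have "AE x in lebesgue. G x = (\<lambda>_. 0) x"
  proof (rule density_unique_real[OF int])
    fix A assume "A \<in> sets (lebesgue :: real measure)"
    then obtain S N N' where A: "A = S \<union> N" "N \<subseteq> N'" "N' \<in> null_sets lborel" "S \<in> sets lborel"
      by (rule sets_completionE)
    have N': "AE x in lebesgue. x \<notin> N'"
      using A(3) by (intro AE_completion AE_not_in)
    have "(LINT x|lebesgue. indicator A x * G x) = (LINT x|lebesgue. indicator S x * G x)"
    proof (intro integral_cong_AE)
      show "(\<lambda>x. indicator A x * G x) \<in> borel_measurable lebesgue"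
        by (intro borel_measurable_integrable intA) fact
      show "(\<lambda>x. indicator S x * G x) \<in> borel_measurable lebesgue"
        by (intro borel_measurable_integrable intA) (use A(4) in auto)
      from N' show "AE x in lebesgue. indicator A x * G x = indicator S x * G x"
        by (rule eventually_mono) (use A(1,2) in \<open>auto simp: indicator_def\<close>)
    qed
    also have "\<dots> = 0" using borel A(4) by simp
    finally show "(LINT x:A|lebesgue. G x) = (LINT x:A|lebesgue. 0)"
      by (simp add: set_lebesgue_integral_def)
  qed simp
  then show ?thesis by simp
qed

lemma integrable_half_line_bound:
  fixes f :: "real \<Rightarrow> 'a::{banach, second_countable_topology}"
  assumes "integrable half_line g" "f \<in> half_measurable" "\<And>t. t \<ge> 0 \<Longrightarrow> norm (f t) \<le> g t"
  shows "integrable half_line f"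
  by (rule Bochner_Integration.integrable_bound[OF assms(1,2)])
     (use assms(3) in \<open>auto intro!: AE_I2 order_trans[OF _ abs_ge_self]\<close>)

text \<open>The moments of \<open>g e\<^bsup>-st\<^esup>\<close> determine those of \<open>g e\<^bsup>-(s+\<delta>)t\<^esup>\<close> by expanding \<open>e\<^bsup>-\<delta>t\<^esup>\<close>; the step \<open>\<delta>\<close> depends only on the
exponential moment of \<open>g\<close>, so it can be repeated.\<close>

lemma exp_moment_shift:
  fixes g :: "real \<Rightarrow> real" and \<delta> s :: real
  assumes \<delta>: "\<delta> > 0" and s: "s \<ge> 0" and g: "g \<in> half_measurable"
    and int: "integrable half_line (\<lambda>t. \<bar>g t\<bar> * exp (2 * \<delta> * t))"
    and mom: "\<And>n. (LINT t|half_line. t ^ n * (g t * exp (- s * t))) = 0"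
  shows "(LINT t|half_line. t ^ n * (g t * exp (- (s + \<delta>) * t))) = 0"
proof -
  have cont: "(\<lambda>t. h t) \<in> half_measurable" if "continuous_on {0..} h" for h :: "real \<Rightarrow> real"
    using that by (intro continuous_imp_measurable_on_sets_lebesgue) auto
  have es: "exp (- s * t) \<le> 1" if "t \<ge> 0" for t using s that by simp
  have pw: "t ^ m \<le> fact m / \<delta> ^ m * exp (\<delta> * t)" if "t \<ge> 0" for t m
  proof -
    have "(\<Sum>i\<in>{m}. (\<delta> * t) ^ i /\<^sub>R fact i) \<le> exp (\<delta> * t)"
      unfolding exp_def using that \<delta> by (intro sum_le_suminf summable_exp_generic) auto
    then show ?thesis using \<delta> by (simp add: field_simps)
  qed
  \<comment> \<open>One factor \<open>e\<^bsup>\<delta>t\<^esup>\<close> of the majorant absorbs \<open>t\<^sup>n\<close>, the other the partial sums \<open>P N\<close> of \<open>e\<^bsup>-\<delta>t\<^esup>\<close>.\<close>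
  define w where "w = (\<lambda>t. fact n / \<delta> ^ n * (\<bar>g t\<bar> * exp (2 * \<delta> * t)))"
  have w: "integrable half_line w" unfolding w_def using int by simp
  define P where "P = (\<lambda>N t. t ^ n * (g t * exp (- s * t)) * (\<Sum>i<N. (- \<delta> * t) ^ i /\<^sub>R fact i))"
  have Pw: "\<bar>P N t\<bar> \<le> w t" if t: "t \<ge> 0" for N t
  proof -
    have "\<bar>\<Sum>i<N. (- \<delta> * t) ^ i /\<^sub>R fact i\<bar> \<le> (\<Sum>i<N. \<bar>(- \<delta> * t) ^ i /\<^sub>R fact i\<bar>)" by (rule sum_abs)
    also have "\<dots> = (\<Sum>i<N. (\<delta> * t) ^ i /\<^sub>R fact i)"
      using \<delta> t by (simp add: abs_mult power_abs)
    also have "\<dots> \<le> exp (\<delta> * t)"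
      unfolding exp_def using \<delta> t by (intro sum_le_suminf summable_exp_generic) auto
    finally have 1: "\<bar>\<Sum>i<N. (- \<delta> * t) ^ i /\<^sub>R fact i\<bar> \<le> exp (\<delta> * t)" .
    have "\<bar>P N t\<bar> = t ^ n * (\<bar>g t\<bar> * exp (- s * t)) * \<bar>\<Sum>i<N. (- \<delta> * t) ^ i /\<^sub>R fact i\<bar>"
      unfolding P_def using t by (simp add: abs_mult)
    also have "\<dots> \<le> (fact n / \<delta> ^ n * exp (\<delta> * t)) * (\<bar>g t\<bar> * 1) * exp (\<delta> * t)"
      using 1 pw[OF t] es[OF t] t \<delta> by (intro mult_mono) auto
    also have "\<dots> = w t"
    proof -
      have "exp (2 * \<delta> * t) = exp (\<delta> * t) * exp (\<delta> * t)" by (simp flip: exp_add)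
      then show ?thesis unfolding w_def by (simp only: mult_ac mult_1)
    qed
    finally show ?thesis .
  qed
  have P_meas: "P N \<in> half_measurable" for N
    unfolding P_def by (intro borel_measurable_times g cont continuous_intros)
  have summ_int: "integrable half_line (\<lambda>t. t ^ i * (g t * exp (- s * t)))" for i
  proof (rule integrable_half_line_bound)
    show "integrable half_line (\<lambda>t. fact i / \<delta> ^ i * (\<bar>g t\<bar> * exp (2 * \<delta> * t)))" using int by simp
    show "(\<lambda>t. t ^ i * (g t * exp (- s * t))) \<in> half_measurable"
      by (intro borel_measurable_times g cont continuous_intros)
    fix t :: real assume t: "t \<ge> 0"
    have "t ^ i \<le> fact i / \<delta> ^ i * exp (\<delta> * t)" by (rule pw[OF t])
    also have "\<dots> \<le> fact i / \<delta> ^ i * exp (2 * \<delta> * t)" using \<delta> t by (intro mult_left_mono) auto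
    finally have "t ^ i * (\<bar>g t\<bar> * exp (- s * t)) \<le> (fact i / \<delta> ^ i * exp (2 * \<delta> * t)) * (\<bar>g t\<bar> * 1)"
      using es[OF t] t \<delta> by (intro mult_mono) auto
    then show "norm (t ^ i * (g t * exp (- s * t))) \<le> fact i / \<delta> ^ i * (\<bar>g t\<bar> * exp (2 * \<delta> * t))"
      using t by (simp add: abs_mult mult_ac)
  qed
  have "(LINT t|half_line. P N t) = 0" for N
  proof -
    have "P N = (\<lambda>t. \<Sum>i<N. ((- \<delta>) ^ i / fact i) * (t ^ (n + i) * (g t * exp (- s * t))))"
      unfolding P_def power_mult_distrib sum_distrib_left power_add
      by (intro ext sum.cong refl) (simp add: field_simps)
    then have "(LINT t|half_line. P N t) = (\<Sum>i<N. ((- \<delta>) ^ i / fact i) * (LINT t|half_line. t ^ (n + i) * (g t * exp (- s * t))))"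
      using summ_int by (simp add: Bochner_Integration.integral_sum)
    then show ?thesis unfolding mom by simp
  qed
  moreover have "(\<lambda>N. LINT t|half_line. P N t) \<longlonglongrightarrow> (LINT t|half_line. t ^ n * (g t * exp (- (s + \<delta>) * t)))"
  proof (rule integral_dominated_convergence[OF _ P_meas w])
    show "(\<lambda>t. t ^ n * (g t * exp (- (s + \<delta>) * t))) \<in> half_measurable"
      by (intro borel_measurable_times g cont continuous_intros)
    show "AE t in half_line. (\<lambda>N. P N t) \<longlonglongrightarrow> t ^ n * (g t * exp (- (s + \<delta>) * t))"
    proof (rule AE_I2)
      fix t
      have "(\<lambda>N. \<Sum>i<N. (- \<delta> * t) ^ i /\<^sub>R fact i) \<longlonglongrightarrow> exp (- \<delta> * t)"
        using exp_converges[of "- \<delta> * t"] unfolding sums_def .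
      then have *: "(\<lambda>N. P N t) \<longlonglongrightarrow> t ^ n * (g t * exp (- s * t)) * exp (- \<delta> * t)"
        unfolding P_def by (intro tendsto_mult tendsto_const)
      then show "(\<lambda>N. P N t) \<longlonglongrightarrow> t ^ n * (g t * exp (- (s + \<delta>) * t))"
      proof -
        have "exp (- (s + \<delta>) * t) = exp (- s * t) * exp (- \<delta> * t)"
          by (simp add: algebra_simps flip: exp_add)
        then show ?thesis using * by (simp only: mult.assoc)
      qed
    qed
    show "AE t in half_line. norm (P N t) \<le> w t" for N
      using Pw by (intro AE_I2) simp
  qed
  ultimately have "(\<lambda>N::nat. 0) \<longlonglongrightarrow> (LINT t|half_line. t ^ n * (g t * exp (- (s + \<delta>) * t)))"
    by simp
  then show ?thesis by (simp add: LIMSEQ_const_iff)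
qed

text \<open>Repeating the shift, \<open>g(t) x(t)\<close> with \<open>x(t) = e\<^bsup>-\<delta>t\<^esup>\<close> is orthogonal to all powers of \<open>x\<close>, hence by
Weierstrass to all continuous functions of \<open>x \<in> [0, 1]\<close>, and in the limit to the indicators of \<open>{..<c}\<close>.\<close>

theorem moments_determine_real:
  fixes g :: "real \<Rightarrow> real" and \<delta> :: real
  assumes \<delta>: "\<delta> > 0" and g: "g \<in> half_measurable"
    and int: "integrable half_line (\<lambda>t. \<bar>g t\<bar> * exp (2 * \<delta> * t))"
    and mom: "\<And>n. (LINT t|half_line. t ^ n * g t) = 0"
  shows "AE t in half_line. g t = 0"
proof -
  have cont: "(\<lambda>t. h t) \<in> half_measurable" if "continuous_on {0..} h" for h :: "real \<Rightarrow> real"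
    using that by (intro continuous_imp_measurable_on_sets_lebesgue) auto
  have A: "(LINT t|half_line. t ^ n * (g t * exp (- (real k * \<delta>) * t))) = 0" for n k
  proof (induction k arbitrary: n)
    case 0
    then show ?case using mom by simp
  next
    case (Suc k)
    have "(LINT t|half_line. t ^ n * (g t * exp (- (real k * \<delta> + \<delta>) * t))) = 0"
      by (rule exp_moment_shift[OF \<delta> _ g int]) (use \<delta> Suc in auto)
    then show ?case by (simp add: algebra_simps)
  qed
  define x where "x = (\<lambda>t. exp (- \<delta> * t))"
  have x01: "x t \<in> {0..1}" if "t \<ge> 0" for t using that \<delta> by (simp add: x_def)
  have x_cont: "continuous_on S x" for S unfolding x_def by (intro continuous_intros)
  define G where "G = (\<lambda>t. g t * x t)"
  have Gm: "G \<in> half_measurable"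
    unfolding G_def by (intro borel_measurable_times g cont x_cont)
  have gint: "integrable half_line G"
  proof (rule integrable_half_line_bound[OF int Gm])
    fix t :: real assume t: "t \<ge> 0"
    have "\<bar>g t\<bar> * x t \<le> \<bar>g t\<bar> * exp (2 * \<delta> * t)"
      using t \<delta> x01[OF t] by (intro mult_left_mono) (auto intro: order_trans[of _ 1])
    then show "norm (G t) \<le> \<bar>g t\<bar> * exp (2 * \<delta> * t)"
      using x01[OF t] by (simp add: G_def abs_mult)
  qed
  have xp: "x t ^ Suc i = exp (- (real (Suc i) * \<delta>) * t)" for t i
    using exp_of_nat_mult[of "Suc i" "- \<delta> * t"] unfolding x_def by (simp only: mult_ac mult_minus_left mult_minus_right)
  have hG: "integrable half_line (\<lambda>t. h t * G t)"
    if "h \<in> half_measurable" "\<And>t. t \<ge> 0 \<Longrightarrow> \<bar>h t\<bar> \<le> B" for h B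
  proof (rule integrable_half_line_bound)
    show "integrable half_line (\<lambda>t. B * \<bar>G t\<bar>)" using gint by simp
    show "(\<lambda>t. h t * G t) \<in> half_measurable" using that(1) Gm by simp
    show "norm (h t * G t) \<le> B * \<bar>G t\<bar>" if "t \<ge> 0" for t
      using \<open>\<And>t. t \<ge> 0 \<Longrightarrow> \<bar>h t\<bar> \<le> B\<close>[OF that] by (simp add: abs_mult mult_right_mono)
  qed
  have powers: "(LINT t|half_line. x t ^ i * G t) = 0" for i
  proof -
    have "x t ^ i * G t = t ^ 0 * (g t * exp (- (real (Suc i) * \<delta>) * t))" for t
      unfolding G_def xp[symmetric] by simp
    then show ?thesis using A[of 0 "Suc i"] by (simp only:)
  qed
  have B: "(LINT t|half_line. h (x t) * G t) = 0" if h: "continuous_on {0..1} h" for h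
  proof (rule ccontr)
    assume nz: "(LINT t|half_line. h (x t) * G t) \<noteq> 0"
    define I where "I = (LINT t|half_line. \<bar>G t\<bar>)"
    have I0: "I \<ge> 0" unfolding I_def by (intro integral_nonneg_AE) auto
    define e where "e = \<bar>LINT t|half_line. h (x t) * G t\<bar> / (I + 1)"
    have e: "e > 0" unfolding e_def using nz I0 by simp
    obtain q where q: "real_polynomial_function q" "\<And>y. y \<in> {0..1} \<Longrightarrow> \<bar>h y - q y\<bar> < e"
      using Stone_Weierstrass_real_polynomial_function[OF compact_Icc h e] by blast
    obtain a N where qa: "q = (\<lambda>y. \<Sum>i\<le>N. a i * y ^ i)"
      using q(1) unfolding real_polynomial_function_iff_sum by blast
    have xi: "integrable half_line (\<lambda>t. x t ^ i * G t)" for i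
    proof (rule hG[where h="\<lambda>t. x t ^ i" and B=1])
      show "(\<lambda>t. x t ^ i) \<in> half_measurable"
        by (intro cont continuous_on_power x_cont)
      show "\<bar>x t ^ i\<bar> \<le> 1" if "t \<ge> 0" for t
        using x01[OF that] by (simp add: power_abs power_le_one)
    qed
    have qx: "(\<lambda>t. q (x t) * G t) = (\<lambda>t. \<Sum>i\<le>N. a i * (x t ^ i * G t))"
      unfolding qa by (simp add: sum_distrib_left mult_ac)
    have qint: "integrable half_line (\<lambda>t. q (x t) * G t)" unfolding qx using xi by simp
    have q0: "(LINT t|half_line. q (x t) * G t) = 0"
      unfolding qx using xi powers by (simp add: Bochner_Integration.integral_sum)
    have hm: "(\<lambda>t. h (x t)) \<in> half_measurable"
    proof (rule cont)
      show "continuous_on {0..} (\<lambda>t. h (x t))"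
      proof (rule continuous_on_compose2[OF h x_cont])
        show "x ` {0..} \<subseteq> {0..1}" by (rule image_subsetI, rule x01) simp
      qed
    qed
    obtain B where B: "\<And>y. y \<in> {0..1} \<Longrightarrow> \<bar>h y\<bar> \<le> B"
    proof -
      have "bounded (h ` {0..1})" by (rule compact_imp_bounded[OF compact_continuous_image[OF h compact_Icc]])
      then obtain B where "\<forall>z\<in>h ` {0..1}. norm z \<le> B" unfolding bounded_iff ..
      then show thesis by (intro that[of B]) simp
    qed
    have hint: "integrable half_line (\<lambda>t. h (x t) * G t)"
      by (rule hG[where h="\<lambda>t. h (x t)" and B=B, OF hm B[OF x01]])
    have "\<bar>LINT t|half_line. h (x t) * G t\<bar> = \<bar>LINT t|half_line. h (x t) * G t - q (x t) * G t\<bar>"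
      using hint qint q0 by simp
    also have "\<dots> \<le> (LINT t|half_line. \<bar>h (x t) * G t - q (x t) * G t\<bar>)"
      by (rule integral_abs_bound)
    also have "\<dots> \<le> (LINT t|half_line. e * \<bar>G t\<bar>)"
    proof (rule integral_mono)
      show "\<bar>h (x t) * G t - q (x t) * G t\<bar> \<le> e * \<bar>G t\<bar>" if "t \<in> space half_line" for t
      proof -
        have "\<bar>h (x t) - q (x t)\<bar> < e" using that by (intro q(2) x01) auto
        then have "\<bar>h (x t) - q (x t)\<bar> * \<bar>G t\<bar> \<le> e * \<bar>G t\<bar>" by (intro mult_right_mono) auto
        then show ?thesis by (simp add: left_diff_distrib flip: abs_mult)
      qed
    qed (use hint qint gint in auto)
    also have "\<dots> = e * I" unfolding I_def by simp
    also have "\<dots> < e * (I + 1)" using e by simp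
    also have "\<dots> = \<bar>LINT t|half_line. h (x t) * G t\<bar>" unfolding e_def using I0 by simp
    finally show False by simp
  qed
  have C: "(LINT t|half_line. indicator {..<c} t * G t) = 0" for c
  proof -
    \<comment> \<open>Continuous functions of \<open>x\<close> increasing to the indicator of \<open>{y. y > x c}\<close>, that is of \<open>t < c\<close>.\<close>
    define h where "h = (\<lambda>(m::nat) y. max 0 (min 1 (real m * (y - x c))))"
    have "(\<lambda>m. LINT t|half_line. h m (x t) * G t) \<longlonglongrightarrow> (LINT t|half_line. indicator {..<c} t * G t)"
    proof (rule integral_dominated_convergence[where w="\<lambda>t. \<bar>G t\<bar>"])
      show "(\<lambda>t. indicator {..<c} t * G t) \<in> half_measurable"
        by (intro borel_measurable_times Gm measurable_restrict_space1 borel_measurable_indicator) simp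
      show "(\<lambda>t. h m (x t) * G t) \<in> half_measurable" for m
        unfolding h_def by (intro borel_measurable_times Gm cont continuous_intros x_cont)
      show "integrable half_line (\<lambda>t. \<bar>G t\<bar>)" using gint by simp
      show "AE t in half_line. norm (h m (x t) * G t) \<le> \<bar>G t\<bar>" for m
        by (intro AE_I2) (auto simp: h_def abs_mult intro!: mult_left_le_one_le)
      show "AE t in half_line. (\<lambda>m. h m (x t) * G t) \<longlonglongrightarrow> indicator {..<c} t * G t"
      proof (rule AE_I2, rule tendsto_mult[OF _ tendsto_const])
        fix t
        show "(\<lambda>m. h m (x t)) \<longlonglongrightarrow> indicator {..<c} t"
        proof (cases "t < c")
          case True
          then have pos: "x t - x c > 0" using \<delta> by (simp add: x_def)
          obtain m0 :: nat where m0: "1 / (x t - x c) < real m0" using reals_Archimedean2 by blast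
          have "h m (x t) = 1" if "m \<ge> m0" for m
          proof -
            have "1 / (x t - x c) \<le> real m" using m0 that by linarith
            then have "1 \<le> real m * (x t - x c)" using pos by (simp add: field_simps)
            then show ?thesis by (simp add: h_def)
          qed
          then have "\<forall>\<^sub>F m in sequentially. h m (x t) = indicator {..<c} t"
            unfolding eventually_sequentially using True by auto
          then show ?thesis by (rule tendsto_eventually)
        next
          case False
          then have "x t - x c \<le> 0" using \<delta> by (simp add: x_def)
          then have "h m (x t) = 0" for m
            using mult_nonneg_nonpos[of "real m" "x t - x c"] by (simp add: h_def)
          then show ?thesis using False by simp
        qed
      qed
    qed
    moreover have "(LINT t|half_line. h m (x t) * G t) = 0" for m
      unfolding h_def by (intro B[where h="\<lambda>y. max 0 (min 1 (real m * (y - x c)))"] continuous_intros)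
    ultimately have "(\<lambda>m::nat. 0) \<longlonglongrightarrow> (LINT t|half_line. indicator {..<c} t * G t)"
      by simp
    then show ?thesis by (simp add: LIMSEQ_const_iff)
  qed
  have "AE t in lebesgue. indicator {0..} t * G t = 0"
  proof (rule AE_zero_if_lessThan_integrals_zero)
    show "integrable lebesgue (\<lambda>t. indicator {0..} t * G t)"
      using gint by (subst (asm) integrable_restrict_space) auto
    fix c
    have "(LINT t|half_line. indicator {..<c} t * G t) = (LINT t|lebesgue. indicator {0..} t *\<^sub>R (indicator {..<c} t * G t))"
      by (rule integral_restrict_space) simp
    also have "\<dots> = (LINT t|lebesgue. indicator {..<c} t * (indicator {0..} t * G t))"
      by (simp add: mult_ac)
    finally show "(LINT t|lebesgue. indicator {..<c} t * (indicator {0..} t * G t)) = 0"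
      using C[of c] by simp
  qed
  then have "AE t in half_line. G t = 0"
    by (subst AE_restrict_space_iff) (auto elim: eventually_mono simp: indicator_def)
  then show ?thesis
    by (rule eventually_mono) (simp add: G_def x_def)
qed

section \<open>Laguerre functions and Laguerre series\<close>

lemma laguerre_fun_eq:
  assumes "t > 0"
  shows "laguerre_fun \<alpha> n t = lag_norm \<alpha> n * t powr (\<alpha> / 2) * lag_fun \<alpha> n t"
proof -
  have "t powr (- \<alpha>) * t powr \<alpha> = 1" using assms by (simp flip: powr_add)
  moreover have "exp t * exp (- t) = 1" by (simp flip: exp_add)
  ultimately have "laguerre_poly \<alpha> n t = poly (lag_poly \<alpha> n) t"
    unfolding laguerre_poly_def rodrigues[OF assms] by (simp add: mult_ac)
  then show ?thesis by (simp add: laguerre_fun_def lag_norm_def lag_fun_def)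
qed

lemma continuous_half_line_measurable:
  fixes f :: "real \<Rightarrow> 'a::{second_countable_topology, real_normed_vector}"
  assumes "continuous_on UNIV f"
  shows "f \<in> half_measurable"
  using borel_measurable_continuous_onI[OF assms]
  by (intro measurable_restrict_space1 measurable_completion) simp

lemma powr_half_line_measurable: "(\<lambda>t. t powr a) \<in> half_measurable"
proof -
  have "(\<lambda>t::real. t powr a) \<in> borel_measurable borel" by measurable
  then show ?thesis by (intro measurable_restrict_space1 measurable_completion) simp
qed

lemma lag_fun_continuous: "continuous_on S (lag_fun a n)"
  unfolding lag_fun_def[abs_def] by (auto intro!: continuous_intros)

lemma half_line_cong:
  fixes f g :: "real \<Rightarrow> complex"
  assumes f: "f \<in> half_measurable" and eq: "\<And>t. t > 0 \<Longrightarrow> g t = f t"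
  shows "g \<in> half_measurable" and "ae_class g = ae_class f"
proof -
  have "{t \<in> space half_line. t = 0} = {0}" by auto
  then have "{t \<in> space half_line. t = 0} \<in> sets half_line" by (simp add: sets_restrict_space_iff)
  then have "(\<lambda>t. if t = 0 then g 0 else f t) \<in> half_measurable"
    by (intro measurable_If f borel_measurable_const)
  moreover have "g t = (if t = 0 then g 0 else f t)" if "t \<in> space half_line" for t
    using that eq[of t] by auto
  ultimately show g: "g \<in> half_measurable"
    by (subst measurable_cong)
  show "ae_class g = ae_class f"
    unfolding ae_class_eq_iff[OF g f] using AE_half_line_pos by (rule eventually_mono) (rule eq)
qed

text \<open>The sequences of Laguerre coefficients of elements of \<open>\<D>\<^sub>\<alpha>\<close>.\<close>

definition rapidly_decreasing :: "(nat \<Rightarrow> complex) \<Rightarrow> bool"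
  where "rapidly_decreasing b \<longleftrightarrow> (\<forall>K. \<exists>C. \<forall>n. norm (b n) * (real n + 1) ^ K \<le> C)"

lemma rapidly_decreasing_mono:
  assumes a: "rapidly_decreasing a" and e: "e \<ge> 0" and b: "\<And>n. norm (b n) \<le> e * norm (a n)"
  shows "rapidly_decreasing b"
  unfolding rapidly_decreasing_def
proof
  fix K
  obtain C where C: "\<And>n. norm (a n) * (real n + 1) ^ K \<le> C"
    using a unfolding rapidly_decreasing_def by metis
  have "norm (b n) * (real n + 1) ^ K \<le> e * C" for n
  proof -
    have "norm (b n) * (real n + 1) ^ K \<le> e * norm (a n) * (real n + 1) ^ K"
      by (intro mult_right_mono b) simp
    also have "\<dots> \<le> e * C" using mult_left_mono[OF C e, of n] by (simp add: mult.assoc)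
    finally show ?thesis .
  qed
  then show "\<exists>C. \<forall>n. norm (b n) * (real n + 1) ^ K \<le> C" by (intro exI[of _ "e * C"] allI)
qed

lemma rapidly_decreasing_unit: "rapidly_decreasing (\<lambda>n. if n = m then 1 else 0)"
  unfolding rapidly_decreasing_def
proof
  show "\<exists>C. \<forall>n. norm (if n = m then 1 else 0 :: complex) * (real n + 1) ^ K \<le> C" for K
    by (intro exI[of _ "(real m + 1) ^ K"]) simp
qed

lemma rapidly_decreasing_times_power:
  assumes a: "rapidly_decreasing a"
  shows "rapidly_decreasing (\<lambda>n. (- of_nat n) ^ k * a n)"
  unfolding rapidly_decreasing_def
proof
  fix K
  obtain C where C: "\<And>n. norm (a n) * (real n + 1) ^ (k + K) \<le> C"
    using a unfolding rapidly_decreasing_def by metis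
  have "norm ((- of_nat n) ^ k * a n) * (real n + 1) ^ K \<le> C" for n
  proof -
    have "norm ((- of_nat n) ^ k * a n) * (real n + 1) ^ K = real n ^ k * (norm (a n) * (real n + 1) ^ K)"
      by (simp add: norm_mult norm_power)
    also have "\<dots> \<le> (real n + 1) ^ k * (norm (a n) * (real n + 1) ^ K)"
      by (intro mult_right_mono power_mono) auto
    also have "\<dots> = norm (a n) * (real n + 1) ^ (k + K)" by (simp add: power_add mult_ac)
    finally show ?thesis using C[of n] by linarith
  qed
  then show "\<exists>C. \<forall>n. norm ((- of_nat n) ^ k * a n) * (real n + 1) ^ K \<le> C" by (intro exI[of _ C] allI)
qed

lemma rapidly_decreasing_summable:
  assumes "rapidly_decreasing b"
  shows "summable (\<lambda>n. norm (b n) * (real n + 1) ^ K)"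
proof -
  obtain C where C: "\<And>n. norm (b n) * (real n + 1) ^ (K + 2) \<le> C"
    using assms unfolding rapidly_decreasing_def by metis
  have "summable (\<lambda>n. C * (1 / (real n + 1) ^ 2))"
    using inverse_squares_sums by (intro summable_mult) (simp add: sums_iff add_ac)
  then show ?thesis
  proof (rule summable_comparison_test'[where N=0])
    fix n
    have "norm (b n) * (real n + 1) ^ K * (real n + 1) ^ 2 \<le> C"
      using C[of n] unfolding power_add by (simp only: mult_ac)
    then have "norm (b n) * (real n + 1) ^ K \<le> C / (real n + 1) ^ 2"
      by (simp add: pos_le_divide_eq)
    then show "norm (norm (b n) * (real n + 1) ^ K) \<le> C * (1 / (real n + 1) ^ 2)"
      by simp
  qed
qed

context laguerre_exponent
begin

text \<open>A power of \<open>t\<close> that beats \<open>t\<^bsup>\<alpha>/2\<^esup>\<close> at infinity and leaves a factor \<open>t\<^sup>2\<close> to spare.\<close>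

definition decay :: nat where "decay = nat \<lceil>\<bar>\<alpha>\<bar>\<rceil> + 2"

text \<open>The bound \<open>B0\<close> serves near 0, the bound \<open>B1\<close> at infinity.\<close>

lemma powr_times_majorized:
  assumes t: "t > 0" and B0: "x \<le> B0" and B1: "t ^ decay * x \<le> B1" and x: "x \<ge> 0"
  shows "t powr (\<alpha> / 2) * x \<le> (B0 + B1) * V t"
proof -
  have B0': "B0 \<ge> 0" using B0 x by linarith
  have B1': "B1 \<ge> 0" using B1 x t by (meson less_imp_le mult_nonneg_nonneg order_trans zero_le_power)
  show ?thesis
  proof (cases "t \<le> 1")
    case True
    have "t powr (\<alpha> / 2) * x \<le> t powr (\<alpha> / 2) * (B0 + B1)" using B0 B1' by (intro mult_left_mono) auto
    then show ?thesis using True by (simp add: V_def majorant_def mult.commute)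
  next
    case False
    have "t powr (\<alpha> / 2) \<le> t powr real (nat \<lceil>\<bar>\<alpha>\<bar>\<rceil>)"
      using False by (intro powr_mono) linarith+
    also have "\<dots> = t ^ nat \<lceil>\<bar>\<alpha>\<bar>\<rceil>" by (rule powr_realpow[OF t])
    finally have "t powr (\<alpha> / 2) * x * t\<^sup>2 \<le> t ^ nat \<lceil>\<bar>\<alpha>\<bar>\<rceil> * x * t\<^sup>2"
      using x by (intro mult_right_mono) auto
    also have "\<dots> = t ^ decay * x" unfolding decay_def power_add by (simp only: mult_ac)
    also have "\<dots> \<le> B0 + B1" using B1 B0' by linarith
    finally show ?thesis using False t by (simp add: V_def majorant_def pos_le_divide_eq)
  qed
qed

definition majorized :: "(real \<Rightarrow> complex) \<Rightarrow> bool"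
  where "majorized f \<longleftrightarrow> f \<in> half_measurable \<and> (\<exists>c\<ge>0. \<forall>t>0. norm (f t) \<le> c * V t)"

lemma D_majorized:
  assumes "f \<in> D_space \<alpha>"
  shows "majorized f"
proof -
  from assms obtain F where f: "f = (\<lambda>t. of_real (t powr (\<alpha> / 2)) * F t)" and F: "F \<in> schwartz_space"
    unfolding D_space_def by blast
  obtain G where G: "F = G 0" "\<And>k t. (G k has_vector_derivative G (Suc k) t) (at t)"
    "\<And>k m. \<exists>B. \<forall>t. \<bar>t\<bar> ^ m * norm (G k t) \<le> B"
    by (rule schwartz_spaceE[OF F], rule that)
  have cF: "continuous_on UNIV F"
    unfolding G(1) using G(2)[of 0]
    by (intro continuous_at_imp_continuous_on ballI has_vector_derivative_continuous)
  obtain B0 where B0: "\<And>t. norm (F t) \<le> B0" using G(3)[where k=0 and m=0] unfolding G(1) by auto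
  obtain B1 where B1: "\<And>t. \<bar>t\<bar> ^ decay * norm (F t) \<le> B1" using G(3)[where k=0 and m=decay] unfolding G(1) by auto
  have "norm (f t) \<le> (B0 + B1) * V t" if t: "t > 0" for t
  proof -
    have "t powr (\<alpha> / 2) * norm (F t) \<le> (B0 + B1) * V t"
      using B0[of t] B1[of t] t by (intro powr_times_majorized) auto
    then show ?thesis by (simp add: f norm_mult)
  qed
  moreover have "B0 + B1 \<ge> 0"
    using order_trans[OF norm_ge_zero B0[of 0]] order_trans[OF _ B1[of 0], of 0] by simp
  moreover have "f \<in> half_measurable"
    unfolding f using continuous_half_line_measurable[OF cF] powr_half_line_measurable[of "\<alpha> / 2"]
    by measurable
  ultimately show ?thesis unfolding majorized_def by blast
qed

lemma majorized_Lp: "majorized f \<Longrightarrow> ae_class f \<in> Lp p"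
proof -
  assume "majorized f"
  then obtain c where f: "f \<in> half_measurable" "c \<ge> 0" "\<And>t. t > 0 \<Longrightarrow> norm (f t) \<le> c * V t"
    unfolding majorized_def by blast
  have "AE t in half_line. norm (f t) \<le> c * V t"
    using AE_half_line_pos by (rule eventually_mono) (rule f(3))
  then show ?thesis using Lp_majorized f(1,2) by blast
qed

lemma integral_times_majorized:
  fixes g h :: "real \<Rightarrow> complex"
  assumes h: "h \<in> half_measurable" "integrable half_line (\<lambda>t. norm (h t) * V t)"
    and g: "g \<in> half_measurable" "\<And>t. t > 0 \<Longrightarrow> norm (g t) \<le> c * V t"
  shows "integrable half_line (\<lambda>t. h t * g t)"
    and "norm (LINT t|half_line. h t * g t) \<le> c * (LINT t|half_line. norm (h t) * V t)"
proof -
  have ci: "integrable half_line (\<lambda>t. c * (norm (h t) * V t))" using h(2) by simp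
  have b: "AE t in half_line. norm (h t * g t) \<le> c * (norm (h t) * V t)"
    using AE_half_line_pos
  proof (rule eventually_mono)
    fix t :: real assume "t > 0"
    then have "norm (h t) * norm (g t) \<le> norm (h t) * (c * V t)" by (intro mult_left_mono g(2)) auto
    then show "norm (h t * g t) \<le> c * (norm (h t) * V t)" by (simp add: norm_mult mult_ac)
  qed
  show i: "integrable half_line (\<lambda>t. h t * g t)"
  proof (rule Bochner_Integration.integrable_bound[OF ci])
    show "(\<lambda>t. h t * g t) \<in> half_measurable" using h(1) g(1) by measurable
    show "AE t in half_line. norm (h t * g t) \<le> norm (c * (norm (h t) * V t))"
      using b by (rule eventually_mono) (unfold real_norm_def, rule order_trans[OF _ abs_ge_self])
  qed
  have "norm (LINT t|half_line. h t * g t) \<le> (LINT t|half_line. norm (h t * g t))"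
    by (rule integral_norm_bound)
  also have "\<dots> \<le> (LINT t|half_line. c * (norm (h t) * V t))"
    using i ci b by (intro integral_mono_AE) auto
  finally show "norm (LINT t|half_line. h t * g t) \<le> c * (LINT t|half_line. norm (h t) * V t)" by simp
qed

lemma pairing_bounded:
  assumes "majorized g"
  shows "\<exists>C\<ge>0. \<forall>x\<in>Lp p. norm (pairing x (ae_class g)) \<le> C * Lp_norm p x"
proof -
  obtain c where g: "g \<in> half_measurable" "c \<ge> 0" "\<And>t. t > 0 \<Longrightarrow> norm (g t) \<le> c * V t"
    using assms unfolding majorized_def by blast
  obtain C where C: "C \<ge> 0" "\<And>f. f \<in> half_measurable \<Longrightarrow> ae_class f \<in> Lp p \<Longrightarrow>
     integrable half_line (\<lambda>t. norm (f t) * V t) \<and>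
     (LINT t|half_line. norm (f t) * V t) \<le> C * Lp_norm p (ae_class f)"
    using Lp_weighted_integral by blast
  have "norm (pairing x (ae_class g)) \<le> (c * C) * Lp_norm p x" if x: "x \<in> Lp p" for x
  proof -
    obtain f where f: "f \<in> half_measurable" "x = ae_class f" by (rule ae_class_cases)
    note Cf = C(2)[OF f(1) x[unfolded f(2)]]
    have "norm (pairing x (ae_class g)) \<le> c * (LINT t|half_line. norm (f t) * V t)"
      unfolding f(2) ae_class_ops(4)[OF f(1) g(1)]
      by (rule integral_times_majorized(2)[OF f(1) conjunct1[OF Cf] g(1,3)])
    also have "\<dots> \<le> c * (C * Lp_norm p x)" unfolding f(2) using Cf g(2) by (intro mult_left_mono) auto
    finally show ?thesis by simp
  qed
  then show ?thesis using C(1) g(2) by (intro exI[of _ "c * C"]) auto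
qed

lemma pairing_diff:
  assumes "majorized g" "x \<in> Lp p" "y \<in> Lp p"
  shows "pairing (x - y) (ae_class g) = pairing x (ae_class g) - pairing y (ae_class g)"
proof -
  obtain c where g: "g \<in> half_measurable" "\<And>t. t > 0 \<Longrightarrow> norm (g t) \<le> c * V t"
    using assms unfolding majorized_def by blast
  obtain f where f: "f \<in> half_measurable" "x = ae_class f" by (rule ae_class_cases)
  obtain h where h: "h \<in> half_measurable" "y = ae_class h" by (rule ae_class_cases)
  have i: "integrable half_line (\<lambda>t. f t * g t)" "integrable half_line (\<lambda>t. h t * g t)"
    using Lp_weighted_integral assms(2,3) f h by (auto intro!: integral_times_majorized(1)[OF _ _ g])
  have "pairing (x - y) (ae_class g) = (LINT t|half_line. (f t - h t) * g t)"
    unfolding f(2) h(2) ae_class_ops(2)[OF f(1) h(1)] using f h g by (intro ae_class_ops(4)) auto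
  also have "\<dots> = (LINT t|half_line. f t * g t) - (LINT t|half_line. h t * g t)"
    using i by (simp add: left_diff_distrib)
  finally show ?thesis unfolding f(2) h(2) by (simp add: ae_class_ops(4)[OF _ g(1)] f(1) h(1))
qed

lemma pairing_cscale:
  assumes "g \<in> half_measurable"
  shows "pairing (cscale c x) (ae_class g) = c * pairing x (ae_class g)"
    and "pairing x (cscale c (ae_class g)) = c * pairing x (ae_class g)"
proof -
  obtain f where f: "f \<in> half_measurable" "x = ae_class f" by (rule ae_class_cases)
  show "pairing (cscale c x) (ae_class g) = c * pairing x (ae_class g)"
    using f assms by (simp add: ae_class_ops[OF f(1) f(1)] ae_class_ops(4) mult.assoc)
  show "pairing x (cscale c (ae_class g)) = c * pairing x (ae_class g)"
    using f assms by (simp add: ae_class_ops(3)[OF assms assms] ae_class_ops(4) mult.left_commute)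
qed

lemma lag_fun_powr_majorized:
  "\<exists>C\<ge>0. \<exists>K. \<forall>n. \<forall>t>0. \<bar>t ^ k * t powr (\<alpha> / 2) * lag_fun \<alpha> n t\<bar> \<le> C * (real n + 1) ^ K * V t"
proof -
  have "poly_growth (\<lambda>n t. \<bar>t ^ k * lag_fun \<alpha> n t\<bar> + \<bar>t ^ (decay + k) * lag_fun \<alpha> n t\<bar>)"
    by (intro poly_growth_add)
       (use poly_growth_lag_fun_deriv[OF alpha, of _ 0] in \<open>auto simp: poly_growth_def\<close>)
  then obtain C K where CK: "C \<ge> 0" "\<And>n t. t \<ge> 0 \<Longrightarrow>
      \<bar>\<bar>t ^ k * lag_fun \<alpha> n t\<bar> + \<bar>t ^ (decay + k) * lag_fun \<alpha> n t\<bar>\<bar> \<le> C * (real n + 1) ^ K"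
    by (rule poly_growthE) blast
  have "\<bar>t ^ k * t powr (\<alpha> / 2) * lag_fun \<alpha> n t\<bar> \<le> (2 * C) * (real n + 1) ^ K * V t" if t: "t > 0" for n t
  proof -
    have "t powr (\<alpha> / 2) * \<bar>t ^ k * lag_fun \<alpha> n t\<bar> \<le> (C * (real n + 1) ^ K + C * (real n + 1) ^ K) * V t"
    proof (intro powr_times_majorized)
      have 1: "\<bar>t ^ (decay + k) * lag_fun \<alpha> n t\<bar> = t ^ decay * \<bar>t ^ k * lag_fun \<alpha> n t\<bar>"
        using t by (simp add: abs_mult power_add)
      have 2: "0 \<le> t ^ decay * \<bar>t ^ k * lag_fun \<alpha> n t\<bar>" using t by simp
      show "\<bar>t ^ k * lag_fun \<alpha> n t\<bar> \<le> C * (real n + 1) ^ K"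
        "t ^ decay * \<bar>t ^ k * lag_fun \<alpha> n t\<bar> \<le> C * (real n + 1) ^ K"
        using CK(2)[of t n] t 2 unfolding 1 by linarith+
    qed (use t in auto)
    then show ?thesis using t by (simp add: abs_mult mult_ac)
  qed
  then show ?thesis using CK(1) by (intro exI[of _ "2 * C"] conjI exI[of _ K]) auto
qed

text \<open>The normalised Laguerre function, with values in the complex numbers; at \<open>t > 0\<close> it agrees with
\<open>laguerre_fun\<close>.\<close>

definition ell :: "nat \<Rightarrow> real \<Rightarrow> complex"
  where "ell n t = of_real (lag_norm \<alpha> n * t powr (\<alpha> / 2) * lag_fun \<alpha> n t)"

abbreviation coef :: "ae_fun \<Rightarrow> nat \<Rightarrow> complex"
  where "coef x n \<equiv> pairing x (ae_class (ell n))"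

lemma ell_measurable: "ell n \<in> half_measurable"
  unfolding ell_def[abs_def]
  using powr_half_line_measurable[of "\<alpha> / 2"] continuous_half_line_measurable[OF lag_fun_continuous, of \<alpha> n]
  by measurable

lemma ell_bound: "\<exists>C\<ge>0. \<exists>K. \<forall>n. \<forall>t>0. norm (ell n t) \<le> C * (real n + 1) ^ K * V t"
proof -
  obtain C K where CK: "C \<ge> 0" "\<And>n t. t > 0 \<Longrightarrow> \<bar>t ^ 0 * t powr (\<alpha> / 2) * lag_fun \<alpha> n t\<bar> \<le> C * (real n + 1) ^ K * V t"
    using lag_fun_powr_majorized[of 0] by blast
  obtain C' K' where CK': "C' \<ge> 0" "\<And>n t. (t::real) \<ge> 0 \<Longrightarrow> \<bar>lag_norm \<alpha> n\<bar> \<le> C' * (real n + 1) ^ K'"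
    using poly_growth_lag_norm[OF alpha] by (rule poly_growthE) blast
  have "norm (ell n t) \<le> (C' * C) * (real n + 1) ^ (K' + K) * V t" if t: "t > 0" for n t
  proof -
    have "norm (ell n t) = \<bar>lag_norm \<alpha> n\<bar> * \<bar>t ^ 0 * t powr (\<alpha> / 2) * lag_fun \<alpha> n t\<bar>"
      unfolding ell_def norm_of_real by (simp add: abs_mult mult.assoc)
    also have "\<dots> \<le> (C' * (real n + 1) ^ K') * (C * (real n + 1) ^ K * V t)"
      using CK(2)[OF t, of n] CK'(2)[of 0 n] CK'(1) by (intro mult_mono) auto
    also have "\<dots> = (C' * C) * (real n + 1) ^ (K' + K) * V t" by (simp add: power_add mult_ac)
    finally show ?thesis .
  qed
  then show ?thesis using CK(1) CK'(1) by (intro exI[of _ "C' * C"] conjI exI[of _ "K' + K"]) auto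
qed

lemma ell_majorized: "majorized (ell n)"
proof -
  obtain C K where "C \<ge> 0" "\<forall>n. \<forall>t>0. norm (ell n t) \<le> C * (real n + 1) ^ K * V t"
    using ell_bound by blast
  then show ?thesis unfolding majorized_def using ell_measurable
    by (intro conjI exI[of _ "C * (real n + 1) ^ K"]) auto
qed

lemma transform_eq_pairing:
  assumes "f \<in> D_space \<alpha>"
  shows "laguerre_transform \<alpha> f n = coef (ae_class f) n"
proof -
  have fm: "f \<in> half_measurable" using D_majorized[OF assms] by (simp add: majorized_def)
  have eq: "AE t in half_line. f t * of_real (laguerre_fun \<alpha> n t) = f t * ell n t"
    using AE_half_line_pos by (rule eventually_mono) (simp add: ell_def laguerre_fun_eq)
  have m: "(\<lambda>t. f t * ell n t) \<in> half_measurable" using fm ell_measurable by simp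
  show ?thesis
    unfolding laguerre_transform_def ae_class_ops(4)[OF fm ell_measurable]
  proof (rule integral_cong_AE[OF _ m eq])
    show "(\<lambda>t. f t * of_real (laguerre_fun \<alpha> n t)) \<in> half_measurable"
      by (rule half_line_cong(1)[OF m]) (simp add: ell_def laguerre_fun_eq)
  qed
qed

text \<open>Multiplication by \<open>t\<close> maps each Laguerre function to a combination of its neighbours, so vanishing
coefficients are preserved under multiplication by powers of \<open>t\<close>.\<close>

lemma lag_fun_moments_zero:
  fixes h :: "real \<Rightarrow> complex"
  assumes h: "h \<in> half_measurable" "integrable half_line (\<lambda>t. norm (h t) * V t)"
    and zero: "\<And>n. (LINT t|half_line. h t * ell n t) = 0"
  shows "integrable half_line (\<lambda>t. h t * of_real (t ^ k * t powr (\<alpha> / 2) * lag_fun \<alpha> n t))"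
    and "(LINT t|half_line. h t * of_real (t ^ k * t powr (\<alpha> / 2) * lag_fun \<alpha> n t)) = 0"
proof -
  define w where "w = (\<lambda>k n t. complex_of_real (t ^ k * t powr (\<alpha> / 2) * lag_fun \<alpha> n t))"
  have w_int: "integrable half_line (\<lambda>t. h t * w k n t)" for k n
  proof -
    obtain C K where CK: "\<And>n t. t > 0 \<Longrightarrow> \<bar>t ^ k * t powr (\<alpha> / 2) * lag_fun \<alpha> n t\<bar> \<le> C * (real n + 1) ^ K * V t"
      using lag_fun_powr_majorized[of k] by blast
    have m: "w k n \<in> half_measurable"
    proof -
      have "continuous_on UNIV (\<lambda>t::real. t ^ k)" by (intro continuous_intros)
      note this[THEN continuous_half_line_measurable, measurable]
      note powr_half_line_measurable[of "\<alpha> / 2", measurable]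
      note continuous_half_line_measurable[OF lag_fun_continuous, of \<alpha> n, measurable]
      show ?thesis unfolding w_def by measurable
    qed
    show ?thesis
    proof (rule integral_times_majorized(1)[OF h m])
      show "norm (w k n t) \<le> C * (real n + 1) ^ K * V t" if "t > 0" for t
        using CK[OF that, of n] unfolding w_def norm_of_real .
    qed
  qed
  have w_zero: "(LINT t|half_line. h t * w k n t) = 0" for k n
  proof (induction k arbitrary: n)
    case 0
    have e: "ell n t = of_real (lag_norm \<alpha> n) * w 0 n t" for t
      by (simp add: ell_def w_def mult.assoc)
    have "(LINT t|half_line. h t * ell n t) = (LINT t|half_line. of_real (lag_norm \<alpha> n) * (h t * w 0 n t))"
      unfolding e by (simp add: mult.left_commute)
    also have "\<dots> = of_real (lag_norm \<alpha> n) * (LINT t|half_line. h t * w 0 n t)" by simp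
    finally show ?case using zero[of n] lag_norm_pos[OF alpha, of n] by simp
  next
    case (Suc k)
    define c where "c = (if n = 0 then 0 else real n + \<alpha>)"
    have "h t * w (Suc k) n t = of_real (- (real n + 1)) * (h t * w k (Suc n) t)
       + of_real (2 * real n + 1 + \<alpha>) * (h t * w k n t) - of_real c * (h t * w k (n - 1) t)" for t
    proof -
      have "t ^ Suc k * t powr (\<alpha> / 2) * lag_fun \<alpha> n t = t ^ k * t powr (\<alpha> / 2) * (t * lag_fun \<alpha> n t)" by simp
      also have "\<dots> = - (real n + 1) * (t ^ k * t powr (\<alpha> / 2) * lag_fun \<alpha> (Suc n) t)
          + (2 * real n + 1 + \<alpha>) * (t ^ k * t powr (\<alpha> / 2) * lag_fun \<alpha> n t)
          - c * (t ^ k * t powr (\<alpha> / 2) * lag_fun \<alpha> (n - 1) t)"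
        unfolding lag_fun_mult_t c_def by (simp only: ring_distribs mult_ac)
      finally have "w (Suc k) n t = of_real (- (real n + 1)) * w k (Suc n) t
          + of_real (2 * real n + 1 + \<alpha>) * w k n t - of_real c * w k (n - 1) t"
        unfolding w_def by (simp only: of_real_add of_real_diff of_real_mult)
      then show ?thesis by (simp only: ring_distribs mult_ac)
    qed
    then have "(LINT t|half_line. h t * w (Suc k) n t) = (LINT t|half_line. of_real (- (real n + 1)) * (h t * w k (Suc n) t)
       + of_real (2 * real n + 1 + \<alpha>) * (h t * w k n t) - of_real c * (h t * w k (n - 1) t))"
      by presburger
    also have "\<dots> = of_real (- (real n + 1)) * (LINT t|half_line. h t * w k (Suc n) t)
       + of_real (2 * real n + 1 + \<alpha>) * (LINT t|half_line. h t * w k n t) - of_real c * (LINT t|half_line. h t * w k (n - 1) t)"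
      using w_int by (simp only: Bochner_Integration.integral_add Bochner_Integration.integral_diff
          Bochner_Integration.integrable_add integrable_mult_right integral_mult_right_zero)
    also have "\<dots> = 0" using Suc.IH by simp
    finally show ?case .
  qed
  show "integrable half_line (\<lambda>t. h t * of_real (t ^ k * t powr (\<alpha> / 2) * lag_fun \<alpha> n t))"
    using w_int unfolding w_def .
  show "(LINT t|half_line. h t * of_real (t ^ k * t powr (\<alpha> / 2) * lag_fun \<alpha> n t)) = 0"
    using w_zero unfolding w_def .
qed

text \<open>The real and imaginary parts of \<open>h(t) t\<^bsup>\<alpha>/2\<^esup> e\<^bsup>-t/2\<^esup>\<close> have vanishing moments; one factor
\<open>e\<^bsup>-t/4\<^esup>\<close> bounds \<open>t\<^bsup>\<alpha>/2\<^esup> e\<^bsup>-t/4\<^esup>\<close> by a multiple of \<open>V\<close>, and the other one leaves room for the exponential moment.\<close>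

lemma weighted_complete:
  fixes h :: "real \<Rightarrow> complex"
  assumes h: "h \<in> half_measurable" "integrable half_line (\<lambda>t. norm (h t) * V t)"
    and zero: "\<And>n. (LINT t|half_line. h t * ell n t) = 0"
  shows "AE t in half_line. h t = 0"
proof -
  define e where "e = (\<lambda>t. t powr (\<alpha> / 2) * exp (- t / 2))"
  have e_meas [measurable]: "e \<in> half_measurable"
  proof -
    have "continuous_on UNIV (\<lambda>t::real. exp (- t / 2))" by (auto intro!: continuous_intros)
    note this[THEN continuous_half_line_measurable, measurable]
    note powr_half_line_measurable[of "\<alpha> / 2", measurable]
    show ?thesis unfolding e_def by measurable
  qed
  have x_meas [measurable]: "(\<lambda>t::real. exp (c * t)) \<in> half_measurable" for c
    by (intro continuous_half_line_measurable) (auto intro!: continuous_intros)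
  have lagu0: "lag_fun \<alpha> 0 t = exp (- t / 2)" for t by (simp add: lag_fun_def)
  have mom: "integrable half_line (\<lambda>t. h t * of_real (t ^ k * e t))"
    "(LINT t|half_line. h t * of_real (t ^ k * e t)) = 0" for k
    using lag_fun_moments_zero[OF h zero, of k 0] unfolding e_def lagu0 by (simp_all only: mult.assoc)
  define B :: real where "B = 1 + 4 ^ decay * fact decay"
  have emaj: "e t * exp (2 * (1/8) * t) \<le> B * V t" if t: "t > 0" for t
  proof -
    have ex: "exp (- t / 2) * exp (2 * (1/8) * t) = exp (- (t / 4))" by (simp flip: exp_add)
    have "t powr (\<alpha> / 2) * exp (- (t / 4)) \<le> (1 + 4 ^ decay * fact decay) * V t"
    proof (rule powr_times_majorized[OF t])
      show "exp (- (t / 4)) \<le> 1" using t by simp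
      have "(t / 4) ^ decay * exp (- (t / 4)) \<le> fact decay" using t by (intro power_times_exp_neg_le) simp
      then show "t ^ decay * exp (- (t / 4)) \<le> 4 ^ decay * fact decay" by (simp add: power_divide field_simps)
    qed simp
    then show ?thesis unfolding e_def B_def using ex by (simp only: mult.assoc)
  qed
  have part: "AE t in half_line. g (h t) = 0"
    if g: "bounded_linear g" "\<And>z. \<bar>g z\<bar> \<le> norm z" for g :: "complex \<Rightarrow> real"
  proof -
    have gs: "g (z * of_real r) = g z * r" for z r
      using linear_simps(5)[OF g(1), of r z] by (simp add: scaleR_conv_of_real mult.commute)
    have gm [measurable]: "(\<lambda>t. g (h t)) \<in> half_measurable"
      using h(1) borel_measurable_continuous_onI[OF linear_continuous_on[OF g(1)]] by (rule measurable_compose)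
    have "AE t in half_line. g (h t) * e t = 0"
    proof (rule moments_determine_real[where \<delta>="1/8"])
      show m: "(\<lambda>t. g (h t) * e t) \<in> half_measurable" by measurable
      have i: "integrable half_line (\<lambda>t. B * (norm (h t) * V t))" using h(2) by simp
      show "integrable half_line (\<lambda>t. \<bar>g (h t) * e t\<bar> * exp (2 * (1/8) * t))"
      proof (rule Bochner_Integration.integrable_bound[OF i])
        show "(\<lambda>t. \<bar>g (h t) * e t\<bar> * exp (2 * (1/8) * t)) \<in> half_measurable" by measurable
        show "AE t in half_line. norm (\<bar>g (h t) * e t\<bar> * exp (2 * (1/8) * t)) \<le> norm (B * (norm (h t) * V t))"
          using AE_half_line_pos
        proof (rule eventually_mono)
          fix t :: real assume t: "t > 0"
          have e0: "e t \<ge> 0" by (simp add: e_def)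
          have B0: "B \<ge> 0" by (simp add: B_def)
          have "norm (\<bar>g (h t) * e t\<bar> * exp (2 * (1/8) * t)) = \<bar>g (h t)\<bar> * (e t * exp (2 * (1/8) * t))"
            using e0 by (simp add: abs_mult)
          also have "\<dots> \<le> norm (h t) * (B * V t)"
            by (rule mult_mono[OF g(2) emaj[OF t]]) (use e0 in simp_all)
          also have "\<dots> = norm (B * (norm (h t) * V t))" using B0 V_nonneg by (simp add: abs_mult)
          finally show "norm (\<bar>g (h t) * e t\<bar> * exp (2 * (1/8) * t)) \<le> norm (B * (norm (h t) * V t))" .
        qed
      qed
      show "(LINT t|half_line. t ^ n * (g (h t) * e t)) = 0" for n
      proof -
        have "(LINT t|half_line. t ^ n * (g (h t) * e t)) = (LINT t|half_line. g (h t * of_real (t ^ n * e t)))"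
          unfolding gs by (simp add: mult_ac)
        also have "\<dots> = g (LINT t|half_line. h t * of_real (t ^ n * e t))"
          by (rule integral_bounded_linear[OF g(1) mom(1)])
        finally show ?thesis using mom(2) linear_simps(3)[OF g(1)] by simp
      qed
    qed simp
    then show ?thesis using AE_half_line_pos by eventually_elim (simp add: e_def)
  qed
  have "AE t in half_line. Re (h t) = 0" "AE t in half_line. Im (h t) = 0"
    by (rule part; simp add: bounded_linear_Re bounded_linear_Im abs_Re_le_cmod abs_Im_le_cmod)+
  then show ?thesis by eventually_elim (simp add: complex_eq_iff)
qed

lemma Lp_complete:
  assumes x: "x \<in> Lp p" and zero: "\<And>n. coef x n = 0"
  shows "x = 0"
proof -
  obtain f where f: "f \<in> half_measurable" "x = ae_class f" by (rule ae_class_cases)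
  have i: "integrable half_line (\<lambda>t. norm (f t) * V t)" using Lp_weighted_integral x f by blast
  have "AE t in half_line. f t = 0"
  proof (rule weighted_complete[OF f(1) i])
    show "(LINT t|half_line. f t * ell n t) = 0" for n
      using zero[of n] unfolding f(2) ae_class_ops(4)[OF f(1) ell_measurable] .
  qed
  then show ?thesis unfolding f(2) zero_ae_class by (subst ae_class_eq_iff[OF f(1)]) auto
qed

definition synth :: "(nat \<Rightarrow> complex) \<Rightarrow> real \<Rightarrow> complex"
  where "synth b t = (\<Sum>n. b n * ell n t)"

lemma synth_summable:
  assumes b: "rapidly_decreasing b" and t: "t > 0"
  shows "summable (\<lambda>n. norm (b n * ell n t))"
proof -
  obtain C K where CK: "C \<ge> 0" "\<And>n t. t > 0 \<Longrightarrow> norm (ell n t) \<le> C * (real n + 1) ^ K * V t"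
    using ell_bound by blast
  have s: "summable (\<lambda>n. C * V t * (norm (b n) * (real n + 1) ^ K))"
    by (rule summable_mult[OF rapidly_decreasing_summable[OF b]])
  show ?thesis
  proof (rule summable_comparison_test'[OF s, of 0])
    fix n
    have "norm (b n) * norm (ell n t) \<le> norm (b n) * (C * (real n + 1) ^ K * V t)"
      by (intro mult_left_mono CK(2)[OF t]) simp
    then show "norm (norm (b n * ell n t)) \<le> C * V t * (norm (b n) * (real n + 1) ^ K)"
      by (simp add: norm_mult mult_ac)
  qed
qed

text \<open>The series converges together with all weighted derivatives on the half line only; to the left of 0 the terms
\<open>e\<^bsup>-t/2\<^esup> L\<^sub>n\<^sup>\<alpha>(t)\<close> are unbounded, so the Schwartz function on \<open>\<real>\<close> comes from the extension theorem.\<close>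

lemma synth_D:
  assumes b: "rapidly_decreasing b"
  shows "\<exists>g\<in>D_space \<alpha>. \<forall>t>0. g t = synth b t"
proof -
  define F where "F = (\<lambda>k n t. (b n * of_real (lag_norm \<alpha> n)) * complex_of_real (lag_fun_deriv \<alpha> k n t))"
  have deriv: "(F k n has_vector_derivative F (Suc k) n t) (at t within {0..})" for k n t
    unfolding F_def
    by (intro has_vector_derivative_mult_right has_vector_derivative_of_real)
       (rule has_field_derivative_at_within[OF lag_fun_deriv_has_derivative])
  have bound: "\<exists>B. summable B \<and> (\<forall>n. \<forall>t\<ge>0. t ^ m * norm (F k n t) \<le> B n)" for k m
  proof -
    have "poly_growth (\<lambda>n t. lag_norm \<alpha> n * (t ^ m * lag_fun_deriv \<alpha> k n t))"
      by (intro poly_growth_mult poly_growth_lag_norm poly_growth_lag_fun_deriv alpha)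
    then obtain C K where CK: "C \<ge> 0" "\<And>n t. t \<ge> 0 \<Longrightarrow> \<bar>lag_norm \<alpha> n * (t ^ m * lag_fun_deriv \<alpha> k n t)\<bar> \<le> C * (real n + 1) ^ K"
      by (rule poly_growthE) blast
    have "t ^ m * norm (F k n t) \<le> C * (norm (b n) * (real n + 1) ^ K)" if t: "t \<ge> 0" for n t
    proof -
      have "t ^ m * norm (F k n t) = norm (b n) * \<bar>lag_norm \<alpha> n * (t ^ m * lag_fun_deriv \<alpha> k n t)\<bar>"
        using t unfolding F_def norm_mult norm_of_real abs_mult by simp
      also have "\<dots> \<le> norm (b n) * (C * (real n + 1) ^ K)" by (intro mult_left_mono CK(2)[OF t]) simp
      finally show ?thesis by (simp add: mult_ac)
    qed
    moreover have "summable (\<lambda>n. C * (norm (b n) * (real n + 1) ^ K))"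
      by (rule summable_mult[OF rapidly_decreasing_summable[OF b]])
    ultimately show ?thesis by (intro exI[of _ "\<lambda>n. C * (norm (b n) * (real n + 1) ^ K)"] conjI allI impI)
  qed
  note hs = half_schwartz_series[of F, OF deriv bound]
  obtain f where f: "f \<in> schwartz_space" "\<And>t. t \<ge> 0 \<Longrightarrow> f t = (\<Sum>n. F 0 n t)"
    using half_schwartz_extends[OF hs(1)] by blast
  have eq: "of_real (t powr (\<alpha> / 2)) * f t = synth b t" if t: "t > 0" for t
  proof -
    have s: "summable (\<lambda>n. F 0 n t)" by (rule summable_norm_cancel[OF hs(2)]) (use t in simp)
    have "of_real (t powr (\<alpha> / 2)) * f t = (\<Sum>n. of_real (t powr (\<alpha> / 2)) * F 0 n t)"
      using f(2)[of t] t suminf_mult[OF s] by simp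
    also have "\<dots> = synth b t" unfolding synth_def F_def ell_def by (simp add: mult_ac)
    finally show ?thesis .
  qed
  have mem: "(\<lambda>t. of_real (t powr (\<alpha> / 2)) * f t) \<in> D_space \<alpha>"
    unfolding D_space_def using f(1) by (intro CollectI exI[of _ f] conjI refl)
  show ?thesis by (rule bexI[OF _ mem]) (simp add: eq)
qed

lemma synth_measurable:
  assumes "rapidly_decreasing b"
  shows "synth b \<in> half_measurable"
proof -
  obtain g where g: "g \<in> D_space \<alpha>" "\<And>t. t > 0 \<Longrightarrow> g t = synth b t" using synth_D[OF assms] by blast
  have gm: "g \<in> half_measurable"
    using D_majorized[OF g(1)] unfolding majorized_def by (rule conjunct1)
  show ?thesis by (rule half_line_cong(1)[OF gm]) (simp add: g(2))
qed

lemma synth_unit: "t > 0 \<Longrightarrow> synth (\<lambda>n. if n = m then 1 else 0) t = ell m t"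
  unfolding synth_def by (subst suminf_finite[of "{m}"]) auto

lemma ell_D: "\<exists>g\<in>D_space \<alpha>. \<forall>t>0. g t = ell m t \<and> laguerre_diff \<alpha> g t = - of_nat m * ell m t"
proof -
  obtain g where g: "g \<in> D_space \<alpha>" "\<And>t. t > 0 \<Longrightarrow> g t = ell m t"
    using synth_D[OF rapidly_decreasing_unit[of m]] synth_unit[of _ m] by auto
  define F where "F = (\<lambda>k t. complex_of_real (lag_norm \<alpha> m * lag_fun_deriv \<alpha> k m t))"
  have F: "(F k has_vector_derivative F (Suc k) t) (at t)" for k t
    unfolding F_def by (intro has_vector_derivative_of_real DERIV_cmult lag_fun_deriv_has_derivative)
  have "laguerre_diff \<alpha> g t = - of_nat m * ell m t" if t: "t > 0" for t
  proof -
    have "laguerre_diff \<alpha> g t = of_real (t powr (\<alpha> / 2)) * laguerre_core \<alpha> F t"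
    proof (rule laguerre_diff_powr[where F=F])
      show "g s = of_real (s powr (\<alpha> / 2)) * F 0 s" if "s > 0" for s
        using g(2)[OF that] by (simp add: F_def ell_def mult_ac)
    qed (use F t in auto)
    also have "laguerre_core \<alpha> F t = of_real (lag_norm \<alpha> m * (t * lag_fun_deriv \<alpha> 2 m t + (\<alpha> + 1) * lag_fun_deriv \<alpha> 1 m t
        + ((\<alpha> + 1) / 2 - t / 4) * lag_fun \<alpha> m t))"
      unfolding laguerre_core_def F_def by (simp add: algebra_simps)
    also have "t * lag_fun_deriv \<alpha> 2 m t + (\<alpha> + 1) * lag_fun_deriv \<alpha> 1 m t + ((\<alpha> + 1) / 2 - t / 4) * lag_fun \<alpha> m t = - real m * lag_fun \<alpha> m t"
      using lag_fun_ode[of t \<alpha> m] by (simp add: algebra_simps)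
    finally show ?thesis by (simp add: ell_def mult_ac)
  qed
  with g show ?thesis by blast
qed

text \<open>One constant serves all sequences dominated by a multiple of \<open>a\<close>; this yields both the differentiability
of the local resolvent and the growth of the iterates.\<close>

lemma synth_norm_bound:
  assumes a: "rapidly_decreasing a"
  shows "\<exists>C>0. \<forall>b e. e \<ge> 0 \<longrightarrow> (\<forall>n. norm (b n) \<le> e * norm (a n)) \<longrightarrow> Lp_norm p (ae_class (synth b)) \<le> C * e"
proof -
  obtain C K where CK: "C \<ge> 0" "\<And>n t. t > 0 \<Longrightarrow> norm (ell n t) \<le> C * (real n + 1) ^ K * V t"
    using ell_bound by blast
  obtain L where L: "L \<ge> 0" "\<And>f c. f \<in> half_measurable \<Longrightarrow> c \<ge> 0 \<Longrightarrow>
      (AE t in half_line. norm (f t) \<le> c * V t) \<Longrightarrow> ae_class f \<in> Lp p \<and> Lp_norm p (ae_class f) \<le> L * c"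
    using Lp_majorized by blast
  define A where "A = C * (\<Sum>n. norm (a n) * (real n + 1) ^ K)"
  have sa: "summable (\<lambda>n. norm (a n) * (real n + 1) ^ K)" by (rule rapidly_decreasing_summable[OF a])
  have A0: "A \<ge> 0" unfolding A_def using CK(1) sa by (intro mult_nonneg_nonneg suminf_nonneg) auto
  have "Lp_norm p (ae_class (synth b)) \<le> (L * A + 1) * e" if e: "e \<ge> 0" and b: "\<And>n. norm (b n) \<le> e * norm (a n)" for b e
  proof -
    have rb: "rapidly_decreasing b" by (rule rapidly_decreasing_mono[OF a e b])
    have "norm (synth b t) \<le> (e * A) * V t" if t: "t > 0" for t
    proof -
      have "norm (synth b t) \<le> (\<Sum>n. norm (b n * ell n t))"
        unfolding synth_def by (rule summable_norm[OF synth_summable[OF rb t]])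
      also have "\<dots> \<le> (\<Sum>n. (e * C * V t) * (norm (a n) * (real n + 1) ^ K))"
      proof (rule suminf_le[OF _ synth_summable[OF rb t] summable_mult[OF sa]])
        fix n
        have "norm (b n) * norm (ell n t) \<le> (e * norm (a n)) * (C * (real n + 1) ^ K * V t)"
          by (rule mult_mono[OF b CK(2)[OF t]]) (use e in simp_all)
        then show "norm (b n * ell n t) \<le> (e * C * V t) * (norm (a n) * (real n + 1) ^ K)"
          by (simp add: norm_mult mult_ac)
      qed
      also have "\<dots> = (e * C * V t) * (\<Sum>n. norm (a n) * (real n + 1) ^ K)" by (rule suminf_mult[OF sa])
      also have "\<dots> = (e * A) * V t" by (simp add: A_def mult_ac)
      finally show ?thesis .
    qed
    then have "AE t in half_line. norm (synth b t) \<le> (e * A) * V t"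
      using AE_half_line_pos by (rule eventually_mono[rotated])
    then have "Lp_norm p (ae_class (synth b)) \<le> L * (e * A)"
      using L(2)[OF synth_measurable[OF rb]] e A0 by simp
    also have "\<dots> \<le> (L * A + 1) * e" using e by (simp add: algebra_simps)
    finally show ?thesis .
  qed
  moreover have "L * A + 1 > 0" using L(1) A0 by (simp add: add_nonneg_pos)
  ultimately show ?thesis by blast
qed

lemma synth_Lp: "rapidly_decreasing b \<Longrightarrow> ae_class (synth b) \<in> Lp p"
proof -
  assume b: "rapidly_decreasing b"
  obtain g where g: "g \<in> D_space \<alpha>" "\<And>t. t > 0 \<Longrightarrow> g t = synth b t" using synth_D[OF b] by blast
  have "ae_class g = ae_class (synth b)"
    by (rule half_line_cong(2)[OF synth_measurable[OF b]]) (rule g(2))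
  then show ?thesis using majorized_Lp[OF D_majorized[OF g(1)]] by simp
qed

text \<open>Sum and integral may be exchanged because \<open>V \<ell>\<^sub>m\<close> is integrable and the terms are bounded by summable multiples
of it.\<close>

lemma pairing_synth:
  assumes b: "rapidly_decreasing b"
  shows "(\<lambda>n. b n * coef (ae_class (ell n)) m) sums coef (ae_class (synth b)) m"
proof -
  obtain C K where CK: "C \<ge> 0" "\<And>n t. t > 0 \<Longrightarrow> norm (ell n t) \<le> C * (real n + 1) ^ K * V t"
    using ell_bound by blast
  have iV: "integrable half_line (\<lambda>t. norm (ell m t) * V t)"
    using Lp_weighted_integral majorized_Lp[OF ell_majorized] ell_measurable by blast
  define I where "I = (LINT t|half_line. norm (ell m t) * V t)"
  define f where "f = (\<lambda>n t. b n * ell n t * ell m t)"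
  have fm: "f n \<in> half_measurable" for n
    unfolding f_def using ell_measurable[of n] ell_measurable[of m] by measurable
  have fb: "AE t in half_line. norm (f n t) \<le> (C * (norm (b n) * (real n + 1) ^ K)) * (norm (ell m t) * V t)" for n
    using AE_half_line_pos
  proof (rule eventually_mono)
    fix t :: real assume t: "t > 0"
    have "norm (b n) * norm (ell n t) * norm (ell m t) \<le> norm (b n) * (C * (real n + 1) ^ K * V t) * norm (ell m t)"
      by (intro mult_left_mono mult_right_mono CK(2)[OF t]) auto
    then show "norm (f n t) \<le> (C * (norm (b n) * (real n + 1) ^ K)) * (norm (ell m t) * V t)"
      by (simp add: f_def norm_mult mult_ac)
  qed
  have bi: "integrable half_line (\<lambda>t. (C * (norm (b n) * (real n + 1) ^ K)) * (norm (ell m t) * V t))" for n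
    using iV by simp
  have fi: "integrable half_line (f n)" for n
  proof (rule Bochner_Integration.integrable_bound[OF bi fm])
    show "AE t in half_line. norm (f n t) \<le> norm ((C * (norm (b n) * (real n + 1) ^ K)) * (norm (ell m t) * V t))"
      using fb[of n] by (rule eventually_mono) (unfold real_norm_def, rule order_trans[OF _ abs_ge_self])
  qed
  have s1: "AE t in half_line. summable (\<lambda>n. norm (f n t))"
    using AE_half_line_pos
  proof (rule eventually_mono)
    fix t :: real assume t: "t > 0"
    show "summable (\<lambda>n. norm (f n t))"
      unfolding f_def norm_mult[of _ "ell m t"] by (rule summable_mult2[OF synth_summable[OF b t]])
  qed
  have s2: "summable (\<lambda>n. LINT t|half_line. norm (f n t))"
  proof (rule summable_comparison_test'[where N=0])
    show "summable (\<lambda>n. C * I * (norm (b n) * (real n + 1) ^ K))"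
      by (rule summable_mult[OF rapidly_decreasing_summable[OF b]])
    fix n
    have "(LINT t|half_line. norm (f n t)) \<le> (LINT t|half_line. (C * (norm (b n) * (real n + 1) ^ K)) * (norm (ell m t) * V t))"
      using fi bi fb by (intro integral_mono_AE) auto
    also have "\<dots> = C * I * (norm (b n) * (real n + 1) ^ K)" by (simp add: I_def)
    finally show "norm (LINT t|half_line. norm (f n t)) \<le> C * I * (norm (b n) * (real n + 1) ^ K)"
      by (simp add: integral_nonneg_AE)
  qed
  have "(\<lambda>n. LINT t|half_line. f n t) sums (LINT t|half_line. (\<Sum>n. f n t))"
    by (rule sums_integral[OF fi s1 s2])
  also have "(LINT t|half_line. (\<Sum>n. f n t)) = (LINT t|half_line. synth b t * ell m t)"
  proof (rule integral_cong_AE)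
    show "(\<lambda>t. \<Sum>n. f n t) \<in> half_measurable" using fm by measurable
    show "(\<lambda>t. synth b t * ell m t) \<in> half_measurable"
      using synth_measurable[OF b] ell_measurable[of m] by measurable
    show "AE t in half_line. (\<Sum>n. f n t) = synth b t * ell m t"
      using AE_half_line_pos
    proof (rule eventually_mono)
      fix t :: real assume t: "t > 0"
      show "(\<Sum>n. f n t) = synth b t * ell m t"
        unfolding f_def synth_def by (rule suminf_mult2[OF summable_norm_cancel[OF synth_summable[OF b t]], symmetric])
    qed
  qed
  finally have "(\<lambda>n. LINT t|half_line. f n t) sums coef (ae_class (synth b)) m"
    unfolding ae_class_ops(4)[OF synth_measurable[OF b] ell_measurable] .
  moreover have "(LINT t|half_line. f n t) = b n * coef (ae_class (ell n)) m" for n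
    unfolding ae_class_ops(4)[OF ell_measurable ell_measurable] f_def by (simp add: mult.assoc)
  ultimately show ?thesis by simp
qed

end

section \<open>Local spectral theory of the Laguerre operator\<close>

lemma half_line_Gamma_integral:
  assumes "a > -1"
  shows "(LINT t|half_line. t powr a * exp (- t)) = Gamma (a + 1)"
proof -
  have hi: "((\<lambda>t. t powr a * exp (- t)) has_integral Gamma (a + 1)) {0..}"
    using Gamma_integral_real[of "a + 1"] assms by (simp add: exp_minus divide_inverse)
  then have "set_integrable lebesgue {0..} (\<lambda>t. t powr a * exp (- t))"
    by (intro nonnegative_absolutely_integrable_1) auto
  then have "(LINT t:{0..}|lebesgue. t powr a * exp (- t)) = integral {0..} (\<lambda>t. t powr a * exp (- t))"
    by (rule set_lebesgue_integral_eq_integral(2))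
  also have "\<dots> = Gamma (a + 1)" using hi by (rule integral_unique)
  finally show ?thesis
    unfolding set_lebesgue_integral_def by (subst integral_restrict_space) auto
qed

locale laguerre_operator = laguerre_exponent +
  fixes Te :: "(ae_fun \<times> ae_fun) set"
  assumes linear: "linear_operator p Te"
    and extends: "T_op \<alpha> \<subseteq> Te" and maximal: "Te \<subseteq> T_max p \<alpha>"
begin

lemma Te_Lp: "(x, y) \<in> Te \<Longrightarrow> x \<in> Lp p \<and> y \<in> Lp p"
  using linear unfolding linear_operator_def by blast

lemma op_app_eq: "(x, y) \<in> Te \<Longrightarrow> op_app Te x = y"
proof -
  assume xy: "(x, y) \<in> Te"
  have "single_valued Te" using linear unfolding linear_operator_def by blast
  with xy show ?thesis unfolding op_app_def
    by (intro the_equality) (auto dest: single_valuedD)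
qed

lemma op_app_in: "x \<in> Domain Te \<Longrightarrow> (x, op_app Te x) \<in> Te"
  using op_app_eq by force

lemma D_measurable: "f \<in> D_space \<alpha> \<Longrightarrow> f \<in> half_measurable"
  using D_majorized majorized_def by blast

lemma Te_D: "f \<in> D_space \<alpha> \<Longrightarrow> \<exists>g\<in>D_space \<alpha>. (ae_class f, ae_class g) \<in> Te"
proof -
  assume f: "f \<in> D_space \<alpha>"
  obtain g where g: "g \<in> D_space \<alpha>" "\<And>t. t > 0 \<Longrightarrow> laguerre_diff \<alpha> f t = g t"
    using laguerre_diff_D_space[OF f] by blast
  have "ae_class (laguerre_diff \<alpha> f) = ae_class g"
    by (rule half_line_cong(2)[OF D_measurable[OF g(1)] g(2)])
  moreover have "(ae_class f, ae_class (laguerre_diff \<alpha> f)) \<in> T_op \<alpha>"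
    unfolding T_op_def using f by blast
  ultimately have "(ae_class f, ae_class g) \<in> Te" using extends by auto
  then show ?thesis using g(1) by blast
qed

text \<open>Testing the definition of the maximal extension against \<open>\<ell>\<^sub>n\<close> shows that every operator below it multiplies the
\<open>n\<close>-th Laguerre coefficient by \<open>- n\<close>.\<close>

lemma ell_Te: "(ae_class (ell n), cscale (- of_nat n) (ae_class (ell n))) \<in> Te"
  and pairing_Te_ell: "(x, y) \<in> Te \<Longrightarrow> coef y n = - of_nat n * coef x n"
proof -
  obtain g where g: "g \<in> D_space \<alpha>" "\<And>t. t > 0 \<Longrightarrow> g t = ell n t"
    "\<And>t. t > 0 \<Longrightarrow> laguerre_diff \<alpha> g t = - of_nat n * ell n t"
    using ell_D[of n] by blast
  have m: "(\<lambda>t. - of_nat n * ell n t) \<in> half_measurable"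
    using ell_measurable[of n] by measurable
  have 1: "ae_class g = ae_class (ell n)"
    by (rule half_line_cong(2)[OF ell_measurable g(2)])
  have "ae_class (laguerre_diff \<alpha> g) = ae_class (\<lambda>t. - of_nat n * ell n t)"
    by (rule half_line_cong(2)[OF m g(3)])
  also have "\<dots> = cscale (- of_nat n) (ae_class (ell n))"
    by (rule ae_class_ops(3)[OF ell_measurable ell_measurable, symmetric])
  finally have 2: "ae_class (laguerre_diff \<alpha> g) = cscale (- of_nat n) (ae_class (ell n))" .
  have "(ae_class g, ae_class (laguerre_diff \<alpha> g)) \<in> T_op \<alpha>" unfolding T_op_def using g(1) by blast
  then show "(ae_class (ell n), cscale (- of_nat n) (ae_class (ell n))) \<in> Te"
    using extends unfolding 1 2 by blast
  show "coef y n = - of_nat n * coef x n" if "(x, y) \<in> Te"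
  proof -
    have "pairing y (ae_class g) = pairing x (ae_class (laguerre_diff \<alpha> g))"
      using maximal that g(1) unfolding T_max_def by blast
    then show ?thesis unfolding 1 2 pairing_cscale(2)[OF ell_measurable] .
  qed
qed

text \<open>Eigenfunctions for different eigenvalues; the symmetry of the operator is the previous lemma.\<close>

lemma ell_orthogonal: "n \<noteq> m \<Longrightarrow> coef (ae_class (ell n)) m = 0"
proof -
  assume nm: "n \<noteq> m"
  have "- of_nat n * coef (ae_class (ell n)) m = - of_nat m * coef (ae_class (ell n)) m"
    using pairing_Te_ell[OF ell_Te[of n], of m] unfolding pairing_cscale(1)[OF ell_measurable] .
  with nm show ?thesis by simp
qed

lemma ell_mult_t:
  fixes c :: "nat \<Rightarrow> complex"
  defines "c \<equiv> \<lambda>n. of_real (lag_norm \<alpha> n)"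
  shows "of_real t * ell n t = - (of_nat n + 1) * (c n / c (Suc n)) * ell (Suc n) t + (2 * of_nat n + 1 + of_real \<alpha>) * ell n t
     - (if n = 0 then 0 else of_nat n + of_real \<alpha>) * (c n / c (n - 1)) * ell (n - 1) t"
proof -
  have nz: "c k \<noteq> 0" for k unfolding c_def using lag_norm_pos[OF alpha, of k] by simp
  define X where "X = (\<lambda>k. complex_of_real (t powr (\<alpha> / 2) * lag_fun \<alpha> k t))"
  have e: "ell k t = c k * X k" for k by (simp add: ell_def c_def X_def mult.assoc)
  have "of_real t * X n = of_real (t powr (\<alpha> / 2)) * of_real (t * lag_fun \<alpha> n t)"
    by (simp add: X_def mult_ac)
  also have "\<dots> = - (of_nat n + 1) * X (Suc n) + (2 * of_nat n + 1 + of_real \<alpha>) * X n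
     - (if n = 0 then 0 else of_nat n + of_real \<alpha>) * X (n - 1)"
    unfolding lag_fun_mult_t X_def by (cases "n = 0") (simp_all add: algebra_simps)
  finally have "c n * (of_real t * X n) = c n * (- (of_nat n + 1) * X (Suc n) + (2 * of_nat n + 1 + of_real \<alpha>) * X n
     - (if n = 0 then 0 else of_nat n + of_real \<alpha>) * X (n - 1))" by simp
  moreover have "(c n / c (Suc n)) * ell (Suc n) t = c n * X (Suc n)"
    "(c n / c (n - 1)) * ell (n - 1) t = c n * X (n - 1)"
    unfolding e using nz by simp_all
  ultimately show ?thesis unfolding mult.assoc e[of n] by (simp only: ring_distribs mult_ac)
qed

text \<open>Evaluating \<open>\<integral> t \<ell>\<^sub>n \<ell>\<^bsub>n+1\<^esub>\<close> by the recurrence for either factor relates consecutive norms; the base case is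
the Gamma integral.\<close>

lemma ell_normalized: "coef (ae_class (ell n)) n = 1"
proof (induction n)
  case 0
  have "coef (ae_class (ell 0)) 0 = (LINT t|half_line. ell 0 t * ell 0 t)"
    by (rule ae_class_ops(4)[OF ell_measurable ell_measurable])
  also have "\<dots> = (LINT t|half_line. complex_of_real ((lag_norm \<alpha> 0)\<^sup>2 * (t powr \<alpha> * exp (- t))))"
  proof (rule Bochner_Integration.integral_cong[OF refl])
    fix t
    have "t powr (\<alpha> / 2) * t powr (\<alpha> / 2) = t powr \<alpha>" by (simp flip: powr_add)
    moreover have "exp (- t / 2) * exp (- t / 2) = exp (- t)" by (simp flip: exp_add)
    ultimately have "(lag_norm \<alpha> 0 * t powr (\<alpha> / 2) * lag_fun \<alpha> 0 t) * (lag_norm \<alpha> 0 * t powr (\<alpha> / 2) * lag_fun \<alpha> 0 t)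
        = (lag_norm \<alpha> 0)\<^sup>2 * (t powr \<alpha> * exp (- t))"
      by (simp add: lag_fun_def power2_eq_square mult_ac)
    then show "ell 0 t * ell 0 t = of_real ((lag_norm \<alpha> 0)\<^sup>2 * (t powr \<alpha> * exp (- t)))"
      unfolding ell_def of_real_mult[symmetric] by simp
  qed
  also have "\<dots> = of_real ((lag_norm \<alpha> 0)\<^sup>2 * Gamma (\<alpha> + 1))"
    unfolding half_line_Gamma_integral[OF alpha, symmetric] by (simp only: integral_complex_of_real integral_mult_right_zero)
  also have "(lag_norm \<alpha> 0)\<^sup>2 * Gamma (\<alpha> + 1) = 1"
  proof -
    have "Gamma (\<alpha> + 1) > 0" using alpha by (intro Gamma_real_pos) simp
    then have "Gamma (\<alpha> + 1) \<noteq> 0" by (rule less_imp_neq[symmetric])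
    then show ?thesis unfolding lag_norm_square[OF alpha] by simp
  qed
  finally show ?case by simp
next
  case (Suc n)
  define c where "c = (\<lambda>n. complex_of_real (lag_norm \<alpha> n))"
  have nz: "c k \<noteq> 0" for k unfolding c_def using lag_norm_pos[OF alpha, of k] by simp
  define P where "P = (\<lambda>m n. LINT t|half_line. ell m t * ell n t)"
  have P: "P m n = coef (ae_class (ell m)) n" for m n
    unfolding P_def by (rule ae_class_ops(4)[OF ell_measurable ell_measurable, symmetric])
  have int: "integrable half_line (\<lambda>t. ell m t * ell n t)" for m n
  proof -
    have i: "integrable half_line (\<lambda>t. norm (ell m t) * V t)"
      using Lp_weighted_integral majorized_Lp[OF ell_majorized] ell_measurable by blast
    obtain d where "\<And>t. t > 0 \<Longrightarrow> norm (ell n t) \<le> d * V t"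
      using ell_majorized[of n] unfolding majorized_def by blast
    then show ?thesis by (rule integral_times_majorized(1)[OF ell_measurable i ell_measurable])
  qed
  have mult: "(LINT t|half_line. ell m t * (of_real t * ell n t)) =
      - (of_nat n + 1) * (c n / c (Suc n)) * P m (Suc n) + (2 * of_nat n + 1 + of_real \<alpha>) * P m n
       - (if n = 0 then 0 else of_nat n + of_real \<alpha>) * (c n / c (n - 1)) * P m (n - 1)" for m n
  proof -
    define r1 where "r1 = - (of_nat n + 1) * (c n / c (Suc n))"
    define r2 where "r2 = 2 * of_nat n + 1 + complex_of_real \<alpha>"
    define r3 where "r3 = (if n = 0 then 0 else of_nat n + complex_of_real \<alpha>) * (c n / c (n - 1))"
    have "ell m t * (of_real t * ell n t) = r1 * (ell m t * ell (Suc n) t) + r2 * (ell m t * ell n t) - r3 * (ell m t * ell (n - 1) t)" for t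
      unfolding ell_mult_t r1_def r2_def r3_def c_def by (simp add: algebra_simps)
    then have "(LINT t|half_line. ell m t * (of_real t * ell n t)) =
        (LINT t|half_line. r1 * (ell m t * ell (Suc n) t) + r2 * (ell m t * ell n t) - r3 * (ell m t * ell (n - 1) t))"
      by (simp only:)
    also have "\<dots> = r1 * P m (Suc n) + r2 * P m n - r3 * P m (n - 1)"
      unfolding P_def using int
      by (simp only: Bochner_Integration.integral_add Bochner_Integration.integral_diff
          Bochner_Integration.integrable_add integrable_mult_right integral_mult_right_zero)
    finally show ?thesis unfolding r1_def r2_def r3_def .
  qed
  have ortho: "P k j = 0" if "k \<noteq> j" for k j unfolding P by (rule ell_orthogonal[OF that])
  have "(LINT t|half_line. ell (Suc n) t * (of_real t * ell n t)) = (LINT t|half_line. ell n t * (of_real t * ell (Suc n) t))"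
    by (simp add: mult_ac)
  then have "- (of_nat n + 1) * (c n / c (Suc n)) * P (Suc n) (Suc n) = - ((of_nat (Suc n) + of_real \<alpha>) * (c (Suc n) / c n) * P n n)"
    unfolding mult by (simp add: ortho)
  then have eq: "(of_nat n + 1) * (c n)\<^sup>2 * P (Suc n) (Suc n) = (of_nat (Suc n) + of_real \<alpha>) * (c (Suc n))\<^sup>2 * P n n"
    using nz[of n] nz[of "Suc n"] by (simp add: field_simps power2_eq_square)
  have cS: "(c (Suc n))\<^sup>2 * (of_nat (Suc n) + of_real \<alpha>) = (of_nat n + 1) * (c n)\<^sup>2"
    using arg_cong[OF lag_norm_Suc[OF alpha, of n], of complex_of_real] by (simp add: c_def add_ac)
  have "(of_nat n + 1) * (c n)\<^sup>2 * P (Suc n) (Suc n) = (of_nat n + 1) * (c n)\<^sup>2 * P n n"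
  proof -
    note eq
    also have "(of_nat (Suc n) + of_real \<alpha>) * (c (Suc n))\<^sup>2 * P n n
        = ((c (Suc n))\<^sup>2 * (of_nat (Suc n) + of_real \<alpha>)) * P n n"
      by (simp only: mult_ac)
    finally show ?thesis unfolding cS .
  qed
  moreover have "(of_nat n + 1) * (c n)\<^sup>2 \<noteq> (0 :: complex)"
    using nz[of n] of_nat_neq_0[of n, where 'a=complex] by (simp add: add.commute)
  ultimately have "P (Suc n) (Suc n) = P n n" by simp
  then show ?case using Suc P by simp
qed

lemma coeff_synth:
  assumes "rapidly_decreasing b"
  shows "coef (ae_class (synth b)) m = b m"
proof -
  have "(\<lambda>n. b n * coef (ae_class (ell n)) m) sums (b m * 1)"
  proof -
    have "(\<lambda>n. b n * coef (ae_class (ell n)) m) = (\<lambda>n. if n \<in> {m} then b n else 0)"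
      by (auto simp: fun_eq_iff ell_orthogonal ell_normalized)
    then show ?thesis using sums_If_finite_set[of "{m}" b] by simp
  qed
  then show ?thesis using sums_unique2[OF pairing_synth[OF assms, of m]] by simp
qed

lemma eq_if_coeffs_eq:
  assumes "x \<in> Lp p" "y \<in> Lp p" "\<And>n. coef x n = coef y n"
  shows "x = y"
proof -
  have "x - y = 0"
    by (rule Lp_complete) (simp_all add: Lp_diff assms pairing_diff[OF ell_majorized])
  then show ?thesis by simp
qed

text \<open>The coefficient of order \<open>n\<close> vanishes off \<open>- n\<close>; at \<open>z = - n\<close> it is, up to sign, the limit of \<open>w - z\<close> times a convergent
difference quotient.\<close>

theorem has_SVEP: "has_SVEP p Te"
  unfolding has_SVEP_def
proof (intro allI impI ballI, elim conjE)
  fix U \<phi> z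
  assume U: "open U" and an: "Lp_analytic_on p U \<phi>" and z: "z \<in> U"
    and eq: "\<forall>z\<in>U. \<phi> z \<in> Domain Te \<and> op_app Te (\<phi> z) - cscale z (\<phi> z) = 0"
  have Lp: "\<phi> w \<in> Lp p" if "w \<in> U" for w using an that unfolding Lp_analytic_on_def by blast
  have coeff: "coef (\<phi> w) n = 0" if w: "w \<in> U" "w \<noteq> - of_nat n" for w n
  proof -
    have "(\<phi> w, cscale w (\<phi> w)) \<in> Te" using op_app_in[of "\<phi> w"] eq w(1) by simp
    then have "w * coef (\<phi> w) n = - of_nat n * coef (\<phi> w) n"
      using pairing_Te_ell[of "\<phi> w" "cscale w (\<phi> w)" n] unfolding pairing_cscale(1)[OF ell_measurable] by blast
    then have "(w + of_nat n) * coef (\<phi> w) n = 0" by (simp add: distrib_right)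
    with w(2) show ?thesis by (simp add: eq_neg_iff_add_eq_0)
  qed
  show "\<phi> z = 0"
  proof (rule Lp_complete[OF Lp[OF z]])
    fix n
    define a where "a = coef (\<phi> z) n"
    show "coef (\<phi> z) n = 0"
    proof (cases "z = - of_nat n")
      case False
      then show ?thesis by (rule coeff[OF z])
    next
      case True
      obtain d where d: "d \<in> Lp p"
        "((\<lambda>w. Lp_norm p (cscale (1 / (w - z)) (\<phi> w - \<phi> z) - d)) \<longlongrightarrow> 0) (at z)"
        using an z unfolding Lp_analytic_on_def by blast
      obtain C where C: "\<And>x. x \<in> Lp p \<Longrightarrow> norm (coef x n) \<le> C * Lp_norm p x"
        using pairing_bounded[OF ell_majorized] by blast
      define D where "D = coef d n"
      have ev: "\<forall>\<^sub>F w in at z. w \<in> U" using U z by (rule eventually_at_in_open')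
      have "\<forall>\<^sub>F w in at z. norm ((w - z) * D + a) \<le> norm (w - z) * (C * Lp_norm p (cscale (1 / (w - z)) (\<phi> w - \<phi> z) - d))"
        using ev eventually_neq_at_within[of z z UNIV]
      proof eventually_elim
        case (elim w)
        have dl: "\<phi> w - \<phi> z \<in> Lp p" using Lp elim z by (intro Lp_diff) auto
        have "coef (cscale (1 / (w - z)) (\<phi> w - \<phi> z) - d) n
            = 1 / (w - z) * (coef (\<phi> w) n - a) - D"
          unfolding pairing_diff[OF ell_majorized Lp_cscale[OF dl] d(1)] pairing_cscale(1)[OF ell_measurable]
            pairing_diff[OF ell_majorized Lp[OF elim(1)] Lp[OF z]] a_def D_def ..
        also have "coef (\<phi> w) n = 0" using elim True by (intro coeff) auto
        finally have pr: "coef (cscale (1 / (w - z)) (\<phi> w - \<phi> z) - d) n = - ((w - z) * D + a) / (w - z)"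
          using elim(2) by (simp add: field_simps)
        have "norm (((w - z) * D + a) / (w - z)) \<le> C * Lp_norm p (cscale (1 / (w - z)) (\<phi> w - \<phi> z) - d)"
          using C[OF Lp_diff[OF Lp_cscale[OF dl, of "1 / (w - z)"] d(1)]]
          unfolding pr minus_divide_left[symmetric] norm_minus_cancel .
        then show ?case using elim(2) by (simp add: norm_divide pos_divide_le_eq mult.commute)
      qed
      moreover
      have "((\<lambda>w. norm (w - z) * (C * Lp_norm p (cscale (1 / (w - z)) (\<phi> w - \<phi> z) - d))) \<longlongrightarrow> norm (z - z) * (C * 0)) (at z)"
        by (intro tendsto_intros d(2))
      then have "((\<lambda>w. norm (w - z) * (C * Lp_norm p (cscale (1 / (w - z)) (\<phi> w - \<phi> z) - d))) \<longlongrightarrow> 0) (at z)"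
        by simp
      ultimately have "((\<lambda>w. (w - z) * D + a) \<longlongrightarrow> 0) (at z)"
        by (rule Lim_null_comparison)
      moreover have "((\<lambda>w. (w - z) * D + a) \<longlongrightarrow> (z - z) * D + a) (at z)" by (intro tendsto_intros)
      ultimately have "0 = (z - z) * D + a" by (rule tendsto_unique[OF trivial_limit_at])
      then show ?thesis by (simp add: a_def)
    qed
  qed
qed

lemma D_iterate:
  assumes f: "f \<in> D_space \<alpha>"
  shows "\<exists>g\<in>D_space \<alpha>. (op_app Te ^^ k) (ae_class f) = ae_class g \<and>
    (\<forall>n. coef (ae_class g) n = (- of_nat n) ^ k * coef (ae_class f) n)"
proof (induction k)
  case 0
  then show ?case using f by auto
next
  case (Suc k)
  then obtain g where g: "g \<in> D_space \<alpha>" "(op_app Te ^^ k) (ae_class f) = ae_class g"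
    "\<And>n. coef (ae_class g) n = (- of_nat n) ^ k * coef (ae_class f) n"
    by blast
  obtain h where h: "h \<in> D_space \<alpha>" "(ae_class g, ae_class h) \<in> Te" using Te_D[OF g(1)] by blast
  have "(op_app Te ^^ Suc k) (ae_class f) = ae_class h" using g(2) op_app_eq[OF h(2)] by simp
  moreover have "coef (ae_class h) n = (- of_nat n) ^ Suc k * coef (ae_class f) n" for n
    using pairing_Te_ell[OF h(2), of n] g(3)[of n] by simp
  ultimately show ?case using h(1) by blast
qed

text \<open>The \<open>k\<close>-th iterate has coefficients \<open>(- n)\<^sup>k a\<^sub>n\<close>, and the coefficients of every element of \<open>\<D>\<^sub>\<alpha>\<close> grow at most
like \<open>(n + 1)\<^sup>K\<close> with the same \<open>K\<close>.\<close>

lemma coeffs_rapidly_decreasing: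
  assumes f: "f \<in> D_space \<alpha>"
  shows "rapidly_decreasing (\<lambda>n. coef (ae_class f) n)"
proof -
  define a where "a = (\<lambda>n. coef (ae_class f) n)"
  obtain C K where CK: "C \<ge> 0" "\<And>n t. t > 0 \<Longrightarrow> norm (ell n t) \<le> C * (real n + 1) ^ K * V t"
    using ell_bound by blast
  have growth: "\<exists>B. \<forall>n. real n ^ k * norm (a n) \<le> B * (real n + 1) ^ K" for k
  proof -
    obtain g where g: "g \<in> D_space \<alpha>"
      "\<And>n. coef (ae_class g) n = (- of_nat n) ^ k * a n"
      using D_iterate[OF f, of k] unfolding a_def by blast
    have gm: "g \<in> half_measurable" by (rule D_measurable[OF g(1)])
    have gi: "integrable half_line (\<lambda>t. norm (g t) * V t)"
      using Lp_weighted_integral majorized_Lp[OF D_majorized[OF g(1)]] gm by blast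
    have "real n ^ k * norm (a n) \<le> (C * (LINT t|half_line. norm (g t) * V t)) * (real n + 1) ^ K" for n
    proof -
      have "norm (coef (ae_class g) n) \<le> (C * (real n + 1) ^ K) * (LINT t|half_line. norm (g t) * V t)"
        unfolding ae_class_ops(4)[OF gm ell_measurable]
        by (rule integral_times_majorized(2)[OF gm gi ell_measurable]) (rule CK(2))
      then show ?thesis unfolding g(2) by (simp add: norm_mult norm_power mult_ac)
    qed
    then show ?thesis by blast
  qed
  show ?thesis
    unfolding rapidly_decreasing_def a_def[symmetric]
  proof
    fix j
    obtain B0 where B0: "\<And>n. real n ^ 0 * norm (a n) \<le> B0 * (real n + 1) ^ K" using growth by blast
    obtain B1 where B1: "\<And>n. real n ^ (j + K) * norm (a n) \<le> B1 * (real n + 1) ^ K" using growth by blast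
    have "norm (a n) * (real n + 1) ^ j \<le> 2 ^ (j + K) * (B0 + B1)" for n
    proof -
      have "(real n + 1) ^ (j + K) \<le> (2 * max 1 (real n)) ^ (j + K)" by (intro power_mono) auto
      also have "\<dots> = 2 ^ (j + K) * max 1 (real n) ^ (j + K)" by (rule power_mult_distrib)
      also have "\<dots> \<le> 2 ^ (j + K) * (real n ^ 0 + real n ^ (j + K))"
        by (intro mult_left_mono) (auto simp: max_def)
      finally have "norm (a n) * (real n + 1) ^ (j + K) \<le> norm (a n) * (2 ^ (j + K) * (real n ^ 0 + real n ^ (j + K)))"
        by (intro mult_left_mono) auto
      also have "\<dots> = 2 ^ (j + K) * (real n ^ 0 * norm (a n) + real n ^ (j + K) * norm (a n))"
        by (simp only: ring_distribs mult_ac)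
      also have "\<dots> \<le> 2 ^ (j + K) * (B0 * (real n + 1) ^ K + B1 * (real n + 1) ^ K)"
        by (intro mult_left_mono add_mono B0 B1) simp
      finally have "(norm (a n) * (real n + 1) ^ j) * (real n + 1) ^ K \<le> (2 ^ (j + K) * (B0 + B1)) * (real n + 1) ^ K"
        unfolding power_add[of "real n + 1"] by (simp only: ring_distribs mult_ac)
      then show ?thesis by (rule mult_right_le_imp_le) simp
    qed
    then show "\<exists>C. \<forall>n. norm (a n) * (real n + 1) ^ j \<le> C" by blast
  qed
qed

lemma synth_linear:
  assumes "rapidly_decreasing b" "rapidly_decreasing b'" "rapidly_decreasing d"
  shows "cscale c (ae_class (synth b) - ae_class (synth b')) - ae_class (synth d)
     = ae_class (synth (\<lambda>n. c * (b n - b' n) - d n))"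
proof -
  note m = synth_measurable[OF assms(1)] synth_measurable[OF assms(2)] synth_measurable[OF assms(3)]
  have m': "(\<lambda>t. synth b t - synth b' t) \<in> half_measurable" using m by measurable
  have m'': "(\<lambda>t. c * (synth b t - synth b' t)) \<in> half_measurable" using m by measurable
  have m3: "(\<lambda>t. c * (synth b t - synth b' t) - synth d t) \<in> half_measurable" using m by measurable
  have "synth (\<lambda>n. c * (b n - b' n) - d n) t = c * (synth b t - synth b' t) - synth d t" if t: "t > 0" for t
  proof -
    note s = synth_summable[OF assms(1) t, THEN summable_norm_cancel, THEN summable_sums]
      synth_summable[OF assms(2) t, THEN summable_norm_cancel, THEN summable_sums]
      synth_summable[OF assms(3) t, THEN summable_norm_cancel, THEN summable_sums]
    have "(\<lambda>n. c * (b n * ell n t - b' n * ell n t) - d n * ell n t) sums (c * (synth b t - synth b' t) - synth d t)"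
      unfolding synth_def by (rule sums_diff[OF sums_mult[OF sums_diff[OF s(1,2)]] s(3)])
    then have "(\<lambda>n. (c * (b n - b' n) - d n) * ell n t) sums (c * (synth b t - synth b' t) - synth d t)"
      by (simp add: algebra_simps)
    then show ?thesis unfolding synth_def by (rule sums_unique[symmetric])
  qed
  then have "ae_class (synth (\<lambda>n. c * (b n - b' n) - d n)) = ae_class (\<lambda>t. c * (synth b t - synth b' t) - synth d t)"
    by (rule half_line_cong(2)[OF m3])
  also have "\<dots> = cscale c (ae_class (synth b) - ae_class (synth b')) - ae_class (synth d)"
    unfolding ae_class_ops(2)[OF m(1,2)] ae_class_ops(3)[OF m' m'] ae_class_ops(2)[OF m'' m(3)] ..
  finally show ?thesis ..
qed

text \<open>The local resolvent is the Laguerre series with coefficients \<open>- a\<^sub>n / (n + z)\<close>; division by zero gives 0,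
which is the right coefficient when \<open>a\<^sub>n = 0\<close> and \<open>z = - n\<close>. Its derivative has coefficients
\<open>a\<^sub>n / (n + z)\<^sup>2\<close>.\<close>

theorem local_spectrum_D:
  assumes f: "f \<in> D_space \<alpha>"
  defines "a \<equiv> \<lambda>n. coef (ae_class f) n"
  shows "local_spectrum p Te (ae_class f) = {- of_nat n | n. a n \<noteq> 0}"
proof -
  let ?x = "ae_class f"
  define Z :: "complex set" where "Z = {- of_nat n | n. a n \<noteq> 0}"
  have x: "?x \<in> Lp p" by (rule majorized_Lp[OF D_majorized[OF f]])
  have ra: "rapidly_decreasing a" unfolding a_def by (rule coeffs_rapidly_decreasing[OF f])
  have "z0 \<in> local_resolvent_set p Te ?x \<longleftrightarrow> z0 \<notin> Z" for z0
  proof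
    assume "z0 \<in> local_resolvent_set p Te ?x"
    then obtain U \<phi> where U: "z0 \<in> U" "Lp_analytic_on p U \<phi>"
      "\<forall>z\<in>U. \<phi> z \<in> Domain Te \<and> op_app Te (\<phi> z) - cscale z (\<phi> z) = ?x"
      unfolding local_resolvent_set_def by blast
    show "z0 \<notin> Z"
    proof
      assume "z0 \<in> Z"
      then obtain n where n: "z0 = - of_nat n" "a n \<noteq> 0" unfolding Z_def by blast
      have in_Te: "(\<phi> z0, op_app Te (\<phi> z0)) \<in> Te" using U op_app_in by blast
      have L: "\<phi> z0 \<in> Lp p" "op_app Te (\<phi> z0) \<in> Lp p" using Te_Lp[OF in_Te] by auto
      have "a n = coef (op_app Te (\<phi> z0) - cscale z0 (\<phi> z0)) n"
        using U(1,3) unfolding a_def by simp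
      also have "\<dots> = 0"
        unfolding pairing_diff[OF ell_majorized L(2) Lp_cscale[OF L(1)]] pairing_cscale(1)[OF ell_measurable]
          pairing_Te_ell[OF in_Te] by (simp add: n(1))
      finally show False using n(2) by simp
    qed
  next
    assume z0: "z0 \<notin> Z"
    have "closed Z"
      by (rule closed_subset_Ints) (auto simp: Z_def)
    then have "open (- Z)" by (rule open_Compl)
    then obtain \<epsilon> where \<epsilon>: "\<epsilon> > 0" "ball z0 \<epsilon> \<subseteq> - Z" using z0 unfolding open_contains_ball by blast
    \<comment> \<open>Points of \<open>U\<close> then keep a distance of at least \<open>\<delta>\<close> from \<open>Z\<close>.\<close>
    define \<delta> where "\<delta> = \<epsilon> / 2"
    have \<delta>: "\<delta> > 0" using \<epsilon>(1) by (simp add: \<delta>_def)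
    define U where "U = ball z0 \<delta>"
    have gap: "norm (of_nat n + z) \<ge> \<delta>" if "z \<in> U" "a n \<noteq> 0" for z n
    proof -
      have "- of_nat n \<in> Z" using that(2) unfolding Z_def by blast
      then have "\<epsilon> \<le> dist z0 (- of_nat n)" using \<epsilon>(2) by (meson ComplD linorder_not_le mem_ball subsetD)
      also have "\<dots> \<le> dist z0 z + dist z (- of_nat n)" by (rule dist_triangle)
      also have "dist z0 z < \<delta>" using that(1) by (simp add: U_def)
      finally show ?thesis by (simp add: \<delta>_def dist_norm add.commute)
    qed
    define b where "b = (\<lambda>z n. - a n / (of_nat n + z))"
    define b' where "b' = (\<lambda>z n. a n / (of_nat n + z)\<^sup>2)"
    have nb: "norm (b z n) \<le> (1 / \<delta>) * norm (a n)" if z: "z \<in> U" for z n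
    proof (cases "a n = 0")
      case False
      have "norm (of_nat n + z) > 0" using gap[OF z False] \<delta> by linarith
      then have "norm (a n) / norm (of_nat n + z) \<le> norm (a n) / \<delta>"
        using gap[OF z False] \<delta> by (intro divide_left_mono mult_pos_pos) auto
      then show ?thesis by (simp add: b_def norm_divide)
    qed (simp add: b_def)
    have nb': "norm (b' z n) \<le> (1 / \<delta>\<^sup>2) * norm (a n)" if z: "z \<in> U" for z n
    proof (cases "a n = 0")
      case False
      have "\<delta>\<^sup>2 \<le> (norm (of_nat n + z))\<^sup>2" using gap[OF z False] \<delta> by (intro power_mono) auto
      moreover have "norm (of_nat n + z) > 0" using gap[OF z False] \<delta> by linarith
      ultimately have "norm (a n) / (norm (of_nat n + z))\<^sup>2 \<le> norm (a n) / \<delta>\<^sup>2"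
        using \<delta> by (intro divide_left_mono mult_pos_pos) auto
      then show ?thesis by (simp add: b'_def norm_divide norm_power)
    qed (simp add: b'_def)
    have rb: "rapidly_decreasing (b z)" if "z \<in> U" for z
      by (rule rapidly_decreasing_mono[OF ra _ nb[OF that]]) (use \<delta> in simp)
    have rb': "rapidly_decreasing (b' z)" if "z \<in> U" for z
      by (rule rapidly_decreasing_mono[OF ra _ nb'[OF that]]) (use \<delta> in simp)
    define \<phi> where "\<phi> = (\<lambda>z. ae_class (synth (b z)))"
    obtain C where C: "C > 0" "\<And>b e. e \<ge> 0 \<Longrightarrow> (\<And>n. norm (b n) \<le> e * norm (a n)) \<Longrightarrow> Lp_norm p (ae_class (synth b)) \<le> C * e"
      using synth_norm_bound[OF ra] by blast
    have an: "Lp_analytic_on p U \<phi>"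
      unfolding Lp_analytic_on_def
    proof (intro conjI ballI)
      fix z assume z: "z \<in> U"
      show "\<phi> z \<in> Lp p" unfolding \<phi>_def by (rule synth_Lp[OF rb[OF z]])
      show "\<exists>d\<in>Lp p. ((\<lambda>w. Lp_norm p (cscale (1 / (w - z)) (\<phi> w - \<phi> z) - d)) \<longlongrightarrow> 0) (at z)"
      proof (rule bexI[OF _ synth_Lp[OF rb'[OF z]]])
        have ev: "\<forall>\<^sub>F w in at z. w \<in> U" using z unfolding U_def by (intro eventually_at_in_open') auto
        have "\<forall>\<^sub>F w in at z. norm (Lp_norm p (cscale (1 / (w - z)) (\<phi> w - \<phi> z) - ae_class (synth (b' z)))) \<le> C * (norm (w - z) / \<delta> ^ 3)"
          using ev eventually_neq_at_within[of z z UNIV]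
        proof eventually_elim
          case (elim w)
          have "norm (1 / (w - z) * (b w n - b z n) - b' z n) \<le> (norm (w - z) / \<delta> ^ 3) * norm (a n)" for n
          proof (cases "a n = 0")
            case False
            define A where "A = of_nat n + w"
            define B where "B = of_nat n + z"
            have AB: "norm A \<ge> \<delta>" "norm B \<ge> \<delta>" unfolding A_def B_def using gap False elim z by auto
            have nz: "A \<noteq> 0" "B \<noteq> 0" "A - B \<noteq> 0" using AB \<delta> elim(2) by (auto simp: A_def B_def)
            have wz: "w - z = A - B" by (simp add: A_def B_def)
            have "1 / (w - z) * (b w n - b z n) - b' z n = - (a n * (A - B) / (A * B\<^sup>2))"
              unfolding b_def b'_def wz A_def[symmetric] B_def[symmetric] using nz
              by (simp add: field_simps power2_eq_square)
            then have "norm (1 / (w - z) * (b w n - b z n) - b' z n) = norm (a n) * norm (w - z) / (norm A * (norm B)\<^sup>2)"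
              by (simp add: norm_divide norm_mult norm_power wz)
            also have "\<dots> \<le> norm (a n) * norm (w - z) / (\<delta> * \<delta>\<^sup>2)"
              using AB \<delta> by (intro divide_left_mono mult_mono power_mono mult_pos_pos) auto
            also have "\<dots> = (norm (w - z) / \<delta> ^ 3) * norm (a n)" by (simp add: power3_eq_cube power2_eq_square mult_ac)
            finally show ?thesis .
          qed (simp add: b_def b'_def)
          then have "Lp_norm p (ae_class (synth (\<lambda>n. 1 / (w - z) * (b w n - b z n) - b' z n))) \<le> C * (norm (w - z) / \<delta> ^ 3)"
            using \<delta> by (intro C(2)) auto
          then show ?case
            unfolding \<phi>_def synth_linear[OF rb[OF elim(1)] rb[OF z] rb'[OF z]] by (simp add: Lp_norm_def)
        qed
        moreover
        have "((\<lambda>w. C * (norm (w - z) / \<delta> ^ 3)) \<longlongrightarrow> C * (norm (z - z) / \<delta> ^ 3)) (at z)"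
          using \<delta> by (intro tendsto_intros) auto
        then have "((\<lambda>w. C * (norm (w - z) / \<delta> ^ 3)) \<longlongrightarrow> 0) (at z)" by simp
        ultimately show "((\<lambda>w. Lp_norm p (cscale (1 / (w - z)) (\<phi> w - \<phi> z) - ae_class (synth (b' z)))) \<longlongrightarrow> 0) (at z)"
          by (rule Lim_null_comparison)
      qed
    qed
    have sol: "\<phi> z \<in> Domain Te \<and> op_app Te (\<phi> z) - cscale z (\<phi> z) = ?x" if z: "z \<in> U" for z
    proof -
      obtain g where g: "g \<in> D_space \<alpha>" "\<And>t. t > 0 \<Longrightarrow> g t = synth (b z) t" using synth_D[OF rb[OF z]] by blast
      have "ae_class g = \<phi> z" unfolding \<phi>_def by (rule half_line_cong(2)[OF synth_measurable[OF rb[OF z]] g(2)])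
      then obtain h where h: "(\<phi> z, ae_class h) \<in> Te" using Te_D[OF g(1)] by auto
      have L: "\<phi> z \<in> Lp p" "ae_class h \<in> Lp p" using Te_Lp[OF h] by auto
      have "ae_class h - cscale z (\<phi> z) = ?x"
      proof (rule eq_if_coeffs_eq[OF Lp_diff[OF L(2) Lp_cscale[OF L(1)]] x])
        fix n
        have "coef (\<phi> z) n = b z n" unfolding \<phi>_def by (rule coeff_synth[OF rb[OF z]])
        then have "coef (ae_class h - cscale z (\<phi> z)) n = - of_nat n * b z n - z * b z n"
          unfolding pairing_diff[OF ell_majorized L(2) Lp_cscale[OF L(1)]] pairing_cscale(1)[OF ell_measurable]
            pairing_Te_ell[OF h] by simp
        also have "\<dots> = - ((of_nat n + z) * b z n)" by (simp add: algebra_simps)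
        also have "\<dots> = a n"
        proof (cases "a n = 0")
          case False
          then have "of_nat n + z \<noteq> 0" using gap[OF z False] \<delta> by auto
          then show ?thesis by (simp add: b_def)
        qed (simp add: b_def)
        finally show "coef (ae_class h - cscale z (\<phi> z)) n = coef ?x n"
          by (simp add: a_def)
      qed
      then show ?thesis using h op_app_eq[OF h] by auto
    qed
    show "z0 \<in> local_resolvent_set p Te ?x"
      unfolding local_resolvent_set_def using an sol \<delta>
      by (intro CollectI exI[of _ U] exI[of _ \<phi>]) (auto simp: U_def)
  qed
  then show ?thesis unfolding local_spectrum_def Z_def by blast
qed

text \<open>Every \<open>n\<close> with \<open>a\<^sub>n \<noteq> 0\<close> forces \<open>\<parallel>T\<^sub>e\<^sup>k f\<parallel> \<ge> c n\<^sup>k\<close>. An upper bound is needed only if the supremum is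
finite; then it is the largest such \<open>n\<close> (or 0), and the iterates are Laguerre series with coefficients
\<open>(- n)\<^sup>k a\<^sub>n\<close>.\<close>

theorem local_spectral_radius_D:
  assumes f: "f \<in> D_space \<alpha>"
  defines "a \<equiv> \<lambda>n. coef (ae_class f) n"
  shows "(\<lambda>k. ennreal (root k (Lp_norm p ((op_app Te ^^ k) (ae_class f)))))
    \<longlonglongrightarrow> (SUP z\<in>{- of_nat n | n. a n \<noteq> 0}. ennreal (cmod z))"
proof -
  let ?r = "\<lambda>k. root k (Lp_norm p ((op_app Te ^^ k) (ae_class f)))"
  define S where "S = (SUP z\<in>{- of_nat n | n. a n \<noteq> 0}. ennreal (cmod z))"
  have ra: "rapidly_decreasing a" unfolding a_def by (rule coeffs_rapidly_decreasing[OF f])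
  have S_upper: "ennreal (real n) \<le> S" if "a n \<noteq> 0" for n
    unfolding S_def using that by (intro SUP_upper2[of "- of_nat n"]) auto
  have root_lim: "(\<lambda>k. real m * root k C) \<longlonglongrightarrow> real m" if "C > 0" for C m
    using tendsto_mult[OF tendsto_const LIMSEQ_root_const[OF that], of "real m"] by simp
  have "(\<lambda>k. ennreal (?r k)) \<longlonglongrightarrow> S"
  proof (rule order_tendstoI)
    fix l assume "l < S"
    then obtain n where n: "a n \<noteq> 0" "l < ennreal (real n)"
      unfolding S_def less_SUP_iff by auto
    obtain C where C: "C \<ge> 0" "\<And>x. x \<in> Lp p \<Longrightarrow> norm (coef x n) \<le> C * Lp_norm p x"
      using pairing_bounded[OF ell_majorized] by blast
    have pos: "norm (a n) / (C + 1) > 0" using n(1) C(1) by simp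
    have lower: "real n * root k (norm (a n) / (C + 1)) \<le> ?r k" if k: "k \<ge> 1" for k
    proof -
      obtain g where g: "g \<in> D_space \<alpha>" "(op_app Te ^^ k) (ae_class f) = ae_class g"
        "\<And>n. coef (ae_class g) n = (- of_nat n) ^ k * a n"
        using D_iterate[OF f, of k] unfolding a_def by blast
      have "real n ^ k * norm (a n) \<le> C * Lp_norm p (ae_class g)"
        using C(2)[OF majorized_Lp[OF D_majorized[OF g(1)]]] unfolding g(3) by (simp add: norm_mult norm_power)
      also have "\<dots> \<le> (C + 1) * Lp_norm p (ae_class g)" by (intro mult_right_mono) (auto simp: Lp_norm_def)
      finally have "real n ^ k * (norm (a n) / (C + 1)) \<le> Lp_norm p (ae_class g)"
        using C(1) by (simp add: field_simps)
      then have "root k (real n ^ k * (norm (a n) / (C + 1))) \<le> root k (Lp_norm p (ae_class g))"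
        using k by (intro real_root_le_mono) auto
      moreover have "root k (real n ^ k) = real n" using k by (intro real_root_power_cancel) auto
      ultimately show ?thesis unfolding g(2) real_root_mult by (simp only:)
    qed
    have "(\<lambda>k. ennreal (real n * root k (norm (a n) / (C + 1)))) \<longlonglongrightarrow> ennreal (real n)"
      by (intro tendsto_ennrealI root_lim pos)
    then have "\<forall>\<^sub>F k in sequentially. l < ennreal (real n * root k (norm (a n) / (C + 1)))"
      by (rule order_tendstoD(1)[OF _ n(2)])
    then show "\<forall>\<^sub>F k in sequentially. l < ennreal (?r k)"
      using eventually_ge_at_top[of 1]
    proof eventually_elim
      case (elim k)
      then show ?case using ennreal_leI[OF lower[OF elim(2)]] by (rule_tac less_le_trans)
    qed
  next
    fix u assume u: "S < u"
    then have fin: "S < top" using top.not_eq_extremum by fastforce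
    have bound: "real n \<le> enn2real S" if "a n \<noteq> 0" for n
      using enn2real_mono[OF S_upper[OF that] fin] by simp
    have finite: "finite {n. a n \<noteq> 0}"
      by (rule finite_subset[of _ "{..nat \<lceil>enn2real S\<rceil>}"]) (auto dest!: bound simp: le_nat_iff, linarith)
    obtain M :: nat where M: "\<And>n. a n \<noteq> 0 \<Longrightarrow> n \<le> M" "ennreal (real M) \<le> S"
    proof (cases "{n. a n \<noteq> 0} = {}")
      case True
      show thesis by (rule that[of 0]) (use True in auto)
    next
      case False
      show thesis
        by (rule that[of "Max {n. a n \<noteq> 0}"]) (use Max_in[OF finite False] Max_ge[OF finite] S_upper in auto)
    qed
    obtain C where C: "C > 0" "\<And>b e. e \<ge> 0 \<Longrightarrow> (\<And>n. norm (b n) \<le> e * norm (a n)) \<Longrightarrow> Lp_norm p (ae_class (synth b)) \<le> C * e"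
      using synth_norm_bound[OF ra] by blast
    have upper: "?r k \<le> real M * root k C" if k: "k \<ge> 1" for k
    proof -
      obtain g where g: "g \<in> D_space \<alpha>" "(op_app Te ^^ k) (ae_class f) = ae_class g"
        "\<And>n. coef (ae_class g) n = (- of_nat n) ^ k * a n"
        using D_iterate[OF f, of k] unfolding a_def by blast
      define b where "b = (\<lambda>n. (- of_nat n) ^ k * a n)"
      have rb: "rapidly_decreasing b" unfolding b_def by (rule rapidly_decreasing_times_power[OF ra])
      have "ae_class g = ae_class (synth b)"
        by (rule eq_if_coeffs_eq[OF majorized_Lp[OF D_majorized[OF g(1)]] synth_Lp[OF rb]])
           (simp only: g(3) coeff_synth[OF rb], simp only: b_def)
      moreover have "norm (b n) \<le> real M ^ k * norm (a n)" for n
      proof (cases "a n = 0")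
        case False
        then have "real n ^ k \<le> real M ^ k" using M(1) by (intro power_mono) auto
        then show ?thesis by (simp add: b_def norm_mult norm_power mult_right_mono)
      qed (simp add: b_def)
      ultimately have "Lp_norm p (ae_class g) \<le> C * real M ^ k" using C(2)[of "real M ^ k" b] by simp
      then have "root k (Lp_norm p (ae_class g)) \<le> root k (C * real M ^ k)"
        using k by (intro real_root_le_mono) auto
      moreover have "root k (real M ^ k) = real M" using k by (intro real_root_power_cancel) auto
      ultimately show ?thesis unfolding g(2) real_root_mult by (simp only: mult.commute)
    qed
    have "(\<lambda>k. ennreal (real M * root k C)) \<longlonglongrightarrow> ennreal (real M)"
      by (intro tendsto_ennrealI root_lim C(1))
    then have "\<forall>\<^sub>F k in sequentially. ennreal (real M * root k C) < u"
      by (rule order_tendstoD(2)) (rule le_less_trans[OF M(2) u])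
    then show "\<forall>\<^sub>F k in sequentially. ennreal (?r k) < u"
      using eventually_ge_at_top[of 1]
    proof eventually_elim
      case (elim k)
      then show ?case using ennreal_leI[OF upper[OF elim(2)]] by (rule_tac le_less_trans)
    qed
  qed
  then show ?thesis unfolding S_def .
qed

end

theorem theorem3p7:
  fixes \<alpha> :: real and p :: ennreal and Te :: "(ae_fun \<times> ae_fun) set"
  assumes "\<alpha> > -1" and "1 \<le> p"
    and "0 \<le> \<alpha> \<or> (-1 < \<alpha> \<and> \<alpha> < 0 \<and> ennreal (2 / (\<alpha> + 2)) < p \<and> p < ennreal (- 2 / \<alpha>))"
    and "linear_operator p Te"
    and "T_op \<alpha> \<subseteq> Te" and "Te \<subseteq> T_max p \<alpha>"
  shows "has_SVEP p Te \<and>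
    (\<forall>f\<in>D_space \<alpha>.
      (\<lambda>n. ennreal (root n (Lp_norm p ((op_app Te ^^ n) (ae_class f)))))
        \<longlonglongrightarrow> (SUP z\<in>{- of_nat n | n. laguerre_transform \<alpha> f n \<noteq> 0}. ennreal (cmod z)) \<and>
      local_spectrum p Te (ae_class f) = {- of_nat n | n. laguerre_transform \<alpha> f n \<noteq> 0} \<and>
      (\<lambda>n. ennreal (root n (Lp_norm p ((op_app Te ^^ n) (ae_class f)))))
        \<longlonglongrightarrow> (SUP z\<in>local_spectrum p Te (ae_class f). ennreal (cmod z)))"
proof -
  interpret laguerre_operator \<alpha> p Te
    using assms by unfold_locales
  have "(\<lambda>n. ennreal (root n (Lp_norm p ((op_app Te ^^ n) (ae_class f)))))
        \<longlonglongrightarrow> (SUP z\<in>{- of_nat n | n. laguerre_transform \<alpha> f n \<noteq> 0}. ennreal (cmod z))"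
    "local_spectrum p Te (ae_class f) = {- of_nat n | n. laguerre_transform \<alpha> f n \<noteq> 0}"
    if f: "f \<in> D_space \<alpha>" for f
    unfolding transform_eq_pairing[OF f]
    by (rule local_spectral_radius_D[OF f], rule local_spectrum_D[OF f])
  then show ?thesis using has_SVEP by simp
qed

end
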